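(* Let $d\ge2$ and consider maps on $M_d(\mathbb{C})$. (A) If $\Phi$ is an extreme CQ map, then $\Phi$ is an extreme point of the set of EBT maps. (B) If $\Phi$ is an extreme CQ map, then $\Phi$ is an extreme point of the set of CPT maps if and only if, when it is written in the form $\Phi(\rho)=\sum_{k}|\psi_k\rangle\langle\psi_k|\,\langle e_k,\rho\,e_k\rangle$ with $\{e_k\}$ an orthonormal basis and $\psi_k$ unit vectors, one has $\langle\psi_j,\psi_k\rangle\ne0$ for all $j,k$. (C) If $\Phi$ is both in the set of EBT maps and an extreme point of the set of CPT maps, then $\Phi$ is an extreme CQ map. (D) When $d=2$, the extreme points of the set of EBT maps are precisely the extreme CQ maps. When $d\ge3$, there are extreme points of the set of EBT maps which are not CQ maps.
   Context: $M_d(\mathbb{C})$ is the algebra of complex $d\times d$ matrices. A CPT map is a linear map $\Phi:M_d(\mathbb{C})\to M_d(\mathbb{C})$ that is completely positive and trace-preserving; the set of CPT maps is convex. A density matrix (positive semi-definite, trace one) on a tensor product of two finite-dimensional Hilbert spaces is separable if it is a convex combination of tensor products of density matrices. A CPT map $\Phi$ is EBT (entanglement breaking and trace-preserving) if $(I\otimes\Phi)(\Gamma)$ is separable for every density matrix $\Gamma$ on $\mathbb{C}^n\otimes\mathbb{C}^d$ and every $n\ge1$; the set of EBT maps is convex. A map $\Phi$ is classical-quantum (CQ) if there are an orthonormal basis $\{e_k\}_{k=1}^d$ of $\mathbb{C}^d$ and density matrices $R_1,\dots,R_d$ on $\mathbb{C}^d$ (not necessarily distinct) with $\Phi(\rho)=\sum_{k=1}^dR_k\,\langle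 e_k,\rho\,e_k\rangle$ for all $\rho$. It is an extreme CQ map if it can be so written with every $R_k=|\psi_k\rangle\langle\psi_k|$ a pure state ($\psi_k$ a unit vector); the $\psi_k$ need not be orthogonal, linearly independent or distinct. *)

theory Defs
  imports "HOL-Analysis.Analysis"
begin

text \<open>
  The dimension \<open>d\<close> is \<open>CARD('d)\<close>. The second tensor dimension \<open>n\<close> is quantified inside the
  definitions below, so operators on \<open>\<complex>\<^sup>n \<otimes> \<complex>\<^sup>d\<close> are kernels \<open>nat \<times> 'd \<Rightarrow> nat \<times> 'd \<Rightarrow> complex\<close>
  (row index first) that are only inspected on \<open>{..<n} \<times> UNIV\<close>.
\<close>

type_synonym 'd cmat = "complex^'d^'d"

definition cmat_scale :: "complex \<Rightarrow> 'd::finite cmat \<Rightarrow> 'd cmat" where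
  "cmat_scale c = map_matrix ((*) c)"

definition entries :: "'d::finite cmat \<Rightarrow> 'd \<Rightarrow> 'd \<Rightarrow> complex" where
  "entries A = (\<lambda>i j. A $ i $ j)"


subsection \<open>States\<close>

definition psd_on :: "'i set \<Rightarrow> ('i \<Rightarrow> 'i \<Rightarrow> complex) \<Rightarrow> bool" where
  "psd_on I A \<longleftrightarrow> (\<forall>v. (\<Sum>i\<in>I. \<Sum>j\<in>I. cnj (v i) * A i j * v j) \<in> \<real>\<^sub>\<ge>\<^sub>0)"

definition density_on :: "'i set \<Rightarrow> ('i \<Rightarrow> 'i \<Rightarrow> complex) \<Rightarrow> bool" where
  "density_on I A \<longleftrightarrow> psd_on I A \<and> (\<Sum>i\<in>I. A i i) = 1"

definition tensor_op ::
  "('i \<Rightarrow> 'i \<Rightarrow> complex) \<Rightarrow> ('j \<Rightarrow> 'j \<Rightarrow> complex) \<Rightarrow> 'i \<times> 'j \<Rightarrow> 'i \<times> 'j \<Rightarrow> complex" where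
  "tensor_op A B = (\<lambda>(i, k) (j, l). A i j * B k l)"

definition separable_on ::
  "'i set \<Rightarrow> 'j set \<Rightarrow> ('i \<times> 'j \<Rightarrow> 'i \<times> 'j \<Rightarrow> complex) \<Rightarrow> bool" where
  "separable_on I J \<Gamma> \<longleftrightarrow>
     (\<exists>(m::nat) (p :: nat \<Rightarrow> real) A B.
        (\<forall>s<m. 0 \<le> p s \<and> density_on I (A s) \<and> density_on J (B s)) \<and>
        (\<Sum>s<m. p s) = 1 \<and>
        (\<forall>x\<in>I \<times> J. \<forall>y\<in>I \<times> J.
           \<Gamma> x y = (\<Sum>s<m. complex_of_real (p s) * tensor_op (A s) (B s) x y)))"

definition density_matrix :: "'d::finite cmat \<Rightarrow> bool" where
  "density_matrix R \<longleftrightarrow> density_on UNIV (entries R)"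


subsection \<open>CPT and EBT maps\<close>

definition complex_linear :: "('d::finite cmat \<Rightarrow> 'd cmat) \<Rightarrow> bool" where
  "complex_linear \<Phi> \<longleftrightarrow>
     (\<forall>A B. \<Phi> (A + B) = \<Phi> A + \<Phi> B) \<and> (\<forall>c A. \<Phi> (cmat_scale c A) = cmat_scale c (\<Phi> A))"

text \<open>\<open>I \<otimes> \<Phi>\<close> applies \<open>\<Phi>\<close> to each \<open>d \<times> d\<close> block of its argument.\<close>

definition id_tensor ::
  "('d::finite cmat \<Rightarrow> 'd cmat) \<Rightarrow> ('i \<times> 'd \<Rightarrow> 'i \<times> 'd \<Rightarrow> complex) \<Rightarrow> 'i \<times> 'd \<Rightarrow> 'i \<times> 'd \<Rightarrow> complex"
  where
  "id_tensor \<Phi> \<Gamma> = (\<lambda>(i, k) (j, l). \<Phi> (\<chi> k' l'. \<Gamma> (i, k') (j, l')) $ k $ l)"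

definition completely_positive :: "('d::finite cmat \<Rightarrow> 'd cmat) \<Rightarrow> bool" where
  "completely_positive \<Phi> \<longleftrightarrow>
     (\<forall>n::nat. n \<ge> 1 \<longrightarrow>
        (\<forall>\<Gamma>. psd_on ({..<n} \<times> UNIV) \<Gamma> \<longrightarrow> psd_on ({..<n} \<times> UNIV) (id_tensor \<Phi> \<Gamma>)))"

definition trace_preserving :: "('d::finite cmat \<Rightarrow> 'd cmat) \<Rightarrow> bool" where
  "trace_preserving \<Phi> \<longleftrightarrow> (\<forall>A. trace (\<Phi> A) = trace A)"

definition is_CPT :: "('d::finite cmat \<Rightarrow> 'd cmat) \<Rightarrow> bool" where
  "is_CPT \<Phi> \<longleftrightarrow> complex_linear \<Phi> \<and> completely_positive \<Phi> \<and> trace_preserving \<Phi>"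

definition is_EBT :: "('d::finite cmat \<Rightarrow> 'd cmat) \<Rightarrow> bool" where
  "is_EBT \<Phi> \<longleftrightarrow> is_CPT \<Phi> \<and>
     (\<forall>n::nat. n \<ge> 1 \<longrightarrow>
        (\<forall>\<Gamma>. density_on ({..<n} \<times> UNIV) \<Gamma> \<longrightarrow>
             separable_on {..<n} UNIV (id_tensor \<Phi> \<Gamma>)))"

text \<open>
  The real vector space in which extreme points are taken is the type of bounded real-linear
  maps on matrices. Boundedness is no restriction in finite dimension, so every complex-linear
  map is represented.
\<close>

type_synonym 'd superop = "'d cmat \<Rightarrow>\<^sub>L 'd cmat"

lemma complex_linear_imp_bounded_linear:
  fixes \<Phi> :: "'d::finite cmat \<Rightarrow> 'd cmat"
  assumes "complex_linear \<Phi>"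
  shows "bounded_linear \<Phi>"
proof -
  have sc: "r *\<^sub>R A = cmat_scale (complex_of_real r) A" for r and A :: "'d cmat"
    by (simp add: vec_eq_iff cmat_scale_def map_matrix_def scaleR_conv_of_real[where 'a = complex])
  have "linear \<Phi>"
    using assms by (intro linearI) (simp_all add: complex_linear_def sc)
  then show ?thesis
    by (simp add: linear_conv_bounded_linear)
qed

definition CPT_maps :: "'d::finite superop set" where
  "CPT_maps = {\<Phi>. is_CPT (blinfun_apply \<Phi>)}"

definition EBT_maps :: "'d::finite superop set" where
  "EBT_maps = {\<Phi>. is_EBT (blinfun_apply \<Phi>)}"


subsection \<open>Classical-quantum maps\<close>

definition cinner :: "complex^'d::finite \<Rightarrow> complex^'d \<Rightarrow> complex" where
  "cinner u v = (\<Sum>i\<in>UNIV. cnj (u $ i) * v $ i)"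

definition orthonormal_basis :: "('d::finite \<Rightarrow> complex^'d) \<Rightarrow> bool" where
  "orthonormal_basis e \<longleftrightarrow>
     (\<forall>j k. cinner (e j) (e k) = (if j = k then 1 else 0)) \<and> vec.span (range e) = UNIV"

definition pure_state :: "complex^'d::finite \<Rightarrow> 'd cmat" where
  "pure_state \<psi> = (\<chi> i j. \<psi> $ i * cnj (\<psi> $ j))"

definition CQ_form ::
  "('d::finite \<Rightarrow> complex^'d) \<Rightarrow> ('d \<Rightarrow> 'd cmat) \<Rightarrow> ('d cmat \<Rightarrow> 'd cmat) \<Rightarrow> bool" where
  "CQ_form e R \<Phi> \<longleftrightarrow> orthonormal_basis e \<and> (\<forall>k. density_matrix (R k)) \<and>
     (\<forall>\<rho>. \<Phi> \<rho> = (\<Sum>k\<in>UNIV. cmat_scale (cinner (e k) (\<rho> *v e k)) (R k)))"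

definition pure_CQ_form ::
  "('d::finite \<Rightarrow> complex^'d) \<Rightarrow> ('d \<Rightarrow> complex^'d) \<Rightarrow> ('d cmat \<Rightarrow> 'd cmat) \<Rightarrow> bool" where
  "pure_CQ_form e \<psi> \<Phi> \<longleftrightarrow> (\<forall>k. norm (\<psi> k) = 1) \<and> CQ_form e (\<lambda>k. pure_state (\<psi> k)) \<Phi>"

definition CQ_map :: "('d::finite cmat \<Rightarrow> 'd cmat) \<Rightarrow> bool" where
  "CQ_map \<Phi> \<longleftrightarrow> (\<exists>e R. CQ_form e R \<Phi>)"

definition extreme_CQ_map :: "('d::finite cmat \<Rightarrow> 'd cmat) \<Rightarrow> bool" where
  "extreme_CQ_map \<Phi> \<longleftrightarrow> (\<exists>e \<psi>. pure_CQ_form e \<psi> \<Phi>)"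

end

theory Submission
  imports Defs
begin

text \<open>
  An entanglement breaking map is a sum of atoms \<open>\<rho> \<mapsto> |\<phi>\<rangle>\<langle>\<phi>| \<langle>x, \<rho> x\<rangle>\<close>, i.e. it has rank one Kraus
  operators \<open>|\<phi>\<rangle>\<langle>x|\<close>, and the Kraus operators of a map below \<open>\<Phi>\<close> lie in the span of those of \<open>\<Phi>\<close>.

  For an extreme CQ map this forces the Kraus operators \<open>B\<close> of a component to satisfy
  \<open>B e\<^sub>k = b\<^sub>k \<psi>\<^sub>k\<close>, and trace preservation then determines the component, which gives (A) and one
  half of (B). Conversely, if \<open>\<Phi>\<close> is extreme among the CPT maps, \<open>A\<close> is a Kraus operator and \<open>Z\<close> is
  in the span of the Kraus operators with \<open>A\<^sup>* Z = 0\<close>, then \<open>\<rho> \<mapsto> A \<rho> Z\<^sup>* + Z \<rho> A\<^sup>*\<close> is an admissible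
  perturbation, so \<open>Z = 0\<close>. This gives the other half of (B), and it shows for (C) that in a
  representation with as few atoms as possible the vectors \<open>x\<close> are linearly independent. As
  \<open>\<Sum> |x\<rangle>\<langle>x| = 1\<close>, they are then an orthonormal basis.

  For \<open>d = 2\<close>, suppose a shortest representation of an extreme EBT map has three or more atoms. No two of
  its vectors \<open>x\<close>, and no two of its vectors \<open>\<phi>\<close>, are parallel, so after rescaling three of the
  atoms are \<open>(f, p)\<close>, \<open>(g, q)\<close>, \<open>(f + g, p + q)\<close>. Their sum is
  interior to the moment cone generated by all \<open>(s f + t g, s p + t q)\<close> with real \<open>s, t\<close>, which is
  five-dimensional, whereas trace preservation imposes only three conditions; so it can be perturbed.
  For \<open>d \<ge> 3\<close> there are atoms with nonorthogonal \<open>x\<close> whose Kraus operators are, up to scalars, the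
  only product operators in their span.
\<close>

subsection \<open>Positive semidefinite kernels\<close>

lemma nonneg_Reals_eq: "z \<in> \<real>\<^sub>\<ge>\<^sub>0 \<longleftrightarrow> Re z \<ge> 0 \<and> Im z = 0" for z :: complex
  by (auto simp: complex_nonneg_Reals_iff)

lemma psd_onD: "psd_on I A \<Longrightarrow> (\<Sum>i\<in>I. \<Sum>j\<in>I. cnj (v i) * A i j * v j) \<in> \<real>\<^sub>\<ge>\<^sub>0"
  by (simp add: psd_on_def)

lemma psd_on_cong:
  assumes "\<And>i j. i \<in> I \<Longrightarrow> j \<in> I \<Longrightarrow> A i j = B i j" "psd_on I A"
  shows "psd_on I B"
  using assms unfolding psd_on_def by (simp cong: sum.cong)

lemma psd_on_subset:
  assumes "psd_on J A" "I \<subseteq> J" "finite J"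
  shows "psd_on I A"
  unfolding psd_on_def
proof
  fix v
  have "(\<Sum>i\<in>J. \<Sum>j\<in>J. cnj (if i \<in> I then v i else 0) * A i j * (if j \<in> I then v j else 0))
     = (\<Sum>i\<in>I. \<Sum>j\<in>I. cnj (v i) * A i j * v j)"
    using assms(2,3)
    by (intro sum.mono_neutral_cong_right) (auto intro!: sum.mono_neutral_cong_right)
  then show "(\<Sum>i\<in>I. \<Sum>j\<in>I. cnj (v i) * A i j * v j) \<in> \<real>\<^sub>\<ge>\<^sub>0"
    using psd_onD[OF assms(1), of "\<lambda>i. if i \<in> I then v i else 0"] by simp
qed

lemma psd_on_two:
  assumes "psd_on I A" "finite I" "i \<in> I" "j \<in> I" "i \<noteq> j"
  shows "cnj a * A i i * a + cnj a * A i j * b + cnj b * A j i * a + cnj b * A j j * b \<in> \<real>\<^sub>\<ge>\<^sub>0"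
proof -
  have "psd_on {i, j} A"
    using assms by (intro psd_on_subset[OF assms(1)]) auto
  from psd_onD[OF this, of "\<lambda>k. if k = i then a else b"] show ?thesis
    using assms(5) by (simp add: add.assoc)
qed

lemma psd_on_diag:
  assumes "psd_on I A" "finite I" "i \<in> I"
  shows "A i i \<in> \<real>\<^sub>\<ge>\<^sub>0"
proof -
  have "psd_on {i} A"
    using assms by (intro psd_on_subset[OF assms(1)]) auto
  from psd_onD[OF this, of "\<lambda>_. 1"] show ?thesis by simp
qed

text \<open>Evaluating the form at \<open>(1, 1)\<close> and at \<open>(1, \<i>)\<close> on the two
  indices gives the imaginary and the real part of the claim.\<close>

lemma psd_on_hermitian:
  assumes "psd_on I A" "finite I" "i \<in> I" "j \<in> I"
  shows "A j i = cnj (A i j)"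
proof (cases "i = j")
  case True
  then show ?thesis
    using psd_on_diag[OF assms(1,2), of i] assms(3) by (auto simp: nonneg_Reals_eq complex_eq_iff)
next
  case False
  note two = psd_on_two[OF assms False] and d = psd_on_diag[OF assms(1,2)]
  have "Im (A i j) + Im (A j i) = 0"
    using two[of 1 1] d[OF assms(3)] d[OF assms(4)] by (auto simp: nonneg_Reals_eq)
  moreover have "Re (A i j) - Re (A j i) = 0"
    using two[of 1 \<i>] d[OF assms(3)] d[OF assms(4)] by (auto simp: nonneg_Reals_eq)
  ultimately show ?thesis by (auto simp: complex_eq_iff)
qed

text \<open>With \<open>A i i = 0\<close> the form at \<open>(t * A i j, 1)\<close> is affine in the
  real number \<open>t\<close> with slope \<open>2 * (cmod (A i j))\<^sup>2\<close>, so a nonzero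
  slope would make it negative somewhere.\<close>

lemma psd_on_zero_row:
  assumes "psd_on I A" "finite I" "i \<in> I" "j \<in> I" "A i i = 0"
  shows "A i j = 0"
proof (rule ccontr)
  assume nz: "A i j \<noteq> 0"
  then have ij: "i \<noteq> j" using assms(5) by auto
  define n where "n = (cmod (A i j))\<^sup>2"
  have n: "n > 0" using nz by (simp add: n_def)
  have nn: "A i j * cnj (A i j) = of_real n"
    unfolding n_def by (rule complex_norm_square[symmetric])
  \<comment> \<open>This \<open>t\<close> gives the form the value
    \<open>- A j j - 2\<close>.\<close>
  define t where "t = - (Re (A j j) + 1) / n"
  have "cnj (of_real t * A i j) * A i j * 1 + cnj 1 * A j i * (of_real t * A i j) + cnj 1 * A j j * 1
      \<in> \<real>\<^sub>\<ge>\<^sub>0"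
    using psd_on_two[OF assms(1-4) ij, of "of_real t * A i j" 1] assms(5) by simp
  then have "complex_of_real t * of_real n + of_real t * of_real n + A j j \<in> \<real>\<^sub>\<ge>\<^sub>0"
    unfolding psd_on_hermitian[OF assms(1-4)] using nn by (simp add: mult.assoc mult.left_commute mult.commute[of "cnj (A i j)"])
  then have "2 * (t * n) + Re (A j j) \<ge> 0"
    by (simp add: nonneg_Reals_eq mult.commute)
  then have "- Re (A j j) - 2 \<ge> 0"
    using n by (simp add: t_def)
  then show False
    using psd_on_diag[OF assms(1,2,4)] by (simp add: nonneg_Reals_eq)
qed

text \<open>If \<open>v\<close> is extended by the value at \<open>x\<close> that minimises the
  form, then the form of \<open>A\<close> at the extension is the form of the Schur complement at
  \<open>v\<close>.\<close>

lemma psd_on_Schur_complement: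
  assumes "psd_on (insert x F) A" "finite F" "x \<notin> F" "A x x \<noteq> 0"
  shows "psd_on F (\<lambda>i j. A i j - A i x * A x j / A x x)"
  unfolding psd_on_def
proof
  fix v :: "'a \<Rightarrow> complex"
  define r where "r = (\<Sum>j\<in>F. A x j * v j)"
  define l where "l = (\<Sum>j\<in>F. cnj (v j) * A j x)"
  define w where "w = (\<lambda>i. if i = x then - r / A x x else v i)"
  have herm: "A j x = cnj (A x j)" if "j \<in> F" for j
    using assms(2) that by (intro psd_on_hermitian[OF assms(1)]) auto
  have axx: "cnj (A x x) = A x x"
    using psd_on_hermitian[OF assms(1), of x x] assms(2) by simp
  have lr: "cnj r = l"
    unfolding l_def r_def by (simp add: herm mult.commute)
  have wF: "w i = v i" if "i \<in> F" for i using that assms(3) by (auto simp: w_def)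
  have "(\<Sum>i\<in>insert x F. \<Sum>j\<in>insert x F. cnj (w i) * A i j * w j)
     = (cnj (w x) * A x x * w x + (\<Sum>j\<in>F. cnj (w x) * A x j * v j))
       + ((\<Sum>i\<in>F. cnj (v i) * A i x * w x) + (\<Sum>i\<in>F. \<Sum>j\<in>F. cnj (v i) * A i j * v j))"
    using assms(2,3) by (simp add: wF sum.distrib)
  also have "(\<Sum>j\<in>F. cnj (w x) * A x j * v j) = cnj (w x) * r"
    by (simp add: r_def sum_distrib_left mult.assoc)
  also have "(\<Sum>i\<in>F. cnj (v i) * A i x * w x) = l * w x"
    by (simp add: l_def sum_distrib_right)
  also have "(cnj (w x) * A x x * w x + cnj (w x) * r)
      + (l * w x + (\<Sum>i\<in>F. \<Sum>j\<in>F. cnj (v i) * A i j * v j))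
      = (\<Sum>i\<in>F. \<Sum>j\<in>F. cnj (v i) * A i j * v j) - l * r / A x x"
    using assms(4) by (simp add: w_def lr axx field_simps)
  also have "l * r / A x x = (\<Sum>i\<in>F. \<Sum>j\<in>F. cnj (v i) * (A i x * A x j / A x x) * v j)"
    unfolding l_def r_def sum_product sum_divide_distrib by (simp add: mult_ac)
  also have "(\<Sum>i\<in>F. \<Sum>j\<in>F. cnj (v i) * A i j * v j) - \<dots>
      = (\<Sum>i\<in>F. \<Sum>j\<in>F. cnj (v i) * (A i j - A i x * A x j / A x x) * v j)"
    by (simp add: sum_subtractf[symmetric] algebra_simps)
  finally show "(\<Sum>i\<in>F. \<Sum>j\<in>F. cnj (v i) * (A i j - A i x * A x j / A x x) * v j) \<in> \<real>\<^sub>\<ge>\<^sub>0"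
    using psd_onD[OF assms(1), of w] by simp
qed

text \<open>Cholesky factorisation: each index is eliminated by splitting off its column divided by
  the square root of the pivot. A zero pivot forces a zero row and column and contributes no
  term.\<close>

lemma psd_on_decomp:
  assumes "finite I" "psd_on I A"
  shows "\<exists>(n::nat) w. \<forall>i\<in>I. \<forall>j\<in>I. A i j = (\<Sum>s<n. w s i * cnj (w s j))"
  using assms
proof (induction I arbitrary: A rule: finite_induct)
  case empty
  then show ?case by simp
next
  case (insert x F)
  have herm: "A j i = cnj (A i j)" if "i \<in> insert x F" "j \<in> insert x F" for i j
    using insert.hyps that by (intro psd_on_hermitian[OF insert.prems]) auto
  show ?case
  proof (cases "A x x = 0")
    case True
    have row: "A x j = 0" "A j x = 0" if "j \<in> insert x F" for j
      using psd_on_zero_row[OF insert.prems _ _ that True] insert.hyps herm[OF _ that, of x] by simp_all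
    have "psd_on F A"
      using insert.hyps by (intro psd_on_subset[OF insert.prems]) auto
    from insert.IH[OF this] obtain n :: nat and w
      where w: "\<forall>i\<in>F. \<forall>j\<in>F. A i j = (\<Sum>s<n. w s i * cnj (w s j))" by blast
    define w' where "w' = (\<lambda>s. (w s)(x := 0))"
    have w'F: "w' s i = w s i" if "i \<in> F" for s i
      using that insert.hyps by (auto simp: w'_def)
    have w'x: "w' s x = 0" for s
      by (simp add: w'_def)
    have "\<forall>i\<in>insert x F. \<forall>j\<in>insert x F. A i j = (\<Sum>s<n. w' s i * cnj (w' s j))"
      using row w by (auto simp: w'F w'x)
    then show ?thesis by blast
  next
    case False
    define \<alpha> where "\<alpha> = Re (A x x)"
    have \<alpha>: "A x x = of_real \<alpha>" "\<alpha> > 0"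
      using psd_on_diag[OF insert.prems, of x] insert.hyps False
      by (auto simp: nonneg_Reals_eq complex_eq_iff \<alpha>_def)
    from insert.IH[OF psd_on_Schur_complement[OF insert.prems insert.hyps False]]
    obtain n :: nat and w where
      w: "\<forall>i\<in>F. \<forall>j\<in>F. A i j - A i x * A x j / A x x = (\<Sum>s<n. w s i * cnj (w s j))" by blast
    define w' where "w' = (\<lambda>s. if s < n then (w s)(x := 0) else (\<lambda>i. A i x / of_real (sqrt \<alpha>)))"
    have "A i j = (\<Sum>s<Suc n. w' s i * cnj (w' s j))" if "i \<in> insert x F" "j \<in> insert x F" for i j
    proof -
      have w'F: "w' s k = w s k" if "k \<in> F" "s < n" for s k
        using that insert.hyps by (auto simp: w'_def)
      have w'x: "w' s x = 0" if "s < n" for s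
        using that by (simp add: w'_def)
      have "w' n i * cnj (w' n j) = A i x * A x j / A x x"
        using herm[OF _ that(2), of x] \<alpha>
        by (simp add: w'_def of_real_mult[symmetric] del: of_real_mult)
      moreover have "(\<Sum>s<n. w' s i * cnj (w' s j)) = A i j - A i x * A x j / A x x"
        using w that False by (auto simp: w'F w'x)
      ultimately show ?thesis by simp
    qed
    then show ?thesis by blast
  qed
qed

lemma psd_on_outer: "psd_on I (\<lambda>i j. w i * cnj (w j))"
  unfolding psd_on_def
proof
  fix v
  have "(\<Sum>i\<in>I. \<Sum>j\<in>I. cnj (v i) * (w i * cnj (w j)) * v j)
      = (\<Sum>i\<in>I. cnj (v i) * w i) * cnj (\<Sum>i\<in>I. cnj (v i) * w i)"
    unfolding cnj_sum sum_product by (simp add: mult_ac)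
  also have "\<dots> = complex_of_real ((cmod (\<Sum>i\<in>I. cnj (v i) * w i))\<^sup>2)"
    by (rule complex_norm_square[symmetric])
  finally show "(\<Sum>i\<in>I. \<Sum>j\<in>I. cnj (v i) * (w i * cnj (w j)) * v j) \<in> \<real>\<^sub>\<ge>\<^sub>0"
    by (simp add: nonneg_Reals_eq)
qed

lemma psd_on_zero: "psd_on I (\<lambda>i j. 0)"
  by (simp add: psd_on_def)

lemma psd_on_add:
  assumes "psd_on I A" "psd_on I B"
  shows "psd_on I (\<lambda>i j. A i j + B i j)"
  using assms unfolding psd_on_def
  by (simp add: distrib_left distrib_right sum.distrib nonneg_Reals_add_I)

lemma psd_on_sum: "(\<And>s. s \<in> S \<Longrightarrow> psd_on I (A s)) \<Longrightarrow> psd_on I (\<lambda>i j. \<Sum>s\<in>S. A s i j)"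
  by (induction S rule: infinite_finite_induct) (auto intro: psd_on_zero psd_on_add)

lemma psd_on_scale:
  assumes "psd_on I A" "c \<ge> 0"
  shows "psd_on I (\<lambda>i j. complex_of_real c * A i j)"
  unfolding psd_on_def
proof
  fix v
  have "(\<Sum>i\<in>I. \<Sum>j\<in>I. cnj (v i) * (complex_of_real c * A i j) * v j)
     = complex_of_real c * (\<Sum>i\<in>I. \<Sum>j\<in>I. cnj (v i) * A i j * v j)"
    by (simp add: sum_distrib_left mult_ac)
  then show "(\<Sum>i\<in>I. \<Sum>j\<in>I. cnj (v i) * (complex_of_real c * A i j) * v j) \<in> \<real>\<^sub>\<ge>\<^sub>0"
    using psd_onD[OF assms(1), of v] assms(2) by (simp add: nonneg_Reals_eq)
qed

section \<open>Trace normalisation and separability\<close>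

lemma psd_on_normalize:
  assumes "psd_on I G" "finite I" "I \<noteq> {}"
  obtains A where "density_on I A"
    and "\<And>i j. i \<in> I \<Longrightarrow> j \<in> I \<Longrightarrow> G i j = complex_of_real (\<Sum>i\<in>I. Re (G i i)) * A i j"
proof -
  define t where "t = (\<Sum>i\<in>I. Re (G i i))"
  have diag: "G i i = complex_of_real (Re (G i i))" "Re (G i i) \<ge> 0" if "i \<in> I" for i
    using psd_on_diag[OF assms(1,2) that] by (auto simp: nonneg_Reals_eq complex_eq_iff)
  have t0: "t \<ge> 0" unfolding t_def by (intro sum_nonneg diag)
  show ?thesis
  proof (cases "t = 0")
    case True
    then have "\<forall>i\<in>I. Re (G i i) = 0"
      unfolding t_def using diag(2) assms(2) by (subst (asm) sum_nonneg_eq_0_iff) auto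
    then have "G i i = 0" if "i \<in> I" for i
      using that diag(1)[OF that] by simp
    then have G0: "G i j = 0" if "i \<in> I" "j \<in> I" for i j
      using that psd_on_zero_row[OF assms(1,2)] by blast
    \<comment> \<open>With trace zero \<open>G\<close> vanishes, so any density matrix will do; the
      projection onto a basis vector is taken.\<close>
    obtain i0 where i0: "i0 \<in> I" using assms(3) by blast
    have "density_on I (\<lambda>i j. (if i = i0 then 1 else 0) * cnj (if j = i0 then 1 else 0))"
      unfolding density_on_def using psd_on_outer[of I "\<lambda>i. if i = i0 then 1 else 0"] i0 assms(2)
      by (simp add: if_distrib[of "\<lambda>x. x * _"] sum.delta cong: if_cong)
    then show ?thesis
      using that G0 True by (simp add: t_def)
  next
    case False
    have "density_on I (\<lambda>i j. complex_of_real (1 / t) * G i j)"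
      unfolding density_on_def
    proof
      show "psd_on I (\<lambda>i j. complex_of_real (1 / t) * G i j)"
        using t0 by (intro psd_on_scale assms(1)) simp
      have "(\<Sum>i\<in>I. G i i) = complex_of_real t"
        unfolding t_def of_real_sum using diag by (intro sum.cong) auto
      then show "(\<Sum>i\<in>I. complex_of_real (1 / t) * G i i) = 1"
        using False by (simp add: sum_divide_distrib[symmetric])
    qed
    then show ?thesis
      by (rule that) (use False in \<open>simp add: t_def[symmetric]\<close>)
  qed
qed

text \<open>Unnormalised positive factors suffice: their traces are moved into the weights
  \<open>p\<close>, and the trace of \<open>\<Gamma>\<close> makes these sum to one.\<close>

lemma separable_onI:
  fixes G :: "nat \<Rightarrow> 'i \<Rightarrow> 'i \<Rightarrow> complex" and H :: "nat \<Rightarrow> 'j \<Rightarrow> 'j \<Rightarrow> complex"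
  assumes "finite I" "I \<noteq> {}" "finite J" "J \<noteq> {}"
    and "\<And>s. s < m \<Longrightarrow> psd_on I (G s)" "\<And>s. s < m \<Longrightarrow> psd_on J (H s)"
    and \<Gamma>: "\<And>x y. x \<in> I \<times> J \<Longrightarrow> y \<in> I \<times> J \<Longrightarrow> \<Gamma> x y = (\<Sum>s<m. tensor_op (G s) (H s) x y)"
    and tr: "(\<Sum>x\<in>I \<times> J. \<Gamma> x x) = 1"
  shows "separable_on I J \<Gamma>"
proof -
  define a where "a = (\<lambda>s. \<Sum>i\<in>I. Re (G s i i))"
  define b where "b = (\<lambda>s. \<Sum>j\<in>J. Re (H s j j))"
  have "\<exists>A. density_on I A \<and> (\<forall>i\<in>I. \<forall>j\<in>I. G s i j = complex_of_real (a s) * A i j)"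
    if "s < m" for s
    using psd_on_normalize[OF assms(5)[OF that] assms(1,2)] unfolding a_def by metis
  then obtain A where A: "\<And>s. s < m \<Longrightarrow> density_on I (A s)"
    "\<And>s i j. s < m \<Longrightarrow> i \<in> I \<Longrightarrow> j \<in> I \<Longrightarrow> G s i j = complex_of_real (a s) * A s i j"
    by metis
  have "\<exists>B. density_on J B \<and> (\<forall>i\<in>J. \<forall>j\<in>J. H s i j = complex_of_real (b s) * B i j)"
    if "s < m" for s
    using psd_on_normalize[OF assms(6)[OF that] assms(3,4)] unfolding b_def by metis
  then obtain B where B: "\<And>s. s < m \<Longrightarrow> density_on J (B s)"
    "\<And>s i j. s < m \<Longrightarrow> i \<in> J \<Longrightarrow> j \<in> J \<Longrightarrow> H s i j = complex_of_real (b s) * B s i j"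
    by metis
  define p where "p = (\<lambda>s. a s * b s)"
  have p0: "p s \<ge> 0" if "s < m" for s
    unfolding p_def a_def b_def
    using psd_on_diag[OF assms(5)[OF that] assms(1)] psd_on_diag[OF assms(6)[OF that] assms(3)]
    by (intro mult_nonneg_nonneg sum_nonneg) (auto simp: nonneg_Reals_eq)
  have dec: "\<Gamma> x y = (\<Sum>s<m. complex_of_real (p s) * tensor_op (A s) (B s) x y)"
    if "x \<in> I \<times> J" "y \<in> I \<times> J" for x y
    unfolding \<Gamma>[OF that]
    by (intro sum.cong refl) (use that A(2) B(2) in \<open>auto simp: tensor_op_def p_def\<close>)
  have trT: "(\<Sum>x\<in>I \<times> J. tensor_op (A s) (B s) x x) = 1" if "s < m" for s
  proof -
    have "(\<Sum>x\<in>I \<times> J. tensor_op (A s) (B s) x x) = (\<Sum>i\<in>I. A s i i) * (\<Sum>j\<in>J. B s j j)"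
      unfolding sum_product sum.cartesian_product by (intro sum.cong) (auto simp: tensor_op_def)
    then show ?thesis using A(1)[OF that] B(1)[OF that] by (simp add: density_on_def)
  qed
  have "(\<Sum>x\<in>I \<times> J. \<Gamma> x x) = (\<Sum>x\<in>I \<times> J. \<Sum>s<m. complex_of_real (p s) * tensor_op (A s) (B s) x x)"
    using dec by (intro sum.cong) auto
  also have "\<dots> = (\<Sum>s<m. complex_of_real (p s) * (\<Sum>x\<in>I \<times> J. tensor_op (A s) (B s) x x))"
    by (subst sum.swap) (simp add: sum_distrib_left)
  also have "\<dots> = complex_of_real (\<Sum>s<m. p s)"
    using trT by simp
  finally have "(\<Sum>s<m. p s) = 1"
    using tr by (metis of_real_eq_1_iff)
  then show ?thesis
    unfolding separable_on_def using p0 A(1) B(1) dec by blast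
qed


subsection \<open>Kraus operators\<close>

definition mat_unit :: "'d::finite \<Rightarrow> 'd \<Rightarrow> 'd cmat" where
  "mat_unit a b = (\<chi> i j. if i = a \<and> j = b then 1 else 0)"

text \<open>The map \<open>\<rho> \<mapsto> B \<rho> B\<^sup>*\<close>. The operator is a kernel
  rather than a matrix so that the vectors supplied by \<open>psd_on_decomp\<close> can be reshaped
  into it directly.\<close>

definition kraus :: "('d::finite \<Rightarrow> 'd \<Rightarrow> complex) \<Rightarrow> 'd cmat \<Rightarrow> 'd cmat" where
  "kraus B \<rho> = (\<chi> i j. \<Sum>a\<in>UNIV. \<Sum>b\<in>UNIV. B i a * \<rho> $ a $ b * cnj (B j b))"

definition outer :: "complex^'d::finite \<Rightarrow> complex^'d \<Rightarrow> 'd \<Rightarrow> 'd \<Rightarrow> complex" where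
  "outer \<phi> x = (\<lambda>i a. \<phi> $ i * cnj (x $ a))"

definition atom :: "complex^'d::finite \<Rightarrow> complex^'d \<Rightarrow> 'd cmat \<Rightarrow> 'd cmat" where
  "atom x \<phi> \<rho> = cmat_scale (cinner x (\<rho> *v x)) (pure_state \<phi>)"

lemma cmat_scale_component [simp]: "cmat_scale c A $ i $ j = c * A $ i $ j"
  by (simp add: cmat_scale_def map_matrix_def)

lemma pure_state_component [simp]: "pure_state \<psi> $ i $ j = \<psi> $ i * cnj (\<psi> $ j)"
  by (simp add: pure_state_def)

lemma sum_delta2:
  fixes g :: "'d::finite \<Rightarrow> 'd \<Rightarrow> complex"
  shows "(\<Sum>a'\<in>UNIV. \<Sum>b'\<in>UNIV. if a' = a \<and> b' = b then g a' b' else 0) = g a b"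
proof -
  have "(\<Sum>b'\<in>UNIV. if a' = a \<and> b' = b then g a' b' else 0) = (if a' = a then g a b else 0)" for a'
    by (auto simp: sum.delta)
  then show ?thesis by (simp add: sum.delta)
qed

lemma kraus_mat_unit [simp]: "kraus B (mat_unit a b) $ i $ j = B i a * cnj (B j b)"
proof -
  have "kraus B (mat_unit a b) $ i $ j
      = (\<Sum>a'\<in>UNIV. \<Sum>b'\<in>UNIV. if a' = a \<and> b' = b then B i a' * cnj (B j b') else 0)"
    unfolding kraus_def mat_unit_def by (auto intro!: sum.cong)
  then show ?thesis by (simp add: sum_delta2)
qed

lemma cinner_matrix: "cinner x (\<rho> *v x) = (\<Sum>a\<in>UNIV. \<Sum>b\<in>UNIV. cnj (x $ a) * \<rho> $ a $ b * x $ b)"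
  by (simp add: cinner_def matrix_vector_mult_def sum_distrib_left mult.assoc)

lemma kraus_outer: "kraus (outer \<phi> x) = atom x \<phi>"
  by (rule ext)
    (simp add: vec_eq_iff kraus_def outer_def atom_def cinner_matrix sum_distrib_left sum_distrib_right mult_ac)

lemma complex_linear_sum:
  assumes "complex_linear f"
  shows "f (\<Sum>s\<in>S. g s) = (\<Sum>s\<in>S. f (g s))"
proof -
  have "f 0 + f 0 = f 0"
    using assms unfolding complex_linear_def by (metis add.right_neutral)
  then have "f 0 = 0" by simp
  then show ?thesis
    using assms by (induction S rule: infinite_finite_induct) (auto simp: complex_linear_def)
qed

lemma cmat_as_units: "\<rho> = (\<Sum>a\<in>UNIV. \<Sum>b\<in>UNIV. cmat_scale (\<rho> $ a $ b) (mat_unit a b))"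
proof -
  have "(\<Sum>a\<in>UNIV. \<Sum>b\<in>UNIV. cmat_scale (\<rho> $ a $ b) (mat_unit a b)) $ i $ j = \<rho> $ i $ j" for i j
  proof -
    have "(\<Sum>a\<in>UNIV. \<Sum>b\<in>UNIV. cmat_scale (\<rho> $ a $ b) (mat_unit a b)) $ i $ j
       = (\<Sum>a\<in>UNIV. \<Sum>b\<in>UNIV. if a = i \<and> b = j then \<rho> $ a $ b else 0)"
      by (auto simp: mat_unit_def intro!: sum.cong)
    then show ?thesis by (simp add: sum_delta2)
  qed
  then show ?thesis by (simp add: vec_eq_iff)
qed

lemma complex_linear_expand:
  assumes "complex_linear f"
  shows "f \<rho> $ i $ j = (\<Sum>a\<in>UNIV. \<Sum>b\<in>UNIV. \<rho> $ a $ b * f (mat_unit a b) $ i $ j)"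
proof -
  have "f \<rho> = (\<Sum>a\<in>UNIV. \<Sum>b\<in>UNIV. f (cmat_scale (\<rho> $ a $ b) (mat_unit a b)))"
    by (subst cmat_as_units) (simp add: complex_linear_sum[OF assms])
  then show ?thesis
    using assms by (simp add: complex_linear_def)
qed

lemma complex_linear_eqI:
  assumes "complex_linear f" "complex_linear g"
    and "\<And>a b i j. f (mat_unit a b) $ i $ j = g (mat_unit a b) $ i $ j"
  shows "f = g"
proof
  fix \<rho>
  show "f \<rho> = g \<rho>"
    by (simp add: vec_eq_iff complex_linear_expand[OF assms(1), of \<rho>]
        complex_linear_expand[OF assms(2), of \<rho>] assms(3))
qed

lemma complex_linear_kraus: "complex_linear (kraus B)"
  unfolding complex_linear_def
  by (auto simp: vec_eq_iff kraus_def sum.distrib distrib_left distrib_right sum_distrib_left mult_ac)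

lemma complex_linear_add_fun:
  "complex_linear f \<Longrightarrow> complex_linear g \<Longrightarrow> complex_linear (\<lambda>\<rho>. f \<rho> + g \<rho>)"
  unfolding complex_linear_def by (auto simp: vec_eq_iff algebra_simps)

lemma complex_linear_sum_fun:
  "(\<And>s. s \<in> S \<Longrightarrow> complex_linear (f s)) \<Longrightarrow> complex_linear (\<lambda>\<rho>. \<Sum>s\<in>S. f s \<rho>)"
  by (induction S rule: infinite_finite_induct)
    (auto intro: complex_linear_add_fun simp: complex_linear_def[of "\<lambda>_. 0"] vec_eq_iff)

lemma scaleR_cmat: "r *\<^sub>R (A :: 'd::finite cmat) = cmat_scale (complex_of_real r) A"
  by (simp add: vec_eq_iff scaleR_conv_of_real[where 'a = complex])

lemma complex_linear_scaleR_fun: "complex_linear f \<Longrightarrow> complex_linear (\<lambda>\<rho>. r *\<^sub>R f \<rho>)"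
  unfolding complex_linear_def scaleR_cmat by (auto simp: vec_eq_iff algebra_simps)

lemma trace_preserving_units:
  assumes "complex_linear f"
  shows "trace_preserving f \<longleftrightarrow> (\<forall>a b. (\<Sum>i\<in>UNIV. f (mat_unit a b) $ i $ i) = (if a = b then 1 else 0))"
proof
  assume tp: "trace_preserving f"
  show "\<forall>a b. (\<Sum>i\<in>UNIV. f (mat_unit a b) $ i $ i) = (if a = b then 1 else 0)"
  proof (intro allI)
    fix a b
    have "(\<Sum>i\<in>UNIV. f (mat_unit a b) $ i $ i) = trace (f (mat_unit a b))"
      by (simp add: trace_def)
    also have "\<dots> = trace (mat_unit a b)"
      using tp by (simp add: trace_preserving_def)
    also have "\<dots> = (\<Sum>i\<in>UNIV. if i = a then (if a = b then 1 else 0) else 0)"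
      unfolding trace_def mat_unit_def by (intro sum.cong refl) auto
    finally show "(\<Sum>i\<in>UNIV. f (mat_unit a b) $ i $ i) = (if a = b then 1 else 0)"
      by simp
  qed
next
  assume u: "\<forall>a b. (\<Sum>i\<in>UNIV. f (mat_unit a b) $ i $ i) = (if a = b then 1 else 0)"
  show "trace_preserving f"
    unfolding trace_preserving_def
  proof
    fix A
    have "trace (f A) = (\<Sum>i\<in>UNIV. \<Sum>a\<in>UNIV. \<Sum>b\<in>UNIV. A $ a $ b * f (mat_unit a b) $ i $ i)"
      by (simp add: trace_def complex_linear_expand[OF assms, of A])
    also have "\<dots> = (\<Sum>a\<in>UNIV. \<Sum>i\<in>UNIV. \<Sum>b\<in>UNIV. A $ a $ b * f (mat_unit a b) $ i $ i)"
      by (rule sum.swap)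
    also have "\<dots> = (\<Sum>a\<in>UNIV. \<Sum>b\<in>UNIV. \<Sum>i\<in>UNIV. A $ a $ b * f (mat_unit a b) $ i $ i)"
      by (intro sum.cong refl sum.swap)
    also have "\<dots> = (\<Sum>a\<in>UNIV. \<Sum>b\<in>UNIV. A $ a $ b * (if a = b then 1 else 0))"
      using u by (simp add: sum_distrib_left[symmetric])
    also have "\<dots> = trace A"
      by (simp add: trace_def if_distrib[of "\<lambda>x. _ * x"] sum.delta cong: if_cong)
    finally show "trace (f A) = trace A" .
  qed
qed

section \<open>Complete positivity and Choi's theorem\<close>

lemma completely_positive_add:
  assumes "completely_positive f" "completely_positive g"
  shows "completely_positive (\<lambda>\<rho>. f \<rho> + g \<rho>)"
proof -
  have "id_tensor (\<lambda>\<rho>. f \<rho> + g \<rho>) \<Gamma> = (\<lambda>x y. id_tensor f \<Gamma> x y + id_tensor g \<Gamma> x y)"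
    for \<Gamma> :: "nat \<times> 'a \<Rightarrow> nat \<times> 'a \<Rightarrow> complex"
    by (auto simp: id_tensor_def fun_eq_iff)
  then show ?thesis
    using assms unfolding completely_positive_def by (auto intro: psd_on_add)
qed

lemma completely_positive_zero: "completely_positive (\<lambda>\<rho>. 0)"
proof -
  have "id_tensor (\<lambda>\<rho>. 0) \<Gamma> = (\<lambda>x y. 0)" for \<Gamma> :: "nat \<times> 'a \<Rightarrow> nat \<times> 'a \<Rightarrow> complex"
    by (auto simp: id_tensor_def fun_eq_iff)
  then show ?thesis
    unfolding completely_positive_def by (auto intro: psd_on_zero)
qed

lemma completely_positive_sum:
  "(\<And>s. s \<in> S \<Longrightarrow> completely_positive (f s)) \<Longrightarrow> completely_positive (\<lambda>\<rho>. \<Sum>s\<in>S. f s \<rho>)"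
  by (induction S rule: infinite_finite_induct)
    (auto intro: completely_positive_add completely_positive_zero)

lemma completely_positive_scaleR:
  assumes "completely_positive f" "r \<ge> 0"
  shows "completely_positive (\<lambda>\<rho>. r *\<^sub>R f \<rho>)"
proof -
  have "id_tensor (\<lambda>\<rho>. r *\<^sub>R f \<rho>) \<Gamma> = (\<lambda>x y. complex_of_real r * id_tensor f \<Gamma> x y)"
    for \<Gamma> :: "nat \<times> 'a \<Rightarrow> nat \<times> 'a \<Rightarrow> complex"
    by (auto simp: id_tensor_def fun_eq_iff scaleR_cmat)
  then show ?thesis
    using assms unfolding completely_positive_def by (auto intro: psd_on_scale)
qed

text \<open>A decomposition of \<open>\<Gamma>\<close> into rank-one terms is carried to one of its
  image by letting \<open>1 \<otimes> B\<close> act on each vector \<open>w s\<close>.\<close>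

lemma completely_positive_kraus: "completely_positive (kraus (B :: 'd::finite \<Rightarrow> 'd \<Rightarrow> complex))"
  unfolding completely_positive_def
proof (intro allI impI)
  fix n :: nat and \<Gamma> :: "nat \<times> 'd \<Rightarrow> nat \<times> 'd \<Rightarrow> complex"
  assume "psd_on ({..<n} \<times> UNIV) \<Gamma>"
  from psd_on_decomp[OF _ this] obtain m :: nat and w where
    w: "\<And>x y. x \<in> {..<n} \<times> UNIV \<Longrightarrow> y \<in> {..<n} \<times> UNIV \<Longrightarrow> \<Gamma> x y = (\<Sum>s<m. w s x * cnj (w s y))"
    by auto
  define W where "W = (\<lambda>s (i, k). \<Sum>a\<in>UNIV. B k a * w s (i, a))"
  have "(\<Sum>s<m. W s x * cnj (W s y)) = id_tensor (kraus B) \<Gamma> x y"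
    if "x \<in> {..<n} \<times> UNIV" "y \<in> {..<n} \<times> UNIV" for x y
  proof -
    obtain i k j l where x: "x = (i, k)" and y: "y = (j, l)" by (metis surj_pair)
    have "id_tensor (kraus B) \<Gamma> x y
        = (\<Sum>a\<in>UNIV. \<Sum>b\<in>UNIV. \<Sum>s<m. B k a * (w s (i, a) * cnj (w s (j, b))) * cnj (B l b))"
      using that by (simp add: x y id_tensor_def kraus_def w sum_distrib_left sum_distrib_right)
    also have "\<dots> = (\<Sum>a\<in>UNIV. \<Sum>s<m. \<Sum>b\<in>UNIV. B k a * (w s (i, a) * cnj (w s (j, b))) * cnj (B l b))"
      by (intro sum.cong refl sum.swap)
    also have "\<dots> = (\<Sum>s<m. \<Sum>a\<in>UNIV. \<Sum>b\<in>UNIV. B k a * (w s (i, a) * cnj (w s (j, b))) * cnj (B l b))"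
      by (rule sum.swap)
    also have "\<dots> = (\<Sum>s<m. W s x * cnj (W s y))"
      by (simp add: W_def x y sum_product mult_ac)
    finally show ?thesis by simp
  qed
  then show "psd_on ({..<n} \<times> UNIV) (id_tensor (kraus B) \<Gamma>)"
    by (rule psd_on_cong) (auto intro: psd_on_sum psd_on_outer)
qed

text \<open>Reference systems are indexed by initial segments of the naturals, so writing down a
  maximally entangled vector requires a numbering of the basis.\<close>

lemma nat_enum_type:
  obtains h :: "nat \<Rightarrow> 'd::finite" and g :: "'d \<Rightarrow> nat"
  where "\<And>a. h (g a) = a" "\<And>a. g a < CARD('d)"
proof -
  obtain h :: "nat \<Rightarrow> 'd" where h: "bij_betw h {0..<CARD('d)} UNIV"
    using ex_bij_betw_nat_finite[of "UNIV :: 'd set"] by auto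
  show ?thesis
  proof (rule that[of h "inv_into {0..<CARD('d)} h"])
    fix a :: 'd
    have a: "a \<in> h ` {0..<CARD('d)}" using h by (simp add: bij_betw_def)
    then show "h (inv_into {0..<CARD('d)} h a) = a" by (rule f_inv_into_f)
    show "inv_into {0..<CARD('d)} h a < CARD('d)" using inv_into_into[OF a] by simp
  qed
qed

lemma completely_positive_imp_kraus:
  fixes f :: "'d::finite cmat \<Rightarrow> 'd cmat"
  assumes "complex_linear f" "completely_positive f"
  obtains n :: nat and B where "f = (\<lambda>\<rho>. \<Sum>s<n. kraus (B s) \<rho>)"
proof -
  obtain h :: "nat \<Rightarrow> 'd" and g where hg: "\<And>a. h (g a) = a" "\<And>a. g a < CARD('d)"
    using nat_enum_type by metis
  define N where "N = CARD('d)"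
  \<comment> \<open>\<open>\<Omega>\<close> is the unnormalised maximally entangled state. Its block
    at \<open>(g a, g b)\<close> is a matrix unit, so \<open>id_tensor f \<Omega>\<close> is the
    Choi matrix of \<open>f\<close>, and its rank-one terms reshape into Kraus operators.\<close>
  define \<Omega> where "\<Omega> = (\<lambda>x y. (if h (fst x) = snd x then 1 else 0) * cnj (if h (fst y) = snd y then (1::complex) else 0))"
  have "psd_on ({..<N} \<times> UNIV) \<Omega>"
    unfolding \<Omega>_def by (rule psd_on_outer)
  moreover have "N \<ge> 1"
    by (simp add: N_def Suc_leI)
  ultimately have "psd_on ({..<N} \<times> UNIV) (id_tensor f \<Omega>)"
    using assms(2) unfolding completely_positive_def by blast
  from psd_on_decomp[OF _ this] obtain n :: nat and w where
    w: "\<And>x y. x \<in> {..<N} \<times> UNIV \<Longrightarrow> y \<in> {..<N} \<times> UNIV \<Longrightarrow> id_tensor f \<Omega> x y = (\<Sum>s<n. w s x * cnj (w s y))"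
    by auto
  define B where "B = (\<lambda>s i a. w s (g a, i))"
  have "f (mat_unit a b) $ i $ j = (\<Sum>s<n. kraus (B s) (mat_unit a b)) $ i $ j" for a b i j
  proof -
    have "(\<chi> k' l'. \<Omega> (g a, k') (g b, l')) = mat_unit a b"
      by (auto simp: \<Omega>_def mat_unit_def hg vec_eq_iff)
    then have "id_tensor f \<Omega> (g a, i) (g b, j) = f (mat_unit a b) $ i $ j"
      by (simp add: id_tensor_def)
    then show ?thesis
      using w[of "(g a, i)" "(g b, j)"] hg(2) by (simp add: B_def N_def)
  qed
  then have "f = (\<lambda>\<rho>. \<Sum>s<n. kraus (B s) \<rho>)"
    by (intro complex_linear_eqI assms(1) complex_linear_sum_fun complex_linear_kraus) auto
  then show ?thesis by (rule that)
qed

lemma atom_component: "atom x \<phi> \<rho> $ i $ j = cinner x (\<rho> *v x) * (\<phi> $ i * cnj (\<phi> $ j))"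
  by (simp add: atom_def)

lemma atom_mat_unit [simp]:
  "atom x \<phi> (mat_unit a b) $ i $ j = \<phi> $ i * cnj (x $ a) * (x $ b * cnj (\<phi> $ j))"
  using kraus_mat_unit[of "outer \<phi> x" a b i j] unfolding kraus_outer by (simp add: outer_def mult_ac)

lemma complex_linear_atom: "complex_linear (atom x \<phi>)"
  unfolding kraus_outer[symmetric] by (rule complex_linear_kraus)

lemma completely_positive_atom: "completely_positive (atom x \<phi>)"
  unfolding kraus_outer[symmetric] by (rule completely_positive_kraus)

lemma complex_linear_atom_sum: "complex_linear (\<lambda>\<rho>. \<Sum>s\<in>S. atom (x s) (\<phi> s) \<rho>)"
  by (intro complex_linear_sum_fun complex_linear_atom)

lemma atom_scale_left: "atom (k *s x) \<phi> \<rho> = (cmod k)\<^sup>2 *\<^sub>R atom x \<phi> \<rho>"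
proof -
  have "complex_of_real ((cmod k)\<^sup>2) = k * cnj k" by (rule complex_norm_square)
  then show ?thesis
    unfolding scaleR_cmat
    by (simp add: vec_eq_iff atom_component cinner_matrix sum_distrib_left sum_distrib_right mult_ac
        del: of_real_power)
qed

lemma atom_scale_right: "atom x (k *s \<phi>) \<rho> = (cmod k)\<^sup>2 *\<^sub>R atom x \<phi> \<rho>"
proof -
  have "complex_of_real ((cmod k)\<^sup>2) = k * cnj k" by (rule complex_norm_square)
  then show ?thesis
    unfolding scaleR_cmat
    by (simp add: vec_eq_iff atom_component mult_ac del: of_real_power)
qed

subsection \<open>Entanglement breaking maps\<close>

text \<open>The Holevo form without a trace condition. These maps form a convex cone, whose
  trace-preserving members turn out to be the entanglement breaking channels.\<close>

definition eb :: "('d::finite cmat \<Rightarrow> 'd cmat) \<Rightarrow> bool" where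
  "eb f \<longleftrightarrow> (\<exists>(n::nat) x \<phi>. f = (\<lambda>\<rho>. \<Sum>s<n. atom (x s) (\<phi> s) \<rho>))"

lemma ebI: "f = (\<lambda>\<rho>. \<Sum>s<n. atom (x s) (\<phi> s) \<rho>) \<Longrightarrow> eb f" for n :: nat
  unfolding eb_def by blast

lemma eb_atom_sum:
  assumes "finite S"
  shows "eb (\<lambda>\<rho>. \<Sum>s\<in>S. atom (x s) (\<phi> s) \<rho>)"
proof -
  obtain h where h: "bij_betw h {..<card S} S"
    using ex_bij_betw_nat_finite[OF assms] by (auto simp: atLeast0LessThan)
  show ?thesis
    by (rule ebI[of _ "\<lambda>s. x (h s)" "\<lambda>s. \<phi> (h s)" "card S"])
      (simp add: sum.reindex_bij_betw[OF h, of "\<lambda>s. atom (x s) (\<phi> s) _"])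
qed

lemma eb_zero: "eb (\<lambda>\<rho>. 0)"
  using eb_atom_sum[of "{} :: nat set"] by simp

lemma eb_atom: "eb (atom x \<phi>)"
  using eb_atom_sum[of "{0 :: nat}" "\<lambda>_. x" "\<lambda>_. \<phi>"] by simp

lemma eb_add:
  assumes "eb f" "eb g"
  shows "eb (\<lambda>\<rho>. f \<rho> + g \<rho>)"
proof -
  obtain n :: nat and x \<phi> where f: "f = (\<lambda>\<rho>. \<Sum>s<n. atom (x s) (\<phi> s) \<rho>)"
    using assms(1) by (auto simp: eb_def)
  obtain m :: nat and y \<psi> where g: "g = (\<lambda>\<rho>. \<Sum>s<m. atom (y s) (\<psi> s) \<rho>)"
    using assms(2) by (auto simp: eb_def)
  have "(\<lambda>\<rho>. f \<rho> + g \<rho>)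
      = (\<lambda>\<rho>. \<Sum>s\<in>{..<n} <+> {..<m}. atom (case_sum x y s) (case_sum \<phi> \<psi> s) \<rho>)"
    by (simp add: f g sum.Plus)
  then show ?thesis
    using eb_atom_sum[of "{..<n} <+> {..<m}" "case_sum x y" "case_sum \<phi> \<psi>"] by simp
qed

lemma eb_sum: "(\<And>s. s \<in> S \<Longrightarrow> eb (f s)) \<Longrightarrow> eb (\<lambda>\<rho>. \<Sum>s\<in>S. f s \<rho>)"
  by (induction S rule: infinite_finite_induct) (auto intro: eb_zero eb_add)

lemma eb_scaleR:
  assumes "eb f" "c \<ge> 0"
  shows "eb (\<lambda>\<rho>. c *\<^sub>R f \<rho>)"
proof -
  obtain n :: nat and x \<phi> where f: "f = (\<lambda>\<rho>. \<Sum>s<n. atom (x s) (\<phi> s) \<rho>)"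
    using assms(1) by (auto simp: eb_def)
  have "(\<lambda>\<rho>. c *\<^sub>R f \<rho>) = (\<lambda>\<rho>. \<Sum>s<n. atom (complex_of_real (sqrt c) *s x s) (\<phi> s) \<rho>)"
    using assms(2) by (simp add: f atom_scale_left scaleR_sum_right)
  then show ?thesis by (rule ebI)
qed

lemma eb_imp_complex_linear: "eb f \<Longrightarrow> complex_linear f"
  unfolding eb_def using complex_linear_atom_sum by blast

lemma eb_imp_completely_positive: "eb f \<Longrightarrow> completely_positive f"
  unfolding eb_def by (auto intro!: completely_positive_sum completely_positive_atom)

text \<open>The kernel is the compression of \<open>\<Gamma>\<close> by \<open>x\<close> in the
  second tensor factor.\<close>

lemma atom_block_psd:
  fixes \<Gamma> :: "nat \<times> 'd::finite \<Rightarrow> nat \<times> 'd \<Rightarrow> complex"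
  assumes "psd_on ({..<n} \<times> UNIV) \<Gamma>"
  shows "psd_on {..<n} (\<lambda>i j. cinner x ((\<chi> a b. \<Gamma> (i, a) (j, b)) *v x))"
proof -
  from psd_on_decomp[OF _ assms] obtain m :: nat and w where
    w: "\<And>x y. x \<in> {..<n} \<times> UNIV \<Longrightarrow> y \<in> {..<n} \<times> UNIV \<Longrightarrow> \<Gamma> x y = (\<Sum>s<m. w s x * cnj (w s y))"
    by auto
  define W where "W = (\<lambda>s i. \<Sum>a\<in>UNIV. cnj (x $ a) * w s (i, a))"
  have "(\<Sum>s<m. W s i * cnj (W s j)) = cinner x ((\<chi> a b. \<Gamma> (i, a) (j, b)) *v x)"
    if "i \<in> {..<n}" "j \<in> {..<n}" for i j
  proof -
    have "cinner x ((\<chi> a b. \<Gamma> (i, a) (j, b)) *v x)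
        = (\<Sum>a\<in>UNIV. \<Sum>b\<in>UNIV. \<Sum>s<m. cnj (x $ a) * (w s (i, a) * cnj (w s (j, b))) * x $ b)"
      using that by (simp add: cinner_matrix w sum_distrib_left sum_distrib_right)
    also have "\<dots> = (\<Sum>a\<in>UNIV. \<Sum>s<m. \<Sum>b\<in>UNIV. cnj (x $ a) * (w s (i, a) * cnj (w s (j, b))) * x $ b)"
      by (intro sum.cong refl sum.swap)
    also have "\<dots> = (\<Sum>s<m. \<Sum>a\<in>UNIV. \<Sum>b\<in>UNIV. cnj (x $ a) * (w s (i, a) * cnj (w s (j, b))) * x $ b)"
      by (rule sum.swap)
    also have "\<dots> = (\<Sum>s<m. W s i * cnj (W s j))"
      unfolding W_def cnj_sum sum_product by (simp add: mult_ac)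
    finally show ?thesis by simp
  qed
  then show ?thesis
    by (rule psd_on_cong) (auto intro: psd_on_sum psd_on_outer)
qed

text \<open>Each atom sends \<open>\<Gamma>\<close> to the tensor product of the compression of
  \<open>\<Gamma>\<close> by \<open>x s\<close> with the projector given by \<open>\<phi> s\<close>,
  so the image is a sum of products.\<close>

lemma eb_imp_EBT:
  fixes f :: "'d::finite cmat \<Rightarrow> 'd cmat"
  assumes "eb f" "trace_preserving f"
  shows "is_EBT f"
proof -
  obtain m :: nat and x \<phi> where f: "f = (\<lambda>\<rho>. \<Sum>s<m. atom (x s) (\<phi> s) \<rho>)"
    using assms(1) by (auto simp: eb_def)
  have "separable_on {..<n} UNIV (id_tensor f \<Gamma>)"
    if n: "n \<ge> 1" and \<Gamma>: "density_on ({..<n} \<times> UNIV) \<Gamma>" for n :: nat and \<Gamma>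
  proof (rule separable_onI)
    fix s assume "s < m"
    show "psd_on {..<n} (\<lambda>i j. cinner (x s) ((\<chi> a b. \<Gamma> (i, a) (j, b)) *v x s))"
      using \<Gamma> atom_block_psd[of n \<Gamma> "x s"] by (simp add: density_on_def)
    show "psd_on UNIV (\<lambda>i j. \<phi> s $ i * cnj (\<phi> s $ j))"
      by (rule psd_on_outer)
  next
    fix p q :: "nat \<times> 'd"
    obtain i k j l where p: "p = (i, k)" and q: "q = (j, l)" by (metis surj_pair)
    show "id_tensor f \<Gamma> p q = (\<Sum>s<m. tensor_op (\<lambda>i j. cinner (x s) ((\<chi> a b. \<Gamma> (i, a) (j, b)) *v x s))
        (\<lambda>i j. \<phi> s $ i * cnj (\<phi> s $ j)) p q)"
      by (simp add: p q f id_tensor_def tensor_op_def atom_component)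
  next
    have "(\<Sum>p\<in>{..<n} \<times> UNIV. id_tensor f \<Gamma> p p)
        = (\<Sum>i<n. trace (f (\<chi> k' l'. \<Gamma> (i, k') (i, l'))))"
      unfolding trace_def sum.cartesian_product by (intro sum.cong) (auto simp: id_tensor_def)
    also have "\<dots> = (\<Sum>i<n. trace (\<chi> k' l'. \<Gamma> (i, k') (i, l')))"
      using assms(2) by (simp add: trace_preserving_def)
    also have "\<dots> = (\<Sum>p\<in>{..<n} \<times> UNIV. \<Gamma> p p)"
      unfolding trace_def sum.cartesian_product by (intro sum.cong) auto
    finally show "(\<Sum>p\<in>{..<n} \<times> UNIV. id_tensor f \<Gamma> p p) = 1"
      using \<Gamma> by (simp add: density_on_def)
  next
    show "{..<n} \<noteq> {}" using n by (auto simp: lessThan_empty_iff)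
  qed simp_all
  then show ?thesis
    unfolding is_EBT_def is_CPT_def
    using assms eb_imp_complex_linear eb_imp_completely_positive by blast
qed

text \<open>Splitting both factors of a separable decomposition of the Choi matrix into rank-one
  terms turns it into a decomposition of \<open>f\<close> into atoms.\<close>

lemma EBT_imp_eb:
  fixes f :: "'d::finite cmat \<Rightarrow> 'd cmat"
  assumes "is_EBT f"
  shows "eb f"
proof -
  have lin: "complex_linear f" using assms by (simp add: is_EBT_def is_CPT_def)
  obtain h :: "nat \<Rightarrow> 'd" and g where hg: "\<And>a. h (g a) = a" "\<And>a. g a < CARD('d)"
    using nat_enum_type by metis
  define N where "N = CARD('d)"
  have N: "N \<ge> 1"
    by (simp add: N_def Suc_leI)
  \<comment> \<open>The factor \<open>1 / N\<close> normalises the maximally entangled state; the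
    factor \<open>real N\<close> in \<open>F\<close> undoes it.\<close>
  define \<Omega> where "\<Omega> = (\<lambda>x y. complex_of_real (1 / real N) *
    ((if h (fst x) = snd x then 1 else 0) * cnj (if h (fst y) = snd y then (1::complex) else 0)))"
  have "psd_on ({..<N} \<times> UNIV) \<Omega>"
    unfolding \<Omega>_def by (intro psd_on_scale psd_on_outer) simp
  moreover have "(\<Sum>x\<in>{..<N} \<times> UNIV. \<Omega> x x) = 1"
  proof -
    have "(\<Sum>x\<in>{..<N} \<times> UNIV. \<Omega> x x) = (\<Sum>i<N. \<Sum>k\<in>UNIV. if k = h i then complex_of_real (1 / real N) else 0)"
      unfolding sum.cartesian_product by (intro sum.cong) (auto simp: \<Omega>_def)
    also have "\<dots> = 1" using N by simp
    finally show ?thesis .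
  qed
  ultimately have "separable_on {..<N} UNIV (id_tensor f \<Omega>)"
    using assms N unfolding is_EBT_def density_on_def by blast
  then obtain m :: nat and p :: "nat \<Rightarrow> real" and A B where
    AB: "\<And>s. s < m \<Longrightarrow> 0 \<le> p s" "\<And>s. s < m \<Longrightarrow> density_on {..<N} (A s)"
      "\<And>s. s < m \<Longrightarrow> density_on UNIV (B s)"
    and dec: "\<forall>x\<in>{..<N} \<times> UNIV. \<forall>y\<in>{..<N} \<times> UNIV.
      id_tensor f \<Omega> x y = (\<Sum>s<m. complex_of_real (p s) * tensor_op (A s) (B s) x y)"
    unfolding separable_on_def by blast
  have "\<exists>(n::nat) w. \<forall>i\<in>{..<N}. \<forall>j\<in>{..<N}. A s i j = (\<Sum>u<n. w u i * cnj (w u j))" if "s < m" for s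
    using psd_on_decomp[of "{..<N}" "A s"] AB(2)[OF that] by (simp add: density_on_def)
  then obtain nA :: "nat \<Rightarrow> nat" and w where
    w: "\<And>s i j. s < m \<Longrightarrow> i < N \<Longrightarrow> j < N \<Longrightarrow> A s i j = (\<Sum>u<nA s. w s u i * cnj (w s u j))"
    by (metis lessThan_iff)
  have "\<exists>(n::nat) w. \<forall>i\<in>UNIV. \<forall>j\<in>UNIV. B s i j = (\<Sum>u<n. w u i * cnj (w u j))" if "s < m" for s
    using psd_on_decomp[of UNIV "B s"] AB(3)[OF that] by (simp add: density_on_def)
  then obtain nB :: "nat \<Rightarrow> nat" and z where
    z: "\<And>s i j. s < m \<Longrightarrow> B s i j = (\<Sum>v<nB s. z s v i * cnj (z s v j))"
    by (metis UNIV_I)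
  \<comment> \<open>The conjugate appears because an atom depends on \<open>x\<close> through
    \<open>cnj (x $ a) * x $ b\<close>, which has to match
    \<open>w (g a) * cnj (w (g b))\<close>.\<close>
  define F where "F = (\<lambda>\<rho>. \<Sum>s<m. \<Sum>u<nA s. \<Sum>v<nB s.
    (real N * p s) *\<^sub>R atom (\<chi> a. cnj (w s u (g a))) (\<chi> i. z s v i) \<rho>)"
  have "eb F"
    unfolding F_def using AB(1) by (intro eb_sum eb_scaleR eb_atom) simp_all
  moreover have "f (mat_unit a b) $ i $ j = F (mat_unit a b) $ i $ j" for a b i j
  proof -
    have "(\<chi> k' l'. \<Omega> (g a, k') (g b, l')) = cmat_scale (complex_of_real (1 / real N)) (mat_unit a b)"
      by (auto simp: \<Omega>_def mat_unit_def hg vec_eq_iff)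
    then have "id_tensor f \<Omega> (g a, i) (g b, j) = complex_of_real (1 / real N) * f (mat_unit a b) $ i $ j"
      using lin by (simp add: id_tensor_def complex_linear_def)
    then have "f (mat_unit a b) $ i $ j = complex_of_real (real N) * id_tensor f \<Omega> (g a, i) (g b, j)"
      using N by simp
    also have "\<dots> = complex_of_real (real N) * (\<Sum>s<m. complex_of_real (p s) * (A s (g a) (g b) * B s i j))"
      using dec hg(2) by (simp add: N_def tensor_op_def)
    also have "\<dots> = F (mat_unit a b) $ i $ j"
      using w z hg(2)
      by (simp add: F_def N_def sum_product sum_distrib_left scaleR_cmat mult_ac)
    finally show ?thesis .
  qed
  then have "f = F"
    by (intro complex_linear_eqI lin eb_imp_complex_linear \<open>eb F\<close>)
  ultimately show ?thesis by simp
qed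

lemma EBT_iff: "is_EBT f \<longleftrightarrow> eb f \<and> trace_preserving f"
  using EBT_imp_eb eb_imp_EBT by (auto simp: is_EBT_def is_CPT_def)


subsection \<open>Extreme points\<close>

text \<open>Extremality in the form needed for perturbations, with \<open>\<Phi>\<close> the
  midpoint of \<open>f\<close> and \<open>g\<close>. Linearity lets \<open>f\<close> and
  \<open>g\<close> be represented in the ambient vector space.\<close>

lemma extreme_superopD:
  fixes \<Phi> :: "'d::finite superop"
  assumes ext: "\<Phi> extreme_point_of {\<Psi>. P (blinfun_apply \<Psi>)}"
    and lin: "\<And>f. P f \<Longrightarrow> complex_linear f"
    and f: "P f" and g: "P g"
    and avg: "\<And>\<rho>. f \<rho> + g \<rho> = blinfun_apply \<Phi> \<rho> + blinfun_apply \<Phi> \<rho>"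
  shows "f = blinfun_apply \<Phi>"
proof -
  define F where "F = Blinfun f"
  define G where "G = Blinfun g"
  have F: "blinfun_apply F = f"
    unfolding F_def by (intro bounded_linear_Blinfun_apply complex_linear_imp_bounded_linear lin f)
  have G: "blinfun_apply G = g"
    unfolding G_def by (intro bounded_linear_Blinfun_apply complex_linear_imp_bounded_linear lin g)
  have "\<Phi> = (1 - 1/2) *\<^sub>R F + (1/2) *\<^sub>R G"
  proof (rule blinfun_eqI)
    fix \<rho>
    have "(1/2) *\<^sub>R (f \<rho> + g \<rho>) = (1/2) *\<^sub>R (blinfun_apply \<Phi> \<rho> + blinfun_apply \<Phi> \<rho>)"
      by (simp add: avg)
    also have "\<dots> = blinfun_apply \<Phi> \<rho>"
      by (simp add: scaleR_add_left[symmetric] scaleR_add_right)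
    finally show "blinfun_apply \<Phi> \<rho> = blinfun_apply ((1 - 1/2) *\<^sub>R F + (1/2) *\<^sub>R G) \<rho>"
      by (simp add: blinfun.add_left blinfun.scaleR_left F G scaleR_add_right)
  qed
  then have "\<exists>u>0. u < 1 \<and> \<Phi> = (1 - u) *\<^sub>R F + u *\<^sub>R G"
    by (intro exI[of _ "1/2"]) simp
  moreover have "\<Phi> \<notin> open_segment F G"
    using ext f g by (simp add: extreme_point_of_def F G)
  ultimately have "F = G"
    unfolding in_segment by blast
  then have "\<Phi> = F"
    using \<open>\<Phi> = (1 - 1/2) *\<^sub>R F + (1/2) *\<^sub>R G\<close> by (simp add: scaleR_add_left[symmetric])
  then show ?thesis by (simp add: F)
qed

text \<open>Identifying one component of a convex combination suffices: once one end of the segment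
  equals \<open>\<Phi>\<close>, so does the other.\<close>

lemma extreme_superopI:
  fixes \<Phi> :: "'d::finite superop"
  assumes "P (blinfun_apply \<Phi>)"
    and "\<And>f g u. P f \<Longrightarrow> P g \<Longrightarrow> 0 < u \<Longrightarrow> u < 1 \<Longrightarrow>
      (\<And>\<rho>. blinfun_apply \<Phi> \<rho> = u *\<^sub>R f \<rho> + (1 - u) *\<^sub>R g \<rho>) \<Longrightarrow> f = blinfun_apply \<Phi>"
  shows "\<Phi> extreme_point_of {\<Psi>. P (blinfun_apply \<Psi>)}"
  unfolding extreme_point_of_def
proof (intro conjI ballI notI)
  show "\<Phi> \<in> {\<Psi>. P (blinfun_apply \<Psi>)}" using assms(1) by simp
  fix F G assume F: "F \<in> {\<Psi>. P (blinfun_apply \<Psi>)}" and G: "G \<in> {\<Psi>. P (blinfun_apply \<Psi>)}"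
    and seg: "\<Phi> \<in> open_segment F G"
  from seg obtain u where u: "0 < u" "u < 1" and \<Phi>: "\<Phi> = (1 - u) *\<^sub>R F + u *\<^sub>R G" and FG: "F \<noteq> G"
    unfolding in_segment by blast
  have "blinfun_apply G = blinfun_apply \<Phi>"
    by (rule assms(2)[of _ "blinfun_apply F" u])
      (use F G u in \<open>auto simp: \<Phi> blinfun.add_left blinfun.scaleR_left\<close>)
  then have "G = (1 - u) *\<^sub>R F + u *\<^sub>R G"
    using \<Phi> by (simp add: blinfun_apply_inject)
  then have "(1 - u) *\<^sub>R F = (1 - u) *\<^sub>R G"
    by (auto simp: algebra_simps)
  with u have "F = G" by (metis diff_gt_0_iff_gt less_irrefl scaleR_left_imp_eq)
  with FG show False by simp
qed

text \<open>Trace preservation passes from \<open>f\<close> and \<open>\<Phi>\<close> to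
  \<open>g\<close>, so a two-sided perturbation needs its trace checked on one side only.\<close>

lemma extreme_EBT_perturb:
  fixes \<Phi> :: "'d::finite superop"
  assumes ext: "\<Phi> extreme_point_of EBT_maps"
    and f: "eb f" and g: "eb g"
    and avg: "\<And>\<rho>. f \<rho> + g \<rho> = blinfun_apply \<Phi> \<rho> + blinfun_apply \<Phi> \<rho>"
    and tr: "\<And>\<rho>. trace (f \<rho>) = trace \<rho>"
  shows "f = blinfun_apply \<Phi>"
proof -
  have "trace (blinfun_apply \<Phi> \<rho>) = trace \<rho>" for \<rho>
    using ext by (auto simp: extreme_point_of_def EBT_maps_def EBT_iff trace_preserving_def)
  moreover have "trace (f \<rho>) + trace (g \<rho>) = trace (blinfun_apply \<Phi> \<rho>) + trace (blinfun_apply \<Phi> \<rho>)" for \<rho>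
    using arg_cong[OF avg[of \<rho>], of trace] by (simp only: trace_add)
  ultimately have "trace (g \<rho>) = trace \<rho>" for \<rho>
    using tr by simp
  then show ?thesis
    using f g tr
    by (intro extreme_superopD[OF ext[unfolded EBT_maps_def] _ _ _ avg])
      (auto simp: EBT_iff trace_preserving_def eb_imp_complex_linear)
qed

lemma extreme_CPT_perturb:
  fixes \<Phi> :: "'d::finite superop"
  assumes ext: "\<Phi> extreme_point_of CPT_maps"
    and f: "complex_linear f" "completely_positive f" and g: "complex_linear g" "completely_positive g"
    and avg: "\<And>\<rho>. f \<rho> + g \<rho> = blinfun_apply \<Phi> \<rho> + blinfun_apply \<Phi> \<rho>"
    and tr: "\<And>\<rho>. trace (f \<rho>) = trace \<rho>"
  shows "f = blinfun_apply \<Phi>"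
proof -
  have "trace (blinfun_apply \<Phi> \<rho>) = trace \<rho>" for \<rho>
    using ext by (auto simp: extreme_point_of_def CPT_maps_def is_CPT_def trace_preserving_def)
  moreover have "trace (f \<rho>) + trace (g \<rho>) = trace (blinfun_apply \<Phi> \<rho>) + trace (blinfun_apply \<Phi> \<rho>)" for \<rho>
    using arg_cong[OF avg[of \<rho>], of trace] by (simp only: trace_add)
  ultimately have "trace (g \<rho>) = trace \<rho>" for \<rho>
    using tr by simp
  then show ?thesis
    using f g tr
    by (intro extreme_superopD[OF ext[unfolded CPT_maps_def] _ _ _ avg])
      (auto simp: is_CPT_def trace_preserving_def)
qed

section \<open>The Hermitian inner product\<close>

lemma cinner_self: "cinner v v = complex_of_real ((norm v)\<^sup>2)"
proof -
  have "cinner v v = (\<Sum>i\<in>UNIV. complex_of_real ((cmod (v $ i))\<^sup>2))"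
    unfolding cinner_def by (intro sum.cong refl) (simp only: complex_norm_square mult.commute)
  also have "\<dots> = complex_of_real ((norm v)\<^sup>2)"
    by (simp add: norm_vec_def L2_set_def sum_nonneg del: of_real_power)
  finally show ?thesis .
qed

lemma cinner_self_eq_0 [simp]: "cinner v v = 0 \<longleftrightarrow> v = 0"
  by (simp add: cinner_self)

lemma cinner_cnj: "cnj (cinner u v) = cinner v u"
  by (simp add: cinner_def mult.commute)

lemma cinner_eq_0_commute: "cinner u v = 0 \<longleftrightarrow> cinner v u = 0"
  by (metis cinner_cnj complex_cnj_zero_iff)

lemma cinner_add_right: "cinner u (v + w) = cinner u v + cinner u w"
  by (simp add: cinner_def distrib_left sum.distrib)

lemma cinner_add_left: "cinner (u + v) w = cinner u w + cinner v w"
  by (simp add: cinner_def distrib_right sum.distrib)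

lemma cinner_diff_right: "cinner u (v - w) = cinner u v - cinner u w"
  by (simp add: cinner_def right_diff_distrib sum_subtractf)

lemma cinner_diff_left: "cinner (u - v) w = cinner u w - cinner v w"
  by (simp add: cinner_def left_diff_distrib sum_subtractf)

lemma cinner_scale_right: "cinner u (k *s v) = k * cinner u v"
  by (simp add: cinner_def sum_distrib_left mult_ac)

lemma cinner_scale_left: "cinner (k *s u) v = cnj k * cinner u v"
  by (simp add: cinner_def sum_distrib_left mult_ac)

lemma cinner_zero [simp]: "cinner 0 v = 0" "cinner v 0 = 0"
  by (simp_all add: cinner_def)

lemmas cinner_simps = cinner_add_left cinner_add_right cinner_diff_left cinner_diff_right
  cinner_scale_left cinner_scale_right

text \<open>For the square matrix with columns \<open>e k\<close>, orthonormality says that the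
  adjoint is a left inverse, hence also a right inverse.\<close>

lemma orthonormal_complete:
  fixes e :: "'d::finite \<Rightarrow> complex^'d"
  assumes "\<And>j k. cinner (e j) (e k) = (if j = k then 1 else 0)"
  shows "(\<Sum>k\<in>UNIV. e k $ a * cnj (e k $ b)) = (if a = b then 1 else 0)"
proof -
  define U :: "complex^'d^'d" where "U = (\<chi> i k. e k $ i)"
  define V :: "complex^'d^'d" where "V = (\<chi> k i. cnj (e k $ i))"
  have "V ** U = mat 1"
    using assms by (simp add: V_def U_def matrix_matrix_mult_def mat_def vec_eq_iff cinner_def)
  then have "U ** V = mat 1"
    by (simp add: matrix_left_right_inverse)
  then have "(U ** V) $ a $ b = (mat 1 :: complex^'d^'d) $ a $ b" by simp
  then show ?thesis
    by (simp add: U_def V_def matrix_matrix_mult_def mat_def)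
qed

section \<open>Trace preservation and the span of the Kraus operators\<close>

lemma trace_preserving_kraus:
  "trace_preserving (\<lambda>\<rho>. \<Sum>s\<in>S. kraus (B s) \<rho>) \<longleftrightarrow>
    (\<forall>a b. (\<Sum>s\<in>S. \<Sum>i\<in>UNIV. B s i a * cnj (B s i b)) = (if a = b then 1 else 0))"
  by (subst trace_preserving_units)
    (auto intro!: complex_linear_sum_fun complex_linear_kraus simp: sum.swap[of _ S])

text \<open>Dual form of the fact that the Kraus operators of a dominated map lie in the span of
  those of the dominating one; \<open>z\<close> is a linear functional on operators.\<close>

lemma kraus_range:
  fixes A :: "'m \<Rightarrow> 'd::finite \<Rightarrow> 'd \<Rightarrow> complex" and B :: "'s \<Rightarrow> 'd \<Rightarrow> 'd \<Rightarrow> complex"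
  assumes dec: "\<And>\<rho>. (\<Sum>m\<in>M. kraus (A m) \<rho>) = c *\<^sub>R (\<Sum>s\<in>S. kraus (B s) \<rho>) + g \<rho>"
    and c: "c > 0" and S: "finite S" and g: "complex_linear g" "completely_positive g"
    and zero: "\<And>m. m \<in> M \<Longrightarrow> (\<Sum>i\<in>UNIV. \<Sum>a\<in>UNIV. z i a * A m i a) = 0"
    and s: "s \<in> S"
  shows "(\<Sum>i\<in>UNIV. \<Sum>a\<in>UNIV. z i a * B s i a) = 0"
proof -
  obtain n :: nat and D where D: "g = (\<lambda>\<rho>. \<Sum>t<n. kraus (D t) \<rho>)"
    using completely_positive_imp_kraus[OF g] by metis
  define L where "L = (\<lambda>B. \<Sum>i\<in>UNIV. \<Sum>a\<in>UNIV. z i a * B i a)"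
  \<comment> \<open>\<open>q\<close> evaluates the Choi matrix at the vector \<open>cnj z\<close>.
    It is additive in the map and takes the value \<open>(cmod (L B))\<^sup>2\<close> on
    \<open>kraus B\<close>, so a zero total forces each of the nonnegative terms to vanish.\<close>
  define q where "q = (\<lambda>f :: 'd cmat \<Rightarrow> 'd cmat. \<Sum>i\<in>UNIV. \<Sum>a\<in>UNIV. \<Sum>j\<in>UNIV. \<Sum>b\<in>UNIV.
      z i a * f (mat_unit a b) $ i $ j * cnj (z j b))"
  have q_kraus: "q (kraus B) = complex_of_real ((cmod (L B))\<^sup>2)" for B
  proof -
    have "q (kraus B) = (\<Sum>i\<in>UNIV. \<Sum>a\<in>UNIV. z i a * B i a * (\<Sum>j\<in>UNIV. \<Sum>b\<in>UNIV. cnj (z j b * B j b)))"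
      by (simp add: q_def sum_distrib_left mult_ac)
    also have "\<dots> = L B * cnj (L B)"
      unfolding L_def cnj_sum sum_distrib_right ..
    finally show ?thesis by (simp only: complex_norm_square)
  qed
  have q_add: "q (\<lambda>\<rho>. f \<rho> + h \<rho>) = q f + q h" for f h
    by (simp add: q_def distrib_left distrib_right sum.distrib)
  have q_scale: "q (\<lambda>\<rho>. r *\<^sub>R f \<rho>) = complex_of_real r * q f" for r f
    by (simp add: q_def scaleR_cmat sum_distrib_left mult_ac)
  have q_0: "q (\<lambda>\<rho>. 0) = 0"
    by (simp add: q_def)
  have q_sum_A: "q (\<lambda>\<rho>. \<Sum>x\<in>X. f x \<rho>) = (\<Sum>x\<in>X. q (f x))" for X :: "'m set" and f
    by (induction X rule: infinite_finite_induct) (simp_all add: q_add q_0)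
  have q_sum_B: "q (\<lambda>\<rho>. \<Sum>x\<in>X. f x \<rho>) = (\<Sum>x\<in>X. q (f x))" for X :: "'s set" and f
    by (induction X rule: infinite_finite_induct) (simp_all add: q_add q_0)
  have q_sum_D: "q (\<lambda>\<rho>. \<Sum>x\<in>X. f x \<rho>) = (\<Sum>x\<in>X. q (f x))" for X :: "nat set" and f
    by (induction X rule: infinite_finite_induct) (simp_all add: q_add q_0)
  have "q (\<lambda>\<rho>. \<Sum>m\<in>M. kraus (A m) \<rho>)
      = complex_of_real c * (\<Sum>s\<in>S. q (kraus (B s))) + (\<Sum>t<n. q (kraus (D t)))"
    unfolding dec D by (simp add: q_add q_scale q_sum_B q_sum_D)
  then have "complex_of_real (\<Sum>m\<in>M. (cmod (L (A m)))\<^sup>2)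
      = complex_of_real (c * (\<Sum>s\<in>S. (cmod (L (B s)))\<^sup>2) + (\<Sum>t<n. (cmod (L (D t)))\<^sup>2))"
    by (simp add: q_sum_A q_kraus)
  then have "(\<Sum>m\<in>M. (cmod (L (A m)))\<^sup>2)
      = c * (\<Sum>s\<in>S. (cmod (L (B s)))\<^sup>2) + (\<Sum>t<n. (cmod (L (D t)))\<^sup>2)"
    by (simp only: of_real_eq_iff)
  moreover have "(\<Sum>m\<in>M. (cmod (L (A m)))\<^sup>2) = 0"
    using zero by (simp add: L_def)
  moreover have "(\<Sum>t<n. (cmod (L (D t)))\<^sup>2) \<ge> 0"
    by (simp add: sum_nonneg)
  ultimately have "c * (\<Sum>s\<in>S. (cmod (L (B s)))\<^sup>2) \<le> 0"
    by linarith
  then have "(\<Sum>s\<in>S. (cmod (L (B s)))\<^sup>2) \<le> 0"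
    using c by (simp add: mult_le_0_iff)
  then have "(\<Sum>s\<in>S. (cmod (L (B s)))\<^sup>2) = 0"
    by (intro antisym sum_nonneg) simp_all
  then have "(cmod (L (B s)))\<^sup>2 = 0"
    using S s by (subst (asm) sum_nonneg_eq_0_iff) auto
  then show ?thesis by (simp add: L_def)
qed


subsection \<open>Extreme classical-quantum maps\<close>

lemma pure_CQ_form_atoms:
  assumes "pure_CQ_form e \<psi> \<Phi>"
  shows "\<Phi> = (\<lambda>\<rho>. \<Sum>k\<in>UNIV. atom (e k) (\<psi> k) \<rho>)"
    and "\<And>j k. cinner (e j) (e k) = (if j = k then 1 else 0)"
    and "\<And>k. cinner (\<psi> k) (\<psi> k) = 1"
  using assms
  by (auto simp: pure_CQ_form_def CQ_form_def atom_def fun_eq_iff orthonormal_basis_def cinner_self)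

lemma trace_atom: "trace (atom x \<phi> \<rho>) = cinner x (\<rho> *v x) * cinner \<phi> \<phi>"
  by (simp add: trace_def atom_component cinner_def[of \<phi>] sum_distrib_left mult_ac)

lemma trace_preserving_atoms:
  "trace_preserving (\<lambda>\<rho>. \<Sum>s\<in>S. atom (x s) (\<phi> s) \<rho>) \<longleftrightarrow>
    (\<forall>a b. (\<Sum>s\<in>S. cinner (\<phi> s) (\<phi> s) * (x s $ b * cnj (x s $ a))) = (if a = b then 1 else 0))"
proof -
  have "(\<Sum>i\<in>UNIV. outer (\<phi> s) (x s) i a * cnj (outer (\<phi> s) (x s) i b))
      = cinner (\<phi> s) (\<phi> s) * (x s $ b * cnj (x s $ a))" for s a b
    by (simp add: outer_def cinner_def sum_distrib_left sum_distrib_right mult_ac)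
  then show ?thesis
    unfolding kraus_outer[symmetric] trace_preserving_kraus by simp
qed

lemma extreme_CQ_imp_EBT:
  fixes \<Phi> :: "'d::finite cmat \<Rightarrow> 'd cmat"
  assumes "pure_CQ_form e \<psi> \<Phi>"
  shows "is_EBT \<Phi>"
proof -
  note CQ = pure_CQ_form_atoms[OF assms]
  have "eb \<Phi>"
    unfolding CQ(1) by (rule eb_atom_sum) simp
  moreover have "trace_preserving \<Phi>"
    unfolding CQ(1) trace_preserving_atoms using orthonormal_complete[OF CQ(2)] CQ(3) by auto
  ultimately show ?thesis by (rule eb_imp_EBT)
qed

text \<open>A channel below a multiple of \<open>\<Phi>\<close> has Kraus operators \<open>B\<close> with \<open>B e\<^sub>k = b\<^sub>k \<psi>\<^sub>k\<close>, so only
  the Gram matrix of the coefficients \<open>b\<close> remains to be determined; preservation of the trace fixes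
  its entries wherever \<open>\<psi>\<^sub>j\<close> and \<open>\<psi>\<^sub>k\<close> are not orthogonal.\<close>

lemma CQ_rigid:
  fixes \<Phi> f :: "'d::finite cmat \<Rightarrow> 'd cmat" and B :: "nat \<Rightarrow> 'd \<Rightarrow> 'd \<Rightarrow> complex"
  assumes CQ: "pure_CQ_form e \<psi> \<Phi>"
    and dec: "\<And>\<rho>. \<Phi> \<rho> = u *\<^sub>R f \<rho> + (1 - u) *\<^sub>R g \<rho>" and u: "0 < u" "u < 1"
    and f: "f = (\<lambda>\<rho>. \<Sum>s<n. kraus (B s) \<rho>)" "trace_preserving f"
    and g: "complex_linear g" "completely_positive g"
    and cross: "\<And>s j k b b'. s < n \<Longrightarrow> j \<noteq> k \<Longrightarrow> cinner (\<psi> j) (\<psi> k) = 0 \<Longrightarrow>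
      (\<And>i. (\<Sum>a\<in>UNIV. B s i a * e j $ a) = b * \<psi> j $ i) \<Longrightarrow>
      (\<And>i. (\<Sum>a\<in>UNIV. B s i a * e k $ a) = b' * \<psi> k $ i) \<Longrightarrow> b * cnj b' = 0"
  shows "f = \<Phi>"
proof -
  note CQ = pure_CQ_form_atoms[OF CQ]
  define b where "b = (\<lambda>s k. \<Sum>i\<in>UNIV. cnj (\<psi> k $ i) * (\<Sum>a\<in>UNIV. B s i a * e k $ a))"
  have Be: "(\<Sum>a\<in>UNIV. B s i a * e k $ a) = b s k * \<psi> k $ i" if s: "s < n" for s k i
  proof -
    define y where "y = (\<chi> i. \<Sum>a\<in>UNIV. B s i a * e k $ a)"
    \<comment> \<open>\<open>v\<close> is the component of the image of \<open>e k\<close> under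
      \<open>B s\<close> that is orthogonal to \<open>\<psi> k\<close>; the aim is
      \<open>v = 0\<close>.\<close>
    define v where "v = y - b s k *s \<psi> k"
    have b_y: "b s k = cinner (\<psi> k) y" by (simp add: b_def y_def cinner_def)
    have "cinner (\<psi> k) v = 0"
      by (simp add: v_def cinner_simps CQ(3) b_y)
    then have v\<psi>: "cinner v (\<psi> k) = 0" by (simp add: cinner_eq_0_commute)
    \<comment> \<open>The functional that pairs \<open>v\<close> with the image of
      \<open>e k\<close> kills every \<open>outer (\<psi> m) (e m)\<close>: for \<open>m = k\<close>
      because \<open>v\<close> is orthogonal to \<open>\<psi> k\<close>, otherwise because
      \<open>e m\<close> is orthogonal to \<open>e k\<close>.\<close>
    have "(\<Sum>i\<in>UNIV. \<Sum>a\<in>UNIV. cnj (v $ i) * e k $ a * B s i a) = 0"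
    proof (rule kraus_range[where M = UNIV and A = "\<lambda>m. outer (\<psi> m) (e m)"
          and S = "{..<n}" and B = B and c = u and g = "\<lambda>\<rho>. (1 - u) *\<^sub>R g \<rho>"])
      show "(\<Sum>m\<in>UNIV. kraus (outer (\<psi> m) (e m)) \<rho>)
          = u *\<^sub>R (\<Sum>s<n. kraus (B s) \<rho>) + (1 - u) *\<^sub>R g \<rho>" for \<rho>
        using dec[of \<rho>] by (simp add: kraus_outer f(1) CQ(1))
      show "(\<Sum>i\<in>UNIV. \<Sum>a\<in>UNIV. cnj (v $ i) * e k $ a * outer (\<psi> m) (e m) i a) = 0" for m
      proof -
        have "(\<Sum>i\<in>UNIV. \<Sum>a\<in>UNIV. cnj (v $ i) * e k $ a * outer (\<psi> m) (e m) i a)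
            = cinner v (\<psi> m) * cinner (e m) (e k)"
          by (simp add: cinner_def outer_def sum_product mult_ac)
        then show ?thesis using v\<psi> CQ(2) by simp
      qed
    qed (use u s g in \<open>auto intro: complex_linear_scaleR_fun completely_positive_scaleR\<close>)
    then have "cinner v y = 0"
      by (simp add: cinner_def y_def sum_distrib_left mult_ac)
    then have "cinner v v = 0"
      by (subst (2) v_def) (simp add: cinner_simps v\<psi>)
    then show ?thesis
      by (simp add: v_def vec_eq_iff y_def)
  qed
  have B: "B s i a = (\<Sum>k\<in>UNIV. b s k * \<psi> k $ i * cnj (e k $ a))" if "s < n" for s i a
  proof -
    have "(\<Sum>k\<in>UNIV. b s k * \<psi> k $ i * cnj (e k $ a))
        = (\<Sum>k\<in>UNIV. \<Sum>a'\<in>UNIV. B s i a' * (e k $ a' * cnj (e k $ a)))"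
      using that by (simp add: Be[symmetric] sum_distrib_left sum_distrib_right mult_ac)
    also have "\<dots> = (\<Sum>a'\<in>UNIV. B s i a' * (\<Sum>k\<in>UNIV. e k $ a' * cnj (e k $ a)))"
      by (subst sum.swap) (simp add: sum_distrib_left)
    also have "\<dots> = (\<Sum>a'\<in>UNIV. if a' = a then B s i a' else 0)"
      by (intro sum.cong refl) (simp add: orthonormal_complete[OF CQ(2)])
    also have "\<dots> = B s i a" by simp
    finally show ?thesis by simp
  qed
  \<comment> \<open>Trace preservation expressed in the basis \<open>e\<close>: summed over
    \<open>s\<close>, the inner products of the images of \<open>e l\<close> and \<open>e k\<close>
    give that of \<open>e l\<close> and \<open>e k\<close>.\<close>
  have gram: "(\<Sum>s<n. b s k * cnj (b s l)) * cinner (\<psi> l) (\<psi> k) = (if k = l then 1 else 0)" for k l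
  proof -
    have "(\<Sum>s<n. b s k * cnj (b s l)) * cinner (\<psi> l) (\<psi> k)
        = (\<Sum>s<n. \<Sum>i\<in>UNIV. (b s k * \<psi> k $ i) * cnj (b s l * \<psi> l $ i))"
      by (simp add: cinner_def sum_product mult_ac)
    also have "\<dots> = (\<Sum>s<n. \<Sum>i\<in>UNIV. \<Sum>a\<in>UNIV. \<Sum>c\<in>UNIV. (e k $ a * cnj (e l $ c)) * (B s i a * cnj (B s i c)))"
      using Be by (simp add: Be[symmetric] cnj_sum sum_product mult_ac)
    also have "\<dots> = (\<Sum>s<n. \<Sum>a\<in>UNIV. \<Sum>c\<in>UNIV. \<Sum>i\<in>UNIV. (e k $ a * cnj (e l $ c)) * (B s i a * cnj (B s i c)))"
      by (intro sum.cong[of "{..<n}"] refl, subst sum.swap, rule sum.cong[OF refl], rule sum.swap)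
    also have "\<dots> = (\<Sum>a\<in>UNIV. \<Sum>c\<in>UNIV. (e k $ a * cnj (e l $ c)) * (\<Sum>s<n. \<Sum>i\<in>UNIV. B s i a * cnj (B s i c)))"
      by (subst sum.swap, intro sum.cong refl, subst sum.swap) (simp add: sum_distrib_left)
    also have "\<dots> = (\<Sum>a\<in>UNIV. \<Sum>c\<in>UNIV. if c = a then e k $ a * cnj (e l $ c) else 0)"
      using f(2) unfolding f(1) trace_preserving_kraus by (intro sum.cong refl) auto
    also have "\<dots> = cinner (e l) (e k)"
      by (simp add: cinner_def mult.commute)
    finally show ?thesis using CQ(2) by auto
  qed
  have delta: "(\<Sum>s<n. b s k * cnj (b s l)) = (if k = l then 1 else 0)" for k l
  proof (cases "k = l")
    case True
    then show ?thesis using gram[of k l] CQ(3) by simp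
  next
    case False
    show ?thesis
    proof (cases "cinner (\<psi> k) (\<psi> l) = 0")
      case True
      \<comment> \<open>For orthogonal \<open>\<psi> k\<close> and \<open>\<psi> l\<close> the
        identity \<open>gram\<close> reads \<open>0 = 0\<close>, so the coefficient has to come from
        \<open>cross\<close>.\<close>
      have "b s k * cnj (b s l) = 0" if "s < n" for s
        using cross[OF that False True] Be[OF that] by blast
      then have "(\<Sum>s<n. b s k * cnj (b s l)) = 0"
        by (intro sum.neutral) simp
      then show ?thesis using False by simp
    next
      case nz: False
      then have "cinner (\<psi> l) (\<psi> k) \<noteq> 0" by (simp add: cinner_eq_0_commute)
      then show ?thesis using gram[of k l] False by simp
    qed
  qed
  show "f = \<Phi>"
  proof (rule complex_linear_eqI)
    show "complex_linear f" unfolding f(1) by (intro complex_linear_sum_fun complex_linear_kraus)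
    show "complex_linear \<Phi>" unfolding CQ(1) by (rule complex_linear_atom_sum)
    fix a c i j
    let ?X = "\<lambda>k l. \<psi> k $ i * cnj (e k $ a) * (e l $ c * cnj (\<psi> l $ j))"
    have "f (mat_unit a c) $ i $ j = (\<Sum>s<n. B s i a * cnj (B s j c))"
      by (simp add: f(1))
    also have "\<dots> = (\<Sum>s<n. \<Sum>k\<in>UNIV. \<Sum>l\<in>UNIV. b s k * cnj (b s l) * ?X k l)"
      by (intro sum.cong refl) (simp add: B cnj_sum sum_product mult_ac)
    also have "\<dots> = (\<Sum>k\<in>UNIV. \<Sum>l\<in>UNIV. (\<Sum>s<n. b s k * cnj (b s l)) * ?X k l)"
      by (subst sum.swap, intro sum.cong refl, subst sum.swap) (simp add: sum_distrib_right)
    also have "\<dots> = (\<Sum>k\<in>UNIV. \<Sum>l\<in>UNIV. if l = k then ?X k l else 0)"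
      unfolding delta by (intro sum.cong refl) auto
    also have "\<dots> = \<Phi> (mat_unit a c) $ i $ j"
      by (simp add: CQ(1))
    finally show "f (mat_unit a c) $ i $ j = \<Phi> (mat_unit a c) $ i $ j" .
  qed
qed

text \<open>A rank-one Kraus operator maps \<open>e j\<close> and \<open>e k\<close> to multiples of
  the same vector \<open>\<phi> s\<close>. If these are also multiples of the orthogonal vectors
  \<open>\<psi> j\<close> and \<open>\<psi> k\<close>, one of them is zero, which is what
  \<open>CQ_rigid\<close> asks for.\<close>

lemma extreme_CQ_extreme_EBT:
  fixes \<Phi> :: "'d::finite superop"
  assumes "pure_CQ_form e \<psi> (blinfun_apply \<Phi>)"
  shows "\<Phi> extreme_point_of EBT_maps"
  unfolding EBT_maps_def
proof (rule extreme_superopI)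
  show "is_EBT (blinfun_apply \<Phi>)" using assms by (rule extreme_CQ_imp_EBT)
  fix f g :: "'d cmat \<Rightarrow> 'd cmat" and u :: real
  assume f: "is_EBT f" and g: "is_EBT g" and u: "0 < u" "u < 1"
    and dec: "\<And>\<rho>. blinfun_apply \<Phi> \<rho> = u *\<^sub>R f \<rho> + (1 - u) *\<^sub>R g \<rho>"
  obtain n :: nat and x \<phi> where fx: "f = (\<lambda>\<rho>. \<Sum>s<n. atom (x s) (\<phi> s) \<rho>)"
    using f by (auto simp: EBT_iff eb_def)
  show "f = blinfun_apply \<Phi>"
  proof (rule CQ_rigid[OF assms dec u, where n = n and B = "\<lambda>s. outer (\<phi> s) (x s)"])
    show "f = (\<lambda>\<rho>. \<Sum>s<n. kraus (outer (\<phi> s) (x s)) \<rho>)" by (simp add: kraus_outer fx)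
    show "trace_preserving f" using f by (simp add: EBT_iff)
    show "complex_linear g" "completely_positive g" using g by (simp_all add: is_EBT_def is_CPT_def)
    fix s j k b b'
    assume jk: "j \<noteq> k" "cinner (\<psi> j) (\<psi> k) = 0"
      and bj: "\<And>i. (\<Sum>a\<in>UNIV. outer (\<phi> s) (x s) i a * e j $ a) = b * \<psi> j $ i"
      and bk: "\<And>i. (\<Sum>a\<in>UNIV. outer (\<phi> s) (x s) i a * e k $ a) = b' * \<psi> k $ i"
    note \<psi>1 = pure_CQ_form_atoms(3)[OF assms]
    have j: "cinner (x s) (e j) *s \<phi> s = b *s \<psi> j"
      using bj by (simp add: vec_eq_iff outer_def cinner_def sum_distrib_left sum_distrib_right mult_ac)
    have k: "cinner (x s) (e k) *s \<phi> s = b' *s \<psi> k"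
      using bk by (simp add: vec_eq_iff outer_def cinner_def sum_distrib_left sum_distrib_right mult_ac)
    have "cinner (cinner (x s) (e j) *s \<phi> s) (cinner (x s) (e k) *s \<phi> s) = 0"
      unfolding j k by (simp add: cinner_simps jk)
    then have "cinner (x s) (e j) = 0 \<or> cinner (x s) (e k) = 0 \<or> \<phi> s = 0"
      by (auto simp: cinner_simps)
    then have "b *s \<psi> j = 0 \<or> b' *s \<psi> k = 0"
      using j k by auto
    moreover have "b = 0" if "b *s \<psi> j = 0"
      using arg_cong[OF that, of "cinner (\<psi> j)"] \<psi>1 by (simp add: cinner_simps)
    moreover have "b' = 0" if "b' *s \<psi> k = 0"
      using arg_cong[OF that, of "cinner (\<psi> k)"] \<psi>1 by (simp add: cinner_simps)
    ultimately show "b * cnj b' = 0" by auto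
  qed
qed

text \<open>Without orthogonal pairs the condition \<open>cross\<close> of \<open>CQ_rigid\<close>
  is vacuous, so Kraus operators of any rank are covered.\<close>

lemma extreme_CQ_extreme_CPT:
  fixes \<Phi> :: "'d::finite superop"
  assumes "pure_CQ_form e \<psi> (blinfun_apply \<Phi>)"
    and nz: "\<And>j k. cinner (\<psi> j) (\<psi> k) \<noteq> 0"
  shows "\<Phi> extreme_point_of CPT_maps"
  unfolding CPT_maps_def
proof (rule extreme_superopI)
  show "is_CPT (blinfun_apply \<Phi>)" using extreme_CQ_imp_EBT[OF assms(1)] by (simp add: is_EBT_def)
  fix f g :: "'d cmat \<Rightarrow> 'd cmat" and u :: real
  assume f: "is_CPT f" and g: "is_CPT g" and u: "0 < u" "u < 1"
    and dec: "\<And>\<rho>. blinfun_apply \<Phi> \<rho> = u *\<^sub>R f \<rho> + (1 - u) *\<^sub>R g \<rho>"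
  obtain n :: nat and B where "f = (\<lambda>\<rho>. \<Sum>s<n. kraus (B s) \<rho>)"
    using f completely_positive_imp_kraus unfolding is_CPT_def by metis
  then show "f = blinfun_apply \<Phi>"
    using f g nz by (intro CQ_rigid[OF assms(1) dec u]) (auto simp: is_CPT_def)
qed

subsection \<open>Extreme points of the channels\<close>

text \<open>Replacing each Kraus operator \<open>A\<^sub>m\<close> by \<open>A\<^sub>m + t cnj z\<^sub>m A\<^sub>n\<close> perturbs the channel by
  \<open>t (Z \<rho> A\<^sub>n\<^sup>* + A\<^sub>n \<rho> Z\<^sup>*)\<close> up to a multiple of \<open>A\<^sub>n \<rho> A\<^sub>n\<^sup>*\<close> of order \<open>t\<^sup>2\<close>, which the
  \<open>n\<close>-th term can absorb.\<close>

lemma extreme_CPT_kraus: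
  fixes \<Phi> :: "'d::finite superop" and A :: "'m \<Rightarrow> 'd \<Rightarrow> 'd \<Rightarrow> complex"
  assumes ext: "\<Phi> extreme_point_of CPT_maps"
    and \<Phi>: "blinfun_apply \<Phi> = (\<lambda>\<rho>. \<Sum>m\<in>S. kraus (A m) \<rho>)"
    and S: "finite S" "n \<in> S"
    and Z: "\<And>i a. Z i a = (\<Sum>m\<in>S. z m * A m i a)"
    and orth: "\<And>a b. (\<Sum>i\<in>UNIV. cnj (A n i a) * Z i b) = 0"
    and An: "A n i0 a0 \<noteq> 0"
  shows "Z i a = 0"
proof -
  define \<kappa> where "\<kappa> = (\<Sum>m\<in>S. (cmod (z m))\<^sup>2)"
  \<comment> \<open>Small enough that \<open>\<tau> * cmod (z n) \<le> 1/2\<close> and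
    \<open>\<tau>\<^sup>2 * \<kappa> \<le> 1/4\<close>, which keeps the coefficient of
    \<open>kraus (A n)\<close> in \<open>F\<close> nonnegative for both signs of the
    parameter.\<close>
  define \<tau> where "\<tau> = 1 / (2 * (1 + \<kappa>))"
  have \<kappa>0: "\<kappa> \<ge> 0" by (simp add: \<kappa>_def sum_nonneg)
  then have \<tau>0: "\<tau> > 0" by (simp add: \<tau>_def)
  have zn: "(cmod (z n))\<^sup>2 \<le> \<kappa>"
    unfolding \<kappa>_def by (rule member_le_sum) (use S in auto)
  have zn': "cmod (z n) \<le> 1 + \<kappa>"
  proof (rule ccontr)
    assume "\<not> ?thesis"
    then have "1 + \<kappa> < cmod (z n)" by simp
    then have "(1 + \<kappa>)\<^sup>2 < (cmod (z n))\<^sup>2"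
      using \<kappa>0 by (intro power_strict_mono) auto
    moreover have "\<kappa> \<le> (1 + \<kappa>)\<^sup>2"
      using \<kappa>0 by (simp add: power2_eq_square algebra_simps)
    ultimately show False using zn by linarith
  qed
  define F where "F = (\<lambda>t \<rho>. (\<Sum>m\<in>S - {n}. kraus (\<lambda>i a. A m i a + complex_of_real t * cnj (z m) * A n i a) \<rho>)
      + ((cmod (1 + complex_of_real t * cnj (z n)))\<^sup>2 - t\<^sup>2 * \<kappa>) *\<^sub>R kraus (A n) \<rho>)"
  have Flin: "complex_linear (F t)" for t
    unfolding F_def
    by (intro complex_linear_add_fun complex_linear_sum_fun complex_linear_scaleR_fun complex_linear_kraus)
  have \<Phi>lin: "complex_linear (blinfun_apply \<Phi>)"
    unfolding \<Phi> by (intro complex_linear_sum_fun complex_linear_kraus)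
  have coeff: "(cmod (1 + complex_of_real t * cnj (z n)))\<^sup>2 - t\<^sup>2 * \<kappa> \<ge> 0" if "\<bar>t\<bar> = \<tau>" for t
  proof -
    have "\<tau> * cmod (z n) \<le> 1 / 2"
      using zn' \<kappa>0 by (simp add: \<tau>_def field_simps)
    then have "cmod (complex_of_real t * cnj (z n)) \<le> 1 / 2"
      using that by (simp add: norm_mult)
    then have "cmod (1 + complex_of_real t * cnj (z n)) \<ge> 1 / 2"
      using norm_diff_ineq[of 1 "complex_of_real t * cnj (z n)"] by simp
    then have "(1 / 2)\<^sup>2 \<le> (cmod (1 + complex_of_real t * cnj (z n)))\<^sup>2"
      by (intro power_mono) auto
    moreover have "t\<^sup>2 * \<kappa> \<le> (1 / 2)\<^sup>2"
    proof -
      have "t\<^sup>2 = \<tau>\<^sup>2" using that by (metis power2_abs)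
      then show ?thesis
        using \<kappa>0 by (simp add: \<tau>_def power_divide divide_le_eq power2_eq_square algebra_simps)
    qed
    ultimately show ?thesis by linarith
  qed
  have Fcp: "completely_positive (F t)" if "\<bar>t\<bar> = \<tau>" for t
    unfolding F_def using coeff[OF that]
    by (intro completely_positive_add completely_positive_sum completely_positive_scaleR completely_positive_kraus)
  have Funit: "F t (mat_unit a b) $ i $ j = blinfun_apply \<Phi> (mat_unit a b) $ i $ j
      + complex_of_real t * (Z i a * cnj (A n j b) + A n i a * cnj (Z j b))" for t a b i j
  proof -
    let ?s = "complex_of_real t"
    let ?G = "\<lambda>m. (A m i a + ?s * cnj (z m) * A n i a) * cnj (A m j b + ?s * cnj (z m) * A n j b)"
    have "complex_of_real ((cmod (1 + ?s * cnj (z n)))\<^sup>2) = (1 + ?s * cnj (z n)) * cnj (1 + ?s * cnj (z n))"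
      by (rule complex_norm_square)
    then have "F t (mat_unit a b) $ i $ j
        = (\<Sum>m\<in>S - {n}. ?G m)
          + ((1 + ?s * cnj (z n)) * cnj (1 + ?s * cnj (z n)) - ?s\<^sup>2 * complex_of_real \<kappa>) * (A n i a * cnj (A n j b))"
      by (simp add: F_def scaleR_cmat del: of_real_power) (simp add: of_real_power)
    also have "\<dots> = (\<Sum>m\<in>S - {n}. ?G m) + ?G n - ?s\<^sup>2 * complex_of_real \<kappa> * (A n i a * cnj (A n j b))"
      by (simp add: algebra_simps)
    also have "(\<Sum>m\<in>S - {n}. ?G m) + ?G n = (\<Sum>m\<in>S. ?G m)"
      using S by (simp add: sum.remove add.commute)
    also have "(\<Sum>m\<in>S. ?G m) = (\<Sum>m\<in>S. A m i a * cnj (A m j b)) + ?s * (Z i a * cnj (A n j b))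
        + ?s * (A n i a * cnj (Z j b)) + ?s\<^sup>2 * (\<Sum>m\<in>S. z m * cnj (z m)) * (A n i a * cnj (A n j b))"
      unfolding Z cnj_sum sum_distrib_left sum_distrib_right sum.distrib[symmetric]
      by (intro sum.cong refl) (simp add: algebra_simps power2_eq_square)
    also have "(\<Sum>m\<in>S. z m * cnj (z m)) = complex_of_real \<kappa>"
      unfolding \<kappa>_def of_real_sum by (intro sum.cong refl complex_norm_square[symmetric])
    finally show ?thesis
      by (simp add: \<Phi> algebra_simps)
  qed
  have orth': "(\<Sum>i\<in>UNIV. A n i a * cnj (Z i b)) = 0" for a b
    using arg_cong[OF orth[of a b], of cnj] by simp
  have orth'': "(\<Sum>i\<in>UNIV. Z i a * cnj (A n i b)) = 0" for a b
    using orth[of b a] by (simp add: mult.commute)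
  \<comment> \<open>The first-order terms cancel between \<open>F \<tau>\<close> and
    \<open>F (- \<tau>)\<close>, and \<open>orth\<close> makes their trace vanish.\<close>
  have "F \<tau> = blinfun_apply \<Phi>"
  proof (rule extreme_CPT_perturb[OF ext Flin Fcp Flin Fcp])
    show "\<bar>\<tau>\<bar> = \<tau>" "\<bar>- \<tau>\<bar> = \<tau>" using \<tau>0 by auto
    have "(\<lambda>\<rho>. F \<tau> \<rho> + F (- \<tau>) \<rho>) = (\<lambda>\<rho>. blinfun_apply \<Phi> \<rho> + blinfun_apply \<Phi> \<rho>)"
      by (intro complex_linear_eqI complex_linear_add_fun Flin \<Phi>lin)
        (simp only: vector_add_component Funit, simp)
    then show "F \<tau> \<rho> + F (- \<tau>) \<rho> = blinfun_apply \<Phi> \<rho> + blinfun_apply \<Phi> \<rho>" for \<rho>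
      by (rule fun_cong)
    have "trace_preserving (blinfun_apply \<Phi>)"
      using ext by (auto simp: extreme_point_of_def CPT_maps_def is_CPT_def)
    then have "trace_preserving (F \<tau>)"
      unfolding trace_preserving_units[OF Flin] trace_preserving_units[OF \<Phi>lin] Funit
      by (simp add: sum.distrib sum_distrib_left[symmetric] orth' orth'')
    then show "trace (F \<tau> \<rho>) = trace \<rho>" for \<rho>
      by (simp add: trace_preserving_def)
  qed
  then have null: "Z i a * cnj (A n j b) + A n i a * cnj (Z j b) = 0" for i a j b
    using Funit[of \<tau> a b i j] \<tau>0 by simp
  \<comment> \<open>Contracting with column \<open>a0\<close> of \<open>A n\<close> kills the first
    summand of \<open>null\<close> by \<open>orth\<close> and leaves the squared norm of that column
    times \<open>cnj (Z i a)\<close>.\<close>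
  have "(\<Sum>i'\<in>UNIV. cnj (A n i' a0) * (Z i' a0 * cnj (A n i a) + A n i' a0 * cnj (Z i a))) = 0"
    by (simp add: null)
  then have "(\<Sum>i'\<in>UNIV. cnj (A n i' a0) * Z i' a0) * cnj (A n i a)
      + (\<Sum>i'\<in>UNIV. cnj (A n i' a0) * A n i' a0) * cnj (Z i a) = 0"
    unfolding sum_distrib_right sum.distrib[symmetric] by (simp add: algebra_simps)
  moreover have "(\<Sum>i'\<in>UNIV. cnj (A n i' a0) * A n i' a0) \<noteq> 0"
  proof -
    have "(\<Sum>i'\<in>UNIV. cnj (A n i' a0) * A n i' a0) = cinner (\<chi> i. A n i a0) (\<chi> i. A n i a0)"
      by (simp add: cinner_def)
    moreover have "(\<chi> i. A n i a0) \<noteq> 0"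
      using An by (auto simp: vec_eq_iff)
    ultimately show ?thesis by simp
  qed
  ultimately show ?thesis using orth[of a0 a0] by simp
qed

lemma outer_nonzero: "\<phi> \<noteq> 0 \<Longrightarrow> x \<noteq> 0 \<Longrightarrow> \<exists>i a. outer \<phi> x i a \<noteq> 0"
  by (auto simp: outer_def vec_eq_iff)

text \<open>If \<open>\<phi> j\<close> and \<open>\<phi> k\<close> were orthogonal, the Kraus
  operator \<open>outer (\<phi> k) (x k)\<close> itself could serve as \<open>Z\<close> in
  \<open>extreme_CPT_kraus\<close> and would have to vanish.\<close>

lemma extreme_CPT_nonorthogonal:
  fixes \<Phi> :: "'d::finite superop" and x \<phi> :: "'m \<Rightarrow> complex^'d"
  assumes ext: "\<Phi> extreme_point_of CPT_maps"
    and \<Phi>: "blinfun_apply \<Phi> = (\<lambda>\<rho>. \<Sum>m\<in>S. atom (x m) (\<phi> m) \<rho>)"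
    and S: "finite S" "j \<in> S" "k \<in> S"
    and nz: "x j \<noteq> 0" "x k \<noteq> 0" "\<phi> j \<noteq> 0" "\<phi> k \<noteq> 0"
  shows "cinner (\<phi> j) (\<phi> k) \<noteq> 0"
proof
  assume 0: "cinner (\<phi> j) (\<phi> k) = 0"
  obtain i0 a0 where ia: "outer (\<phi> j) (x j) i0 a0 \<noteq> 0"
    using outer_nonzero nz by blast
  have "outer (\<phi> k) (x k) i a = 0" for i a
  proof (rule extreme_CPT_kraus[OF ext, where S = S and A = "\<lambda>m. outer (\<phi> m) (x m)" and n = j
        and z = "\<lambda>m. if m = k then 1 else 0"])
    show "(\<Sum>i\<in>UNIV. cnj (outer (\<phi> j) (x j) i a) * outer (\<phi> k) (x k) i b) = 0" for a b
    proof -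
      have "(\<Sum>i\<in>UNIV. cnj (outer (\<phi> j) (x j) i a) * outer (\<phi> k) (x k) i b)
          = x j $ a * cinner (\<phi> j) (\<phi> k) * cnj (x k $ b)"
        by (simp add: outer_def cinner_def sum_distrib_left sum_distrib_right mult_ac)
      then show ?thesis using 0 by simp
    qed
    show "outer (\<phi> k) (x k) i a = (\<Sum>m\<in>S. (if m = k then 1 else 0) * outer (\<phi> m) (x m) i a)" for i a
      using S by (simp add: if_distrib[of "\<lambda>y. y * _"] cong: if_cong)
  qed (use \<Phi> S ia in \<open>auto simp: kraus_outer\<close>)
  then show False using outer_nonzero nz by blast
qed


subsection \<open>Minimal representations\<close>

text \<open>Unit vectors \<open>\<phi> s\<close> put all weights into the \<open>x s\<close>, so
  trace preservation becomes \<open>\<Sum> |x\<rangle>\<langle>x| = 1\<close>. An arbitrary finite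
  index set allows atoms to be deleted without renumbering.\<close>

definition atom_rep ::
  "nat set \<Rightarrow> (nat \<Rightarrow> complex^'d::finite) \<Rightarrow> (nat \<Rightarrow> complex^'d) \<Rightarrow> ('d cmat \<Rightarrow> 'd cmat) \<Rightarrow> bool"
  where "atom_rep S x \<phi> f \<longleftrightarrow> finite S \<and> (\<forall>s\<in>S. cinner (\<phi> s) (\<phi> s) = 1) \<and>
    f = (\<lambda>\<rho>. \<Sum>s\<in>S. atom (x s) (\<phi> s) \<rho>)"

definition minimal_rep ::
  "nat set \<Rightarrow> (nat \<Rightarrow> complex^'d::finite) \<Rightarrow> (nat \<Rightarrow> complex^'d) \<Rightarrow> ('d cmat \<Rightarrow> 'd cmat) \<Rightarrow> bool"
  where "minimal_rep S x \<phi> f \<longleftrightarrow> atom_rep S x \<phi> f \<and>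
    (\<forall>S' x' \<phi>'. atom_rep S' x' \<phi>' f \<longrightarrow> card S \<le> card S')"

text \<open>The zero vector is included, with factor zero and a basis vector as direction, so that
  every atom can be normalised.\<close>

lemma unit_direction:
  fixes \<phi> :: "complex^'d::finite"
  obtains k \<phi>' where "\<phi> = k *s \<phi>'" "cinner \<phi>' \<phi>' = 1"
proof (cases "\<phi> = 0")
  case True
  obtain i :: 'd where True by blast
  have "cinner (axis i 1) (axis i 1 :: complex^'d) = 1"
    by (simp add: cinner_def axis_def if_distrib[of "\<lambda>y. y * _"] if_distrib[of cnj] cong: if_cong)
  then show ?thesis using that[of 0 "axis i 1"] True by simp
next
  case False
  define r where "r = complex_of_real (norm \<phi>)"
  have r: "r \<noteq> 0" using False by (simp add: r_def)
  have "\<phi> = r *s ((1 / r) *s \<phi>)" using r by (simp add: vec_eq_iff)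
  moreover have "cinner ((1 / r) *s \<phi>) ((1 / r) *s \<phi>) = 1"
    by (simp only: cinner_scale_left cinner_scale_right, simp only: cinner_self) (use r in \<open>simp add: r_def power2_eq_square\<close>)
  ultimately show ?thesis by (rule that)
qed

lemma eb_imp_minimal_rep:
  fixes f :: "'d::finite cmat \<Rightarrow> 'd cmat"
  assumes "eb f"
  obtains S x \<phi> where "minimal_rep S x \<phi> f"
proof -
  obtain n :: nat and x \<phi> where f: "f = (\<lambda>\<rho>. \<Sum>s<n. atom (x s) (\<phi> s) \<rho>)"
    using assms by (auto simp: eb_def)
  have "\<exists>k \<phi>'. \<phi> s = k *s \<phi>' \<and> cinner \<phi>' \<phi>' = 1" for s
    by (metis unit_direction)
  then obtain k \<phi>' where k: "\<And>s. \<phi> s = k s *s \<phi>' s" "\<And>s. cinner (\<phi>' s) (\<phi>' s) = 1"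
    by metis
  have "atom_rep {..<n} (\<lambda>s. k s *s x s) \<phi>' f"
    unfolding atom_rep_def using k(2) by (simp add: f k(1) atom_scale_left atom_scale_right)
  then have "\<exists>S. \<exists>x \<phi>. atom_rep S x \<phi> f" by blast
  from ex_has_least_nat[where P = "\<lambda>S. \<exists>x \<phi>. atom_rep S x \<phi> f" and m = card, OF this[THEN someI_ex]]
  show ?thesis unfolding minimal_rep_def using that[unfolded minimal_rep_def] by blast
qed

lemma atom_rep_cong_sum:
  assumes "atom_rep S x \<phi> f" "finite S'" "\<forall>s\<in>S'. cinner (\<phi>' s) (\<phi>' s) = 1"
    and "\<And>\<rho>. (\<Sum>s\<in>S'. atom (x' s) (\<phi>' s) \<rho>) = (\<Sum>s\<in>S. atom (x s) (\<phi> s) \<rho>)"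
  shows "atom_rep S' x' \<phi>' f"
  using assms by (simp add: atom_rep_def)

lemma sum_two:
  fixes g :: "nat \<Rightarrow> 'a::comm_monoid_add"
  assumes "finite S" "m \<in> S" "n \<in> S" "m \<noteq> n"
  shows "sum g S = g m + g n + sum g (S - {m, n})"
proof -
  have "sum g S = g m + (g n + sum g (S - {m} - {n}))"
    using assms by (subst sum.remove[of S m], simp_all, subst sum.remove[of "S - {m}" n]) auto
  also have "S - {m} - {n} = S - {m, n}" by auto
  finally show ?thesis by (simp add: add.assoc)
qed

text \<open>Exchanging two atoms for two others with the same sum leaves the number of atoms
  unchanged.\<close>

lemma minimal_rep_replace_two:
  assumes min: "minimal_rep S x \<phi> f" and mn: "m \<in> S" "n \<in> S" "m \<noteq> n"
    and unit: "cinner \<alpha> \<alpha> = 1" "cinner \<beta> \<beta> = 1"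
    and eq: "\<And>\<rho>. atom y \<alpha> \<rho> + atom z \<beta> \<rho> = atom (x m) (\<phi> m) \<rho> + atom (x n) (\<phi> n) \<rho>"
  shows "minimal_rep S (x(m := y, n := z)) (\<phi>(m := \<alpha>, n := \<beta>)) f"
proof -
  have rep: "atom_rep S x \<phi> f" using min by (simp add: minimal_rep_def)
  then have S: "finite S" by (simp add: atom_rep_def)
  have "atom_rep S (x(m := y, n := z)) (\<phi>(m := \<alpha>, n := \<beta>)) f"
  proof (rule atom_rep_cong_sum[OF rep S])
    show "\<forall>s\<in>S. cinner ((\<phi>(m := \<alpha>, n := \<beta>)) s) ((\<phi>(m := \<alpha>, n := \<beta>)) s) = 1"
      using rep unit by (auto simp: atom_rep_def)
    show "(\<Sum>s\<in>S. atom ((x(m := y, n := z)) s) ((\<phi>(m := \<alpha>, n := \<beta>)) s) \<rho>) = (\<Sum>s\<in>S. atom (x s) (\<phi> s) \<rho>)"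
      for \<rho>
      unfolding sum_two[OF S mn] using mn eq[of \<rho>] by simp
  qed
  then show ?thesis using min by (simp add: minimal_rep_def)
qed

lemma minimal_rep_no_merge:
  assumes min: "minimal_rep S x \<phi> f" and mn: "m \<in> S" "n \<in> S" "m \<noteq> n"
    and unit: "cinner \<alpha> \<alpha> = 1"
    and eq: "\<And>\<rho>. atom y \<alpha> \<rho> = atom (x m) (\<phi> m) \<rho> + atom (x n) (\<phi> n) \<rho>"
  shows False
proof -
  have rep: "atom_rep S x \<phi> f" using min by (simp add: minimal_rep_def)
  then have S: "finite S" by (simp add: atom_rep_def)
  have "atom_rep (S - {m}) (x(n := y)) (\<phi>(n := \<alpha>)) f"
  proof (rule atom_rep_cong_sum[OF rep])
    show "\<forall>s\<in>S - {m}. cinner ((\<phi>(n := \<alpha>)) s) ((\<phi>(n := \<alpha>)) s) = 1"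
      using rep unit by (auto simp: atom_rep_def)
    have "S - {m} - {n} = S - {m, n}" by auto
    then show "(\<Sum>s\<in>S - {m}. atom ((x(n := y)) s) ((\<phi>(n := \<alpha>)) s) \<rho>) = (\<Sum>s\<in>S. atom (x s) (\<phi> s) \<rho>)"
      for \<rho>
      unfolding sum_two[OF S mn] using mn eq[of \<rho>] S by (subst sum.remove[of "S - {m}" n]) auto
  qed (use S in simp)
  then have "card S \<le> card (S - {m})" using min unfolding minimal_rep_def by blast
  then show False using S mn by (metis card_Diff1_less not_le)
qed

lemma minimal_rep_nonzero:
  assumes min: "minimal_rep S x \<phi> f" and m: "m \<in> S"
  shows "x m \<noteq> 0"
proof
  assume 0: "x m = 0"
  have rep: "atom_rep S x \<phi> f" using min by (simp add: minimal_rep_def)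
  then have S: "finite S" by (simp add: atom_rep_def)
  have "atom_rep (S - {m}) x \<phi> f"
  proof (rule atom_rep_cong_sum[OF rep])
    have "atom 0 (\<phi> m) \<rho> = 0" for \<rho> by (simp add: vec_eq_iff atom_component)
    then show "(\<Sum>s\<in>S - {m}. atom (x s) (\<phi> s) \<rho>) = (\<Sum>s\<in>S. atom (x s) (\<phi> s) \<rho>)" for \<rho>
      using 0 S m by (simp add: sum.remove[of S m])
  qed (use S rep in \<open>auto simp: atom_rep_def\<close>)
  then have "card S \<le> card (S - {m})" using min unfolding minimal_rep_def by blast
  then show False using S m by (metis card_Diff1_less not_le)
qed

text \<open>Unitary freedom of Kraus operators: a unitary 2 by 2 matrix with first row
  \<open>(c / r, d / r)\<close> acts on the pair \<open>(x, y)\<close> and preserves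
  \<open>|x\<rangle>\<langle>x| + |y\<rangle>\<langle>y|\<close>.\<close>

lemma atom_rotate:
  assumes r: "r \<noteq> 0" "r\<^sup>2 = (cmod c)\<^sup>2 + (cmod d)\<^sup>2"
  shows "atom ((c / complex_of_real r) *s x + (d / complex_of_real r) *s y) \<phi> \<rho>
     + atom ((cnj c / complex_of_real r) *s y - (cnj d / complex_of_real r) *s x) \<phi> \<rho>
     = atom x \<phi> \<rho> + atom y \<phi> \<rho>"
proof -
  let ?r = "complex_of_real r"
  have r2: "c * cnj c + d * cnj d = ?r * ?r"
    using arg_cong[OF r(2), of complex_of_real]
    by (simp only: of_real_add complex_norm_square) (simp add: power2_eq_square)
  have "cnj ((c / ?r) * x $ a + (d / ?r) * y $ a) * ((c / ?r) * x $ b + (d / ?r) * y $ b)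
      + cnj ((cnj c / ?r) * y $ a - (cnj d / ?r) * x $ a) * ((cnj c / ?r) * y $ b - (cnj d / ?r) * x $ b)
      = cnj (x $ a) * x $ b + cnj (y $ a) * y $ b" (is "?L = _") for a b
  proof -
    have "?L = (c * cnj c + d * cnj d) / (?r * ?r) * (cnj (x $ a) * x $ b + cnj (y $ a) * y $ b)"
      by (simp add: add_divide_distrib[symmetric] diff_divide_distrib[symmetric] algebra_simps)
    then show ?thesis using r by (simp add: r2)
  qed
  then have *: "\<phi> $ i * cnj (\<phi> $ j) * (cnj ((c / ?r) * x $ a + (d / ?r) * y $ a) * ((c / ?r) * x $ b + (d / ?r) * y $ b)
      + cnj ((cnj c / ?r) * y $ a - (cnj d / ?r) * x $ a) * ((cnj c / ?r) * y $ b - (cnj d / ?r) * x $ b))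
      = \<phi> $ i * cnj (\<phi> $ j) * (cnj (x $ a) * x $ b + cnj (y $ a) * y $ b)" for i j a b
    by simp
  have "(\<lambda>\<rho>. atom ((c / ?r) *s x + (d / ?r) *s y) \<phi> \<rho> + atom ((cnj c / ?r) *s y - (cnj d / ?r) *s x) \<phi> \<rho>)
     = (\<lambda>\<rho>. atom x \<phi> \<rho> + atom y \<phi> \<rho>)"
    using * by (intro complex_linear_eqI complex_linear_add_fun complex_linear_atom) (simp add: distrib_left mult_ac)
  then show ?thesis by (rule fun_cong)
qed

lemma atom_rep_unit_parallel:
  assumes "cinner \<phi> \<phi> = 1" "cinner \<psi> \<psi> = 1" "\<phi> = k *s \<psi>"
  shows "atom x \<phi> = atom x \<psi>"
proof -
  have "k * cnj k = 1"
    using assms by (auto simp: cinner_simps mult.commute)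
  then have "(cmod k)\<^sup>2 = 1"
    by (metis complex_norm_square of_real_eq_1_iff)
  then show ?thesis
    unfolding assms(3) by (simp add: fun_eq_iff atom_scale_right)
qed

text \<open>Parallel unit vectors \<open>\<phi> m\<close> and \<open>\<phi> n\<close> differ by a
  phase, which an atom does not see. The two atoms can therefore be rotated so that any prescribed
  nontrivial combination of \<open>x m\<close> and \<open>x n\<close> becomes, up to a positive
  factor, one of the new vectors.\<close>

lemma minimal_rep_rotate:
  assumes min: "minimal_rep S x \<phi> f" and mn: "m \<in> S" "n \<in> S" "m \<noteq> n"
    and par: "\<phi> m = k *s \<phi> n" and cd: "c \<noteq> 0 \<or> d \<noteq> 0"
  obtains r y z where "r > 0" "complex_of_real r *s y = c *s x m + d *s x n"
    "minimal_rep S (x(m := y, n := z)) (\<phi>(m := \<phi> n, n := \<phi> n)) f"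
proof -
  define r where "r = sqrt ((cmod c)\<^sup>2 + (cmod d)\<^sup>2)"
  have r: "r > 0" "r\<^sup>2 = (cmod c)\<^sup>2 + (cmod d)\<^sup>2"
    using cd by (auto simp: r_def add_pos_nonneg add_nonneg_pos)
  let ?r = "complex_of_real r"
  let ?y = "(c / ?r) *s x m + (d / ?r) *s x n" and ?z = "(cnj c / ?r) *s x n - (cnj d / ?r) *s x m"
  have unit: "cinner (\<phi> s) (\<phi> s) = 1" if "s \<in> S" for s
    using min that by (simp add: minimal_rep_def atom_rep_def)
  show ?thesis
  proof (rule that[of r ?y ?z])
    show "r > 0" by (rule r(1))
    show "?r *s ?y = c *s x m + d *s x n"
      using r(1) by (simp add: vec_eq_iff distrib_left)
    show "minimal_rep S (x(m := ?y, n := ?z)) (\<phi>(m := \<phi> n, n := \<phi> n)) f"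
    proof (rule minimal_rep_replace_two[OF min mn unit[OF mn(2)] unit[OF mn(2)]])
      have "atom (x m) (\<phi> m) = atom (x m) (\<phi> n)"
        by (rule atom_rep_unit_parallel[OF unit[OF mn(1)] unit[OF mn(2)] par])
      then show "atom ?y (\<phi> n) \<rho> + atom ?z (\<phi> n) \<rho> = atom (x m) (\<phi> m) \<rho> + atom (x n) (\<phi> n) \<rho>" for \<rho>
        using atom_rotate[of r c d "x m" "x n" "\<phi> n" \<rho>] r by simp
    qed
  qed
qed

text \<open>Taking the trace of \<open>\<Sum> |x\<rangle>\<langle>x| = 1\<close> shows that there
  are exactly \<open>CARD('d)\<close> atoms, so they can be indexed by \<open>'d\<close>.\<close>

lemma atom_rep_orthonormal_imp_CQ:
  fixes f :: "'d::finite cmat \<Rightarrow> 'd cmat"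
  assumes rep: "atom_rep S x \<phi> f" and tp: "trace_preserving f"
    and orth: "\<And>m n. m \<in> S \<Longrightarrow> n \<in> S \<Longrightarrow> cinner (x m) (x n) = (if m = n then 1 else 0)"
  shows "extreme_CQ_map f"
proof -
  have S: "finite S" and f: "f = (\<lambda>\<rho>. \<Sum>s\<in>S. atom (x s) (\<phi> s) \<rho>)"
    and unit: "\<And>s. s \<in> S \<Longrightarrow> cinner (\<phi> s) (\<phi> s) = 1"
    using rep by (auto simp: atom_rep_def)
  have complete: "(\<Sum>s\<in>S. x s $ b * cnj (x s $ a)) = (if a = b then 1 else 0)" for a b
    using tp unit unfolding f trace_preserving_atoms by simp
  have "complex_of_nat CARD('d) = (\<Sum>a\<in>(UNIV :: 'd set). \<Sum>s\<in>S. x s $ a * cnj (x s $ a))"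
    by (simp add: complete)
  also have "\<dots> = (\<Sum>s\<in>S. cinner (x s) (x s))"
    by (subst sum.swap) (simp add: cinner_def mult.commute)
  also have "\<dots> = complex_of_nat (card S)"
    using orth by simp
  finally have "CARD('d) = card S" by simp
  then obtain h where h: "bij_betw h (UNIV :: 'd set) S"
    using S finite_same_card_bij[of "UNIV :: 'd set" S] by auto
  have hS: "h k \<in> S" for k using h by (auto simp: bij_betw_def)
  have hinj: "h j = h k \<longleftrightarrow> j = k" for j k using h by (auto simp: bij_betw_def inj_on_def)
  have "v \<in> vec.span (range (\<lambda>k. x (h k)))" for v :: "complex^'d"
  proof -
    have "v = (\<Sum>k\<in>UNIV. cinner (x (h k)) v *s x (h k))"
    proof -
      have "(\<Sum>k\<in>UNIV. cinner (x (h k)) v *s x (h k)) $ b = v $ b" for b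
      proof -
        have "(\<Sum>k\<in>UNIV. cinner (x (h k)) v *s x (h k)) $ b = (\<Sum>s\<in>S. cinner (x s) v * x s $ b)"
          by (simp add: sum.reindex_bij_betw[OF h, of "\<lambda>s. cinner (x s) v * x s $ b"])
        also have "\<dots> = (\<Sum>s\<in>S. \<Sum>a\<in>UNIV. v $ a * (x s $ b * cnj (x s $ a)))"
          by (simp add: cinner_def sum_distrib_left sum_distrib_right mult_ac)
        also have "\<dots> = (\<Sum>a\<in>UNIV. v $ a * (\<Sum>s\<in>S. x s $ b * cnj (x s $ a)))"
          by (subst sum.swap) (simp add: sum_distrib_left)
        also have "\<dots> = v $ b"
          unfolding complete by (simp add: if_distrib[of "\<lambda>y. _ * y"] cong: if_cong)
        finally show ?thesis .
      qed
      then show ?thesis by (simp add: vec_eq_iff)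
    qed
    also have "\<dots> \<in> vec.span (range (\<lambda>k. x (h k)))"
      by (intro vec.span_sum vec.span_scale vec.span_base) simp
    finally show ?thesis .
  qed
  then have "orthonormal_basis (\<lambda>k. x (h k))"
    unfolding orthonormal_basis_def using orth hS hinj by auto
  moreover have "entries (pure_state \<psi>) = (\<lambda>i j. \<psi> $ i * cnj (\<psi> $ j))" for \<psi> :: "complex^'d"
    by (simp add: entries_def fun_eq_iff)
  then have "density_matrix (pure_state (\<phi> (h k)))" for k
    unfolding density_matrix_def density_on_def
    using psd_on_outer[of UNIV "\<lambda>i. \<phi> (h k) $ i"] unit[OF hS, of k]
    by (simp add: cinner_def mult.commute)
  moreover have "norm (\<phi> (h k)) = 1" for k
  proof -
    have "(norm (\<phi> (h k)))\<^sup>2 = 1"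
      using unit[OF hS, of k] by (simp only: cinner_self of_real_eq_1_iff)
    then show ?thesis
      using norm_ge_zero[of "\<phi> (h k)"] by (auto simp: power2_eq_1_iff)
  qed
  moreover have "f \<rho> = (\<Sum>k\<in>UNIV. atom (x (h k)) (\<phi> (h k)) \<rho>)" for \<rho>
    unfolding f by (simp add: sum.reindex_bij_betw[OF h, of "\<lambda>s. atom (x s) (\<phi> s) \<rho>"])
  ultimately have "pure_CQ_form (\<lambda>k. x (h k)) (\<lambda>k. \<phi> (h k)) f"
    by (simp add: pure_CQ_form_def CQ_form_def atom_def)
  then show ?thesis unfolding extreme_CQ_map_def by blast
qed

lemma extreme_CPT_CQ_imp_nonorthogonal:
  fixes \<Phi> :: "'d::finite superop"
  assumes CQ: "pure_CQ_form e \<psi> (blinfun_apply \<Phi>)" and ext: "\<Phi> extreme_point_of CPT_maps"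
  shows "cinner (\<psi> j) (\<psi> k) \<noteq> 0"
proof (rule extreme_CPT_nonorthogonal[OF ext pure_CQ_form_atoms(1)[OF CQ]])
  show "e j \<noteq> 0" "e k \<noteq> 0"
    using pure_CQ_form_atoms(2)[OF CQ, of j j] pure_CQ_form_atoms(2)[OF CQ, of k k] by auto
  show "\<psi> j \<noteq> 0" "\<psi> k \<noteq> 0"
    using pure_CQ_form_atoms(3)[OF CQ, of j] pure_CQ_form_atoms(3)[OF CQ, of k] by auto
qed simp_all

text \<open>Induction on the size of the support of a linear dependency: if it is as small as possible, then
  perturbing the channel forces all \<open>\<phi>\<^sub>m\<close> with \<open>m\<close> in the support to be parallel, and rotating two
  of the corresponding \<open>x\<^sub>m\<close> into each other shrinks the support.\<close>

lemma extreme_CPT_minimal_rep_independent: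
  fixes \<Phi> :: "'d::finite superop"
  assumes ext: "\<Phi> extreme_point_of CPT_maps"
    and min: "minimal_rep S x \<phi> (blinfun_apply \<Phi>)"
    and dep: "(\<Sum>m\<in>S. c m *s x m) = 0"
  shows "\<forall>m\<in>S. c m = 0"
  using min dep
proof (induction "card {m \<in> S. c m \<noteq> 0}" arbitrary: x \<phi> c rule: less_induct)
  case less
  note min = less.prems(1) and dep = less.prems(2)
  have S: "finite S" and unit: "\<And>s. s \<in> S \<Longrightarrow> cinner (\<phi> s) (\<phi> s) = 1"
    and \<Phi>: "blinfun_apply \<Phi> = (\<lambda>\<rho>. \<Sum>s\<in>S. atom (x s) (\<phi> s) \<rho>)"
    using min by (auto simp: minimal_rep_def atom_rep_def)
  have x0: "x m \<noteq> 0" if "m \<in> S" for m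
    using minimal_rep_nonzero[OF min that] .
  have \<phi>0: "\<phi> m \<noteq> 0" if "m \<in> S" for m
    using unit[OF that] by auto
  have IH: "\<forall>m\<in>S. c' m = 0"
    if "minimal_rep S x' \<phi>' (blinfun_apply \<Phi>)" "(\<Sum>m\<in>S. c' m *s x' m) = 0"
      "n \<in> S" "c n \<noteq> 0" "c' n = 0" "\<And>m. m \<in> S \<Longrightarrow> c' m \<noteq> 0 \<Longrightarrow> c m \<noteq> 0" for x' \<phi>' c' n
  proof (rule less.hyps[OF _ that(1,2)])
    have "{m \<in> S. c' m \<noteq> 0} \<subset> {m \<in> S. c m \<noteq> 0}"
      using that(3-6) by auto
    then show "card {m \<in> S. c' m \<noteq> 0} < card {m \<in> S. c m \<noteq> 0}"
      using S by (intro psubset_card_mono) auto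
  qed
  show ?case
  proof (rule ccontr)
    assume "\<not> ?case"
    then obtain n where n: "n \<in> S" "c n \<noteq> 0" by auto
    have nonorth: "cinner (\<phi> n) (\<phi> m) \<noteq> 0" if "m \<in> S" for m
      using extreme_CPT_nonorthogonal[OF ext \<Phi> S n(1) that] x0 \<phi>0 that n(1) by blast
    \<comment> \<open>With these coefficients the adjoint of the \<open>n\<close>-th Kraus operator
      times \<open>Z\<close> is \<open>x n\<close> times the adjoint of
      \<open>\<Sum>m\<in>S. c m *s x m\<close>, which is zero by the dependency.\<close>
    define z where "z = (\<lambda>m. cnj (c m) / cinner (\<phi> n) (\<phi> m))"
    have Z: "(\<Sum>m\<in>S. z m * outer (\<phi> m) (x m) i a) = 0" for i a
    proof -
      obtain i0 a0 where ia: "outer (\<phi> n) (x n) i0 a0 \<noteq> 0"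
        using outer_nonzero x0 \<phi>0 n(1) by blast
      show ?thesis
      proof (rule extreme_CPT_kraus[OF ext, where S = S and A = "\<lambda>m. outer (\<phi> m) (x m)" and n = n
            and z = z and Z = "\<lambda>i a. \<Sum>m\<in>S. z m * outer (\<phi> m) (x m) i a"])
        fix a b
        have "(\<Sum>i\<in>UNIV. cnj (outer (\<phi> n) (x n) i a) * (\<Sum>m\<in>S. z m * outer (\<phi> m) (x m) i b))
            = (\<Sum>m\<in>S. x n $ a * (z m * cinner (\<phi> n) (\<phi> m)) * cnj (x m $ b))"
          by (simp add: outer_def cinner_def sum_distrib_left sum_distrib_right sum.swap[of _ UNIV] mult_ac)
        also have "\<dots> = x n $ a * cnj ((\<Sum>m\<in>S. c m *s x m) $ b)"
          using nonorth by (simp add: z_def sum_distrib_left mult_ac)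
        finally show "(\<Sum>i\<in>UNIV. cnj (outer (\<phi> n) (x n) i a) * (\<Sum>m\<in>S. z m * outer (\<phi> m) (x m) i b)) = 0"
          using dep by simp
      qed (use \<Phi> S n ia in \<open>auto simp: kraus_outer\<close>)
    qed
    \<comment> \<open>Pairing \<open>Z = 0\<close> with \<open>w\<close> gives a dependency of the
      \<open>x m\<close> in which \<open>n\<close> has dropped out of the support; by the induction
      hypothesis it is trivial.\<close>
    have perp: "cinner w (\<phi> m) = 0" if w: "cinner w (\<phi> n) = 0" and m: "m \<in> S" "c m \<noteq> 0" for w m
    proof -
      define c' where "c' = (\<lambda>m. cnj (z m * cinner w (\<phi> m)))"
      have "(\<Sum>m\<in>S. c' m *s x m) $ a = 0" for a
      proof -
        have "cnj ((\<Sum>m\<in>S. c' m *s x m) $ a) = (\<Sum>i\<in>UNIV. cnj (w $ i) * (\<Sum>m\<in>S. z m * outer (\<phi> m) (x m) i a))"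
          by (simp add: c'_def outer_def cinner_def sum_distrib_left sum_distrib_right sum.swap[of _ UNIV] mult_ac)
        also have "\<dots> = 0" by (simp add: Z)
        finally show ?thesis by (simp only: complex_cnj_zero_iff)
      qed
      then have "(\<Sum>m\<in>S. c' m *s x m) = 0" by (simp add: vec_eq_iff)
      from IH[OF min this n] have "\<forall>m\<in>S. c' m = 0"
        using w by (auto simp: c'_def z_def)
      then show ?thesis
        using m nonorth[OF m(1)] by (auto simp: c'_def z_def)
    qed
    have par: "\<phi> m = cinner (\<phi> n) (\<phi> m) *s \<phi> n" if m: "m \<in> S" "c m \<noteq> 0" for m
    proof -
      define w where "w = \<phi> m - cinner (\<phi> n) (\<phi> m) *s \<phi> n"
      have "cinner (\<phi> n) w = 0"
        by (simp add: w_def cinner_simps unit[OF n(1)])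
      then have wn: "cinner w (\<phi> n) = 0" by (simp add: cinner_eq_0_commute)
      then have "cinner w w = 0"
        by (subst (2) w_def) (simp add: cinner_simps perp[OF wn m])
      then show ?thesis by (simp add: w_def)
    qed
    show False
    proof (cases "\<exists>m\<in>S. m \<noteq> n \<and> c m \<noteq> 0")
      case False
      have "(\<Sum>m\<in>S. c m *s x m) = c n *s x n + (\<Sum>m\<in>S - {n}. c m *s x m)"
        using S n(1) by (simp add: sum.remove)
      also have "(\<Sum>m\<in>S - {n}. c m *s x m) = 0"
        using False by (intro sum.neutral) auto
      finally show False
        using dep n(2) x0[OF n(1)] by (simp add: vector_mul_eq_0)
    next
      case True
      then obtain m where m: "m \<in> S" "m \<noteq> n" "c m \<noteq> 0" by auto
      obtain r y u where r: "r > 0" and y: "complex_of_real r *s y = c m *s x m + c n *s x n"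
        and min': "minimal_rep S (x(m := y, n := u)) (\<phi>(m := \<phi> n, n := \<phi> n)) (blinfun_apply \<Phi>)"
        using minimal_rep_rotate[OF min m(1) n(1) m(2) par[OF m(1,3)], of "c m" "c n"] n(2) by metis
      \<comment> \<open>The rotated vector \<open>y\<close> takes over both terms of the dependency,
        so \<open>n\<close> leaves the support while the coefficient \<open>r\<close> at
        \<open>m\<close> stays positive.\<close>
      define c' where "c' = c(m := complex_of_real r, n := 0)"
      have "(\<Sum>k\<in>S. c' k *s (x(m := y, n := u)) k) = (\<Sum>k\<in>S. c k *s x k)"
        unfolding sum_two[OF S m(1) n(1) m(2)] using m(2) y by (simp add: c'_def)
      then have "\<forall>k\<in>S. c' k = 0"
        using m dep by (intro IH[OF min' _ n]) (auto simp: c'_def split: if_splits)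
      then show False
        using m r by (auto simp: c'_def)
    qed
  qed
qed

text \<open>Applying \<open>\<Sum> |x\<rangle>\<langle>x| = 1\<close> to \<open>x n\<close> gives a
  linear relation among the \<open>x s\<close>; their independence turns it into
  orthonormality.\<close>

lemma extreme_CPT_EBT_imp_CQ:
  fixes \<Phi> :: "'d::finite superop"
  assumes "\<Phi> \<in> EBT_maps" and ext: "\<Phi> extreme_point_of CPT_maps"
  shows "extreme_CQ_map (blinfun_apply \<Phi>)"
proof -
  have eb: "eb (blinfun_apply \<Phi>)" and tp: "trace_preserving (blinfun_apply \<Phi>)"
    using assms(1) by (auto simp: EBT_maps_def EBT_iff)
  obtain S x \<phi> where min: "minimal_rep S x \<phi> (blinfun_apply \<Phi>)"
    using eb_imp_minimal_rep[OF eb] by blast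
  have rep: "atom_rep S x \<phi> (blinfun_apply \<Phi>)" using min by (simp add: minimal_rep_def)
  then have S: "finite S" and f: "blinfun_apply \<Phi> = (\<lambda>\<rho>. \<Sum>s\<in>S. atom (x s) (\<phi> s) \<rho>)"
    and unit: "\<And>s. s \<in> S \<Longrightarrow> cinner (\<phi> s) (\<phi> s) = 1"
    by (auto simp: atom_rep_def)
  have complete: "(\<Sum>s\<in>S. x s $ b * cnj (x s $ a)) = (if a = b then 1 else 0)" for a b
    using tp unit unfolding f trace_preserving_atoms by simp
  show ?thesis
  proof (rule atom_rep_orthonormal_imp_CQ[OF rep tp])
    fix m n assume m: "m \<in> S" and n: "n \<in> S"
    have "(\<Sum>s\<in>S. (cinner (x s) (x n) - (if s = n then 1 else 0)) *s x s) $ b = 0" for b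
    proof -
      have "(\<Sum>s\<in>S. (cinner (x s) (x n) - (if s = n then 1 else 0)) *s x s) $ b
          = (\<Sum>s\<in>S. cinner (x s) (x n) * x s $ b - (if s = n then x s $ b else 0))"
        unfolding sum_component by (intro sum.cong refl) (simp add: algebra_simps)
      also have "\<dots> = (\<Sum>s\<in>S. \<Sum>a\<in>UNIV. x n $ a * (x s $ b * cnj (x s $ a))) - x n $ b"
        using S n by (simp add: sum_subtractf cinner_def sum_distrib_left sum_distrib_right mult_ac)
      also have "(\<Sum>s\<in>S. \<Sum>a\<in>UNIV. x n $ a * (x s $ b * cnj (x s $ a)))
          = (\<Sum>a\<in>UNIV. x n $ a * (\<Sum>s\<in>S. x s $ b * cnj (x s $ a)))"
        by (subst sum.swap) (simp add: sum_distrib_left)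
      also have "\<dots> = x n $ b"
        unfolding complete by (simp add: if_distrib[of "\<lambda>y. _ * y"] cong: if_cong)
      finally show ?thesis by simp
    qed
    then have "(\<Sum>s\<in>S. (cinner (x s) (x n) - (if s = n then 1 else 0)) *s x s) = 0"
      by (simp add: vec_eq_iff)
    from extreme_CPT_minimal_rep_independent[OF ext min this] m
    show "cinner (x m) (x n) = (if m = n then 1 else 0)" by auto
  qed
qed

subsection \<open>Extreme entanglement breaking maps on a qubit\<close>

lemma trace_scaleR: "trace (r *\<^sub>R (M :: 'd::finite cmat)) = r *\<^sub>R trace M"
  by (simp add: trace_def scaleR_sum_right)

text \<open>With parallel \<open>x m\<close> and \<open>x n\<close>, weight can be shifted between
  the two atoms without changing the trace. Extremality then makes the two output projectors act
  alike, and the atoms merge into one, against minimality.\<close>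

lemma extreme_EBT_not_parallel:
  fixes \<Phi> :: "'d::finite superop"
  assumes ext: "\<Phi> extreme_point_of EBT_maps"
    and min: "minimal_rep S x \<phi> (blinfun_apply \<Phi>)"
    and mn: "m \<in> S" "n \<in> S" "m \<noteq> n"
  shows "x m \<noteq> k *s x n"
proof
  assume par: "x m = k *s x n"
  have S: "finite S" and unit: "\<And>s. s \<in> S \<Longrightarrow> cinner (\<phi> s) (\<phi> s) = 1"
    and \<Phi>: "blinfun_apply \<Phi> = (\<lambda>\<rho>. \<Sum>s\<in>S. atom (x s) (\<phi> s) \<rho>)"
    using min by (auto simp: minimal_rep_def atom_rep_def)
  define K where "K = (cmod k)\<^sup>2"
  have "k \<noteq> 0" using minimal_rep_nonzero[OF min mn(1)] par by auto
  then have K: "K > 0" by (simp add: K_def)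
  \<comment> \<open>The weights of the two atoms are \<open>K\<close> and \<open>1\<close>; neither
    may become negative.\<close>
  define \<epsilon> where "\<epsilon> = min 1 K"
  have \<epsilon>: "0 < \<epsilon>" "\<epsilon> \<le> 1" "\<epsilon> \<le> K" using K by (auto simp: \<epsilon>_def)
  let ?A = "atom (x n) (\<phi> m)" and ?B = "atom (x n) (\<phi> n)"
  define R where "R = (\<lambda>\<rho>. \<Sum>s\<in>S - {m, n}. atom (x s) (\<phi> s) \<rho>)"
  have R: "eb R" unfolding R_def using S by (intro eb_atom_sum) simp
  have dec: "blinfun_apply \<Phi> \<rho> = K *\<^sub>R ?A \<rho> + ?B \<rho> + R \<rho>" for \<rho>
    unfolding \<Phi> sum_two[OF S mn] R_def by (simp add: par atom_scale_left K_def)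
  have F\<Phi>: "(\<lambda>\<rho>. (K + \<epsilon>) *\<^sub>R ?A \<rho> + (1 - \<epsilon>) *\<^sub>R ?B \<rho> + R \<rho>) = blinfun_apply \<Phi>"
  proof (rule extreme_EBT_perturb[OF ext])
    show "eb (\<lambda>\<rho>. (K + \<epsilon>) *\<^sub>R ?A \<rho> + (1 - \<epsilon>) *\<^sub>R ?B \<rho> + R \<rho>)"
      "eb (\<lambda>\<rho>. (K - \<epsilon>) *\<^sub>R ?A \<rho> + (1 + \<epsilon>) *\<^sub>R ?B \<rho> + R \<rho>)"
      using \<epsilon> K by (auto intro!: eb_add eb_scaleR eb_atom R)
    fix \<rho>
    show "(K + \<epsilon>) *\<^sub>R ?A \<rho> + (1 - \<epsilon>) *\<^sub>R ?B \<rho> + R \<rho> + ((K - \<epsilon>) *\<^sub>R ?A \<rho> + (1 + \<epsilon>) *\<^sub>R ?B \<rho> + R \<rho>)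
        = blinfun_apply \<Phi> \<rho> + blinfun_apply \<Phi> \<rho>"
      unfolding dec by (simp add: algebra_simps)
    have "trace (?A \<rho>) = trace (?B \<rho>)"
      using unit mn by (simp add: trace_atom)
    then have "trace ((K + \<epsilon>) *\<^sub>R ?A \<rho> + (1 - \<epsilon>) *\<^sub>R ?B \<rho> + R \<rho>) = trace (blinfun_apply \<Phi> \<rho>)"
      unfolding dec trace_add trace_scaleR by (simp add: algebra_simps)
    then show "trace ((K + \<epsilon>) *\<^sub>R ?A \<rho> + (1 - \<epsilon>) *\<^sub>R ?B \<rho> + R \<rho>) = trace \<rho>"
      using ext by (auto simp: extreme_point_of_def EBT_maps_def EBT_iff trace_preserving_def)
  qed
  have "(K + \<epsilon>) *\<^sub>R ?A \<rho> + (1 - \<epsilon>) *\<^sub>R ?B \<rho> + R \<rho> = K *\<^sub>R ?A \<rho> + ?B \<rho> + R \<rho>" for \<rho>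
    using fun_cong[OF F\<Phi>, of \<rho>] by (simp only: dec)
  then have "\<epsilon> *\<^sub>R ?A \<rho> = \<epsilon> *\<^sub>R ?B \<rho>" for \<rho>
    by (simp add: algebra_simps)
  then have AB: "?A \<rho> = ?B \<rho>" for \<rho>
    using \<epsilon>(1) by simp
  show False
  proof (rule minimal_rep_no_merge[OF min mn unit[OF mn(2)]])
    show "atom (complex_of_real (sqrt (1 + K)) *s x n) (\<phi> n) \<rho> = atom (x m) (\<phi> m) \<rho> + atom (x n) (\<phi> n) \<rho>" for \<rho>
      using K AB[of \<rho>] by (simp add: par atom_scale_left K_def[symmetric] algebra_simps)
  qed
qed

text \<open>In terms of the moment vectors \<open>(s\<^sup>4, s\<^sup>3t, s\<^sup>2t\<^sup>2, st\<^sup>3, t\<^sup>4)\<close> of the points \<open>(s, t)\<close>, this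
  identity puts the sum over \<open>(1,0), (0,1), (1,1)\<close> into the interior of the moment cone.\<close>

lemma atom_six_points:
  "atom (2 *s f + g) (2 *s p + q) \<rho> + atom (f + 2 *s g) (p + 2 *s q) \<rho> + atom (f - g) (p - q) \<rho>
    = 9 *\<^sub>R (atom f p \<rho> + atom g q \<rho> + atom (f + g) (p + q) \<rho>)"
proof -
  have "(\<lambda>\<rho>. atom (2 *s f + g) (2 *s p + q) \<rho> + atom (f + 2 *s g) (p + 2 *s q) \<rho> + atom (f - g) (p - q) \<rho>)
    = (\<lambda>\<rho>. 9 *\<^sub>R (atom f p \<rho> + atom g q \<rho> + atom (f + g) (p + q) \<rho>))"
  proof (rule complex_linear_eqI)
    fix a b i j
    show "(atom (2 *s f + g) (2 *s p + q) (mat_unit a b) + atom (f + 2 *s g) (p + 2 *s q) (mat_unit a b)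
        + atom (f - g) (p - q) (mat_unit a b)) $ i $ j
      = (9 *\<^sub>R (atom f p (mat_unit a b) + atom g q (mat_unit a b) + atom (f + g) (p + q) (mat_unit a b))) $ i $ j"
      by (simp add: scaleR_cmat) (simp add: algebra_simps)
  qed (intro complex_linear_add_fun complex_linear_scaleR_fun complex_linear_atom)+
  then show ?thesis by (rule fun_cong)
qed

text \<open>The fourth atom at \<open>2 *s f + g\<close> can be added or subtracted in small
  amounts, the subtraction being rewritten by \<open>atom_six_points\<close>. Corrections at the
  three given atoms restore the trace, and independence shows that the resulting direction
  \<open>D\<close> is not zero.\<close>

lemma extreme_EBT_three_atoms:
  fixes \<Phi> :: "'d::finite superop"
  assumes ext: "\<Phi> extreme_point_of EBT_maps"
    and dec: "\<And>\<rho>. blinfun_apply \<Phi> \<rho> = \<alpha> *\<^sub>R atom f p \<rho> + \<beta> *\<^sub>R atom g q \<rho> + atom (f + g) (p + q) \<rho> + R \<rho>"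
    and pos: "\<alpha> > 0" "\<beta> > 0" and R: "eb R"
    and fg: "\<And>a b. a *s f + b *s g = 0 \<Longrightarrow> a = 0 \<and> b = 0"
    and pq: "\<And>a b. a *s p + b *s q = 0 \<Longrightarrow> a = 0 \<and> b = 0"
  shows False
proof -
  define H1 where "H1 = (norm p)\<^sup>2"
  define H2 where "H2 = (norm q)\<^sup>2"
  define H3 where "H3 = (norm (p + q))\<^sup>2"
  define Hw where "Hw = (norm (2 *s p + q))\<^sup>2"
  have "p \<noteq> 0" "q \<noteq> 0" "p + q \<noteq> 0" "2 *s p + q \<noteq> 0"
    using pq[of 1 0] pq[of 0 1] pq[of 1 1] pq[of 2 1] by auto
  then have H: "H1 > 0" "H2 > 0" "H3 > 0" "Hw > 0"
    by (simp_all add: H1_def H2_def H3_def Hw_def)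
  have cH: "cinner p p = of_real H1" "cinner q q = of_real H2" "cinner (p + q) (p + q) = of_real H3"
    "cinner (2 *s p + q) (2 *s p + q) = of_real Hw"
    by (simp_all only: cinner_self H1_def H2_def H3_def Hw_def)
  \<comment> \<open>The factors 2, -1, 2 come from
    \<open>q (2 f + g) = 2 q f - q g + 2 q (f + g)\<close> for quadratic forms; the quotients of
    squared norms compensate for the traces of the output projectors, so that \<open>D\<close> has
    trace zero.\<close>
  define c1 where "c1 = 2 * Hw / H1"
  define c2 where "c2 = Hw / H2"
  define c3 where "c3 = 2 * Hw / H3"
  have c: "c1 > 0" "c2 > 0" "c3 > 0" using H by (simp_all add: c1_def c2_def c3_def)
  define K where "K = c1 + c2 + c3 + 9"
  \<comment> \<open>Then \<open>\<epsilon> * K\<close> is at most each of the weights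
    \<open>\<alpha>\<close>, \<open>\<beta>\<close> and \<open>1\<close>, which bounds every
    subtraction in \<open>F\<close> and \<open>G\<close>.\<close>
  define \<epsilon> where "\<epsilon> = min (min \<alpha> \<beta>) 1 / K"
  have K: "K > 0" using c by (simp add: K_def)
  have \<epsilon>0: "\<epsilon> > 0" using K pos by (simp add: \<epsilon>_def)
  have "\<epsilon> * K = min (min \<alpha> \<beta>) 1" using K by (simp add: \<epsilon>_def)
  then have \<epsilon>K: "\<epsilon> * c1 + \<epsilon> * c2 + \<epsilon> * c3 + \<epsilon> * 9 \<le> \<alpha>" "\<epsilon> * c1 + \<epsilon> * c2 + \<epsilon> * c3 + \<epsilon> * 9 \<le> \<beta>"
    "\<epsilon> * c1 + \<epsilon> * c2 + \<epsilon> * c3 + \<epsilon> * 9 \<le> 1"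
    unfolding K_def by (auto simp: algebra_simps)
  have \<epsilon>c: "\<epsilon> * c1 > 0" "\<epsilon> * c2 > 0" "\<epsilon> * c3 > 0" using c \<epsilon>0 by simp_all
  let ?A = "atom f p" and ?B = "atom g q" and ?C = "atom (f + g) (p + q)"
    and ?W = "atom (2 *s f + g) (2 *s p + q)"
    and ?V = "\<lambda>\<rho>. atom (f + 2 *s g) (p + 2 *s q) \<rho> + atom (f - g) (p - q) \<rho>"
  define F where "F = (\<lambda>\<rho>. (\<alpha> - \<epsilon> * c1) *\<^sub>R ?A \<rho> + (\<beta> + \<epsilon> * c2) *\<^sub>R ?B \<rho> + (1 - \<epsilon> * c3) *\<^sub>R ?C \<rho> + \<epsilon> *\<^sub>R ?W \<rho> + R \<rho>)"
  \<comment> \<open>This is \<open>\<Phi> - \<epsilon> D\<close>, with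
    \<open>- \<epsilon> ?W\<close> replaced by \<open>\<epsilon> ?V\<close> minus
    \<open>9 \<epsilon>\<close> times the sum of the three given atoms.\<close>
  define G where "G = (\<lambda>\<rho>. (\<alpha> + \<epsilon> * c1 - \<epsilon> * 9) *\<^sub>R ?A \<rho> + (\<beta> - \<epsilon> * c2 - \<epsilon> * 9) *\<^sub>R ?B \<rho>
    + (1 + \<epsilon> * c3 - \<epsilon> * 9) *\<^sub>R ?C \<rho> + \<epsilon> *\<^sub>R ?V \<rho> + R \<rho>)"
  define D where "D = (\<lambda>\<rho>. ?W \<rho> - c1 *\<^sub>R ?A \<rho> + c2 *\<^sub>R ?B \<rho> - c3 *\<^sub>R ?C \<rho>)"
  have F\<Phi>: "F \<rho> = blinfun_apply \<Phi> \<rho> + \<epsilon> *\<^sub>R D \<rho>" for \<rho>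
    unfolding F_def D_def dec by (simp add: algebra_simps)
  have "F = blinfun_apply \<Phi>"
  proof (rule extreme_EBT_perturb[OF ext])
    show "eb F"
      unfolding F_def using \<epsilon>0 \<epsilon>c \<epsilon>K pos by (intro eb_add eb_scaleR eb_atom R) linarith+
    show "eb G"
      unfolding G_def using \<epsilon>0 \<epsilon>c \<epsilon>K pos by (intro eb_add eb_scaleR eb_atom R) linarith+
    fix \<rho>
    have "\<epsilon> *\<^sub>R ?W \<rho> + \<epsilon> *\<^sub>R ?V \<rho> = (\<epsilon> * 9) *\<^sub>R ?A \<rho> + (\<epsilon> * 9) *\<^sub>R ?B \<rho> + (\<epsilon> * 9) *\<^sub>R ?C \<rho>"
      using arg_cong[OF atom_six_points[of f g p q \<rho>], of "\<lambda>M. \<epsilon> *\<^sub>R M"]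
      by (simp add: scaleR_add_right add.assoc)
    then show "F \<rho> + G \<rho> = blinfun_apply \<Phi> \<rho> + blinfun_apply \<Phi> \<rho>"
      unfolding F_def G_def dec by (simp add: scaleR_add_left scaleR_diff_left algebra_simps)
    have "trace (D \<rho>) = 0"
    proof -
      let ?q = "\<lambda>x y. cinner x (\<rho> *v y)"
      have q: "?q (2 *s f + g) (2 *s f + g) = 2 * ?q f f - ?q g g + 2 * ?q (f + g) (f + g)"
        by (simp add: matrix_vector_right_distrib vector_scalar_commute cinner_simps algebra_simps)
      show ?thesis
        unfolding D_def trace_sub trace_add trace_scaleR trace_atom cH q c1_def c2_def c3_def
        using H by (simp add: scaleR_conv_of_real field_simps)
    qed
    then have "trace (F \<rho>) = trace (blinfun_apply \<Phi> \<rho>)"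
      by (simp add: F\<Phi> trace_add trace_scaleR)
    then show "trace (F \<rho>) = trace \<rho>"
      using ext by (auto simp: extreme_point_of_def EBT_maps_def EBT_iff trace_preserving_def)
  qed
  then have D0: "D \<rho> = 0" for \<rho>
    using F\<Phi>[of \<rho>] \<epsilon>0 by simp
  \<comment> \<open>The component of \<open>g\<close> orthogonal to \<open>f\<close>. On
    \<open>pure_state u\<close> the atom at \<open>f\<close> vanishes and the other three acquire
    the common factor \<open>N\<close>.\<close>
  define u where "u = g - (cinner f g / cinner f f) *s f"
  have f0: "f \<noteq> 0" using fg[of 1 0] by auto
  have fu: "cinner f u = 0"
    using f0 by (simp add: u_def cinner_simps)
  have "u \<noteq> 0"
  proof
    assume "u = 0"
    then have "(- (cinner f g / cinner f f)) *s f + 1 *s g = 0"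
      by (simp add: u_def vec_eq_iff)
    from fg[OF this] show False by simp
  qed
  moreover have "cinner u u = cinner g u"
    by (subst u_def) (simp add: cinner_simps fu)
  ultimately have gu: "cinner g u \<noteq> 0" by (metis cinner_self_eq_0)
  have pure: "cinner v (pure_state u *v v) = cinner v u * cnj (cinner v u)" for v
    unfolding cinner_matrix by (simp add: cinner_def sum_product mult_ac)
  define N where "N = cinner g u * cnj (cinner g u)"
  have N0: "N \<noteq> 0" using gu by (simp add: N_def)
  let ?k = "complex_of_real c3" and ?l = "complex_of_real c2"
  \<comment> \<open>After division by \<open>N\<close>, \<open>D (pure_state u)\<close> is a
    combination of the products of \<open>p\<close> and \<open>q\<close> with their adjoints.
    Independence forces the coefficients \<open>4 - ?k\<close> and \<open>2 - ?k\<close> to vanish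
    together.\<close>
  have comb: "(cnj ((4 - ?k) * p $ j + (2 - ?k) * q $ j)) * p $ i
      + (cnj ((2 - ?k) * p $ j + (1 + ?l - ?k) * q $ j)) * q $ i = 0" for i j
  proof -
    have "0 = D (pure_state u) $ i $ j" by (simp add: D0)
    also have "\<dots> = N * ((cnj ((4 - ?k) * p $ j + (2 - ?k) * q $ j)) * p $ i
        + (cnj ((2 - ?k) * p $ j + (1 + ?l - ?k) * q $ j)) * q $ i)"
      unfolding D_def N_def by (simp add: scaleR_cmat atom_component pure cinner_simps fu) (simp add: algebra_simps)
    finally have "N * ((cnj ((4 - ?k) * p $ j + (2 - ?k) * q $ j)) * p $ i
        + (cnj ((2 - ?k) * p $ j + (1 + ?l - ?k) * q $ j)) * q $ i) = 0" by (rule sym)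
    then show ?thesis by (simp only: mult_eq_0_iff N0 simp_thms)
  qed
  have "(4 - ?k) * p $ j + (2 - ?k) * q $ j = 0" for j
  proof -
    have "(cnj ((4 - ?k) * p $ j + (2 - ?k) * q $ j)) *s p
      + (cnj ((2 - ?k) * p $ j + (1 + ?l - ?k) * q $ j)) *s q = 0"
      using comb by (simp only: vec_eq_iff vector_add_component vector_smult_component zero_index simp_thms)
    from pq[OF this] show ?thesis by (metis complex_cnj_zero_iff)
  qed
  then have "(4 - ?k) *s p + (2 - ?k) *s q = 0"
    by (simp only: vec_eq_iff vector_add_component vector_smult_component zero_index simp_thms)
  from pq[OF this] have "4 = ?k" "2 = ?k" by auto
  then have "(4 :: complex) = 2" by (rule trans[OF _ sym])
  then show False by simp
qed

text \<open>The determinant \<open>\<delta>\<close> of \<open>x\<close> and \<open>y\<close> is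
  nonzero, and Cramer's rule gives the coefficients of \<open>v\<close>.\<close>

lemma two_dim_independent:
  fixes x y :: "complex^'d::finite"
  assumes d: "CARD('d) = 2" and y: "y \<noteq> 0" and np: "\<And>k. x \<noteq> k *s y"
  shows "\<exists>a b. v = a *s x + b *s y" and "a *s x + b *s y = 0 \<Longrightarrow> a = 0 \<and> b = 0"
proof -
  obtain i j :: 'd where ij: "UNIV = {i, j}" "i \<noteq> j"
    using d by (metis card_2_iff)
  then have all: "l = i \<or> l = j" for l by (metis UNIV_I insertE singletonD)
  have eqI: "u = w" if "u $ i = w $ i" "u $ j = w $ j" for u w :: "complex^'d"
  proof -
    have "u $ l = w $ l" for l using all[of l] that by auto
    then show ?thesis by (simp add: vec_eq_iff)
  qed
  define \<delta> where "\<delta> = x $ i * y $ j - x $ j * y $ i"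
  have \<delta>: "\<delta> \<noteq> 0"
  proof
    assume 0: "\<delta> = 0"
    show False
    proof (cases "y $ i = 0")
      case True
      then have "y $ j \<noteq> 0" using y eqI[of y 0] by auto
      then have "x = (x $ j / y $ j) *s y"
        using 0 True by (intro eqI) (auto simp: \<delta>_def)
      then show False using np by blast
    next
      case False
      then have "x = (x $ i / y $ i) *s y"
        using 0 by (intro eqI) (auto simp: \<delta>_def field_simps)
      then show False using np by blast
    qed
  qed
  have "v = ((v $ i * y $ j - v $ j * y $ i) / \<delta>) *s x + ((x $ i * v $ j - x $ j * v $ i) / \<delta>) *s y"
    using \<delta> by (intro eqI) (simp_all add: divide_simps, simp_all add: \<delta>_def algebra_simps)
  then show "\<exists>a b. v = a *s x + b *s y" by blast
  assume 0: "a *s x + b *s y = 0"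
  have "a = 0"
  proof (rule ccontr)
    assume a: "a \<noteq> 0"
    have "x = (- b / a) *s y"
    proof -
      have "a * x $ l + b * y $ l = 0" for l using 0 by (simp add: vec_eq_iff)
      then have "a * x $ l = - (b * y $ l)" for l by (simp add: eq_neg_iff_add_eq_0)
      then show ?thesis using a by (simp add: vec_eq_iff field_simps)
    qed
    then show False using np by blast
  qed
  then show "a = 0 \<and> b = 0" using 0 y by (simp add: vector_mul_eq_0)
qed

text \<open>In dimension two, \<open>x k\<close> and \<open>\<phi> k\<close> are combinations of
  those at \<open>m\<close> and \<open>n\<close> with nonzero coefficients. Absorbing the
  coefficients gives the configuration excluded by \<open>extreme_EBT_three_atoms\<close>.\<close>

lemma extreme_EBT_qubit_card_le:
  fixes \<Phi> :: "'d::finite superop"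
  assumes d: "CARD('d) = 2" and ext: "\<Phi> extreme_point_of EBT_maps"
    and min: "minimal_rep S x \<phi> (blinfun_apply \<Phi>)"
  shows "card S \<le> 2"
proof (rule ccontr)
  assume "\<not> card S \<le> 2"
  then obtain T where T: "T \<subseteq> S" "card T = 3"
    by (metis not_less_eq_eq numeral_2_eq_2 numeral_3_eq_3 obtain_subset_with_card_n)
  then obtain m n k where mnk: "m \<in> S" "n \<in> S" "k \<in> S" "m \<noteq> n" "m \<noteq> k" "n \<noteq> k"
    by (auto simp: card_3_iff)
  have S: "finite S" and unit: "\<And>s. s \<in> S \<Longrightarrow> cinner (\<phi> s) (\<phi> s) = 1"
    and \<Phi>: "blinfun_apply \<Phi> = (\<lambda>\<rho>. \<Sum>s\<in>S. atom (x s) (\<phi> s) \<rho>)"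
    using min by (auto simp: minimal_rep_def atom_rep_def)
  note np = extreme_EBT_not_parallel[OF ext]
  have x0: "x s \<noteq> 0" if "s \<in> S" for s using minimal_rep_nonzero[OF min that] .
  have \<phi>0: "\<phi> s \<noteq> 0" if "s \<in> S" for s using unit[OF that] by auto
  \<comment> \<open>If two of the \<open>\<phi>\<close> were parallel, their atoms could be rotated
    until one of the new vectors is parallel to \<open>x l\<close>, contradicting
    \<open>extreme_EBT_not_parallel\<close> for the new representation.\<close>
  have phi_np: "\<phi> s \<noteq> c *s \<phi> t" if st: "s \<in> S" "t \<in> S" "l \<in> S" "s \<noteq> t" "s \<noteq> l" "t \<noteq> l" for s t l c
  proof
    assume par: "\<phi> s = c *s \<phi> t"
    obtain a b where xl: "x l = a *s x s + b *s x t"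
      using two_dim_independent(1)[OF d x0[OF st(2)] np[OF min st(1,2,4)]] by metis
    have "a \<noteq> 0 \<or> b \<noteq> 0" using xl x0[OF st(3)] by auto
    from minimal_rep_rotate[OF min st(1,2,4) par this] obtain r y z where
      r: "r > 0" and y: "complex_of_real r *s y = a *s x s + b *s x t"
      and min': "minimal_rep S (x(s := y, t := z)) (\<phi>(s := \<phi> t, t := \<phi> t)) (blinfun_apply \<Phi>)"
      by metis
    have "complex_of_real r *s y = x l" using y xl by simp
    then have "y = (1 / complex_of_real r) *s x l"
      using r by (metis divide_self_if mult_1 nonzero_eq_divide_eq of_real_eq_0_iff order_less_irrefl
          times_divide_eq_left vector_smult_assoc vector_smult_lid)
    then show False
      using np[OF min' st(1,3,5), of "1 / complex_of_real r"] st by simp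
  qed
  obtain a b where xk: "x k = a *s x m + b *s x n"
    using two_dim_independent(1)[OF d x0[OF mnk(2)] np[OF min mnk(1,2,4)]] by metis
  obtain a' b' where \<phi>k: "\<phi> k = a' *s \<phi> m + b' *s \<phi> n"
    using two_dim_independent(1)[OF d \<phi>0[OF mnk(2)] phi_np[OF mnk]] by metis
  have nz: "a \<noteq> 0" "b \<noteq> 0" "a' \<noteq> 0" "b' \<noteq> 0"
    using np[OF min mnk(3,2), of b] np[OF min mnk(3,1), of a] mnk xk \<phi>k
      phi_np[of k n m b'] phi_np[of k m n a'] by auto
  \<comment> \<open>\<open>\<alpha>\<close> and \<open>\<beta>\<close> undo the rescaling of the
    atoms at \<open>m\<close> and \<open>n\<close>.\<close>
  define \<alpha> where "\<alpha> = 1 / ((cmod a)\<^sup>2 * (cmod a')\<^sup>2)"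
  define \<beta> where "\<beta> = 1 / ((cmod b)\<^sup>2 * (cmod b')\<^sup>2)"
  define R where "R = (\<lambda>\<rho>. \<Sum>s\<in>S - {m, n} - {k}. atom (x s) (\<phi> s) \<rho>)"
  show False
  proof (rule extreme_EBT_three_atoms[OF ext, where f = "a *s x m" and g = "b *s x n"
        and p = "a' *s \<phi> m" and q = "b' *s \<phi> n" and \<alpha> = \<alpha> and \<beta> = \<beta> and R = R])
    show "\<alpha> > 0" "\<beta> > 0" using nz by (simp_all add: \<alpha>_def \<beta>_def)
    show "eb R" unfolding R_def using S by (intro eb_atom_sum) simp
    show "blinfun_apply \<Phi> \<rho> = \<alpha> *\<^sub>R atom (a *s x m) (a' *s \<phi> m) \<rho> + \<beta> *\<^sub>R atom (b *s x n) (b' *s \<phi> n) \<rho>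
        + atom (a *s x m + b *s x n) (a' *s \<phi> m + b' *s \<phi> n) \<rho> + R \<rho>" for \<rho>
    proof -
      have "(\<Sum>s\<in>S - {m, n}. atom (x s) (\<phi> s) \<rho>) = atom (x k) (\<phi> k) \<rho> + R \<rho>"
        unfolding R_def using S mnk by (subst sum.remove[of _ k]) auto
      then show ?thesis
        unfolding \<Phi> sum_two[OF S mnk(1,2,4)] xk[symmetric] \<phi>k[symmetric]
        using nz by (simp add: atom_scale_left atom_scale_right \<alpha>_def \<beta>_def add.assoc)
    qed
    show "c = 0 \<and> d = 0" if "c *s (a *s x m) + d *s (b *s x n) = 0" for c d
      using two_dim_independent(2)[OF d x0[OF mnk(2)] np[OF min mnk(1,2,4)], of "c * a" "d * b"] that nz
      by (simp add: vector_smult_assoc)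
    show "c = 0 \<and> d = 0" if "c *s (a' *s \<phi> m) + d *s (b' *s \<phi> n) = 0" for c d
      using two_dim_independent(2)[OF d \<phi>0[OF mnk(2)] phi_np[OF mnk], of "c * a'" "d * b'"] that nz
      by (simp add: vector_smult_assoc)
  qed
qed

text \<open>From \<open>\<Sum> |x\<rangle>\<langle>x| = 1\<close>, Parseval at \<open>x n\<close>
  bounds every squared norm \<open>N n\<close> by 1, while the trace makes them sum to
  \<open>CARD('d)\<close>. With at most that many terms all equal 1, and Parseval leaves nothing for
  the off-diagonal inner products.\<close>

lemma atom_rep_card_le_imp_CQ:
  fixes f :: "'d::finite cmat \<Rightarrow> 'd cmat"
  assumes rep: "atom_rep S x \<phi> f" and tp: "trace_preserving f" and card: "card S \<le> CARD('d)"
  shows "extreme_CQ_map f"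
proof (rule atom_rep_orthonormal_imp_CQ[OF rep tp])
  have S: "finite S" and f: "f = (\<lambda>\<rho>. \<Sum>s\<in>S. atom (x s) (\<phi> s) \<rho>)"
    and unit: "\<And>s. s \<in> S \<Longrightarrow> cinner (\<phi> s) (\<phi> s) = 1"
    using rep by (auto simp: atom_rep_def)
  have complete: "(\<Sum>s\<in>S. x s $ b * cnj (x s $ a)) = (if a = b then 1 else 0)" for a b
    using tp unit unfolding f trace_preserving_atoms by simp
  define N where "N = (\<lambda>s. (norm (x s))\<^sup>2)"
  have N: "cinner (x s) (x s) = complex_of_real (N s)" for s
    by (simp only: cinner_self N_def)
  have "complex_of_nat CARD('d) = (\<Sum>a\<in>(UNIV :: 'd set). \<Sum>s\<in>S. x s $ a * cnj (x s $ a))"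
    by (simp add: complete)
  also have "\<dots> = (\<Sum>s\<in>S. cinner (x s) (x s))"
    by (subst sum.swap) (simp add: cinner_def mult.commute)
  also have "\<dots> = complex_of_real (\<Sum>s\<in>S. N s)"
    by (simp add: N)
  finally have "complex_of_real (\<Sum>s\<in>S. N s) = complex_of_real (real CARD('d))"
    by simp
  then have sumN: "(\<Sum>s\<in>S. N s) = real CARD('d)"
    by (simp only: of_real_eq_iff)
  have bessel: "(\<Sum>s\<in>S. (cmod (cinner (x s) (x n)))\<^sup>2) = N n" for n
  proof -
    have "complex_of_real (\<Sum>s\<in>S. (cmod (cinner (x s) (x n)))\<^sup>2)
        = (\<Sum>s\<in>S. \<Sum>a\<in>UNIV. \<Sum>b\<in>UNIV. x n $ a * cnj (x n $ b) * (x s $ b * cnj (x s $ a)))"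
      unfolding of_real_sum complex_norm_square
      unfolding cinner_def cnj_sum sum_product by (intro sum.cong refl) (simp add: mult_ac)
    also have "\<dots> = (\<Sum>a\<in>UNIV. \<Sum>b\<in>UNIV. x n $ a * cnj (x n $ b) * (\<Sum>s\<in>S. x s $ b * cnj (x s $ a)))"
      by (subst sum.swap, intro sum.cong refl, subst sum.swap) (simp add: sum_distrib_left)
    also have "\<dots> = (\<Sum>a\<in>UNIV. \<Sum>b\<in>UNIV. if b = a then x n $ a * cnj (x n $ b) else 0)"
      unfolding complete by (intro sum.cong refl) auto
    also have "\<dots> = cinner (x n) (x n)"
      by (simp add: cinner_def mult.commute)
    finally show ?thesis by (simp only: N of_real_eq_iff)
  qed
  have NN: "(N n)\<^sup>2 + (\<Sum>s\<in>S - {n}. (cmod (cinner (x s) (x n)))\<^sup>2) = N n" if "n \<in> S" for n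
    using bessel[of n] S that by (simp add: sum.remove[of S n] N)
  have N1: "N n \<le> 1" if "n \<in> S" for n
  proof (rule ccontr)
    assume "\<not> N n \<le> 1"
    then have "N n * 1 < N n * N n" by (intro mult_strict_left_mono) auto
    moreover have "(\<Sum>s\<in>S - {n}. (cmod (cinner (x s) (x n)))\<^sup>2) \<ge> 0" by (simp add: sum_nonneg)
    ultimately show False using NN[OF that] by (simp add: power2_eq_square)
  qed
  have "(\<Sum>s\<in>S. 1 - N s) = 0"
  proof (rule antisym)
    show "(\<Sum>s\<in>S. 1 - N s) \<le> 0" using card sumN by (simp add: sum_subtractf)
    show "0 \<le> (\<Sum>s\<in>S. 1 - N s)" using N1 by (intro sum_nonneg) simp
  qed
  then have Neq: "N n = 1" if "n \<in> S" for n
    using S N1 that by (subst (asm) sum_nonneg_eq_0_iff) auto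
  show "cinner (x m) (x n) = (if m = n then 1 else 0)" if m: "m \<in> S" and n: "n \<in> S" for m n
  proof (cases "m = n")
    case True
    then show ?thesis by (simp add: N Neq[OF n])
  next
    case False
    have "(\<Sum>s\<in>S - {n}. (cmod (cinner (x s) (x n)))\<^sup>2) = 0"
      using NN[OF n] Neq[OF n] by simp
    then have "(cmod (cinner (x m) (x n)))\<^sup>2 = 0"
      using S m False by (subst (asm) sum_nonneg_eq_0_iff) auto
    then show ?thesis using False by simp
  qed
qed

lemma extreme_EBT_qubit_imp_CQ:
  fixes \<Phi> :: "'d::finite superop"
  assumes d: "CARD('d) = 2" and ext: "\<Phi> extreme_point_of EBT_maps"
  shows "extreme_CQ_map (blinfun_apply \<Phi>)"
proof -
  have "eb (blinfun_apply \<Phi>)" and tp: "trace_preserving (blinfun_apply \<Phi>)"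
    using ext by (auto simp: extreme_point_of_def EBT_maps_def EBT_iff)
  then obtain S x \<phi> where min: "minimal_rep S x \<phi> (blinfun_apply \<Phi>)"
    using eb_imp_minimal_rep by blast
  then show ?thesis
    using atom_rep_card_le_imp_CQ[of S x \<phi>, OF _ tp] extreme_EBT_qubit_card_le[OF d ext min] d
    by (simp add: minimal_rep_def)
qed

subsection \<open>An extreme entanglement breaking map that is not classical-quantum\<close>

text \<open>With \<open>x\<^sub>p = (1, 2)\<close>, \<open>x\<^sub>q = (1, -2)\<close> and \<open>x\<^sub>* = (1, 0)\<close> (index \<open>None\<close>) on the plane of the basis
  vectors \<open>p, q\<close>, and basis vectors otherwise, the only product operators in the span of the
  \<open>\<phi>\<^sub>m x\<^sub>m\<^sup>*\<close> are the multiples of the \<open>\<phi>\<^sub>m x\<^sub>m\<^sup>*\<close> themselves.\<close>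

definition plane_vec :: "'d::finite \<Rightarrow> 'd \<Rightarrow> 'd option \<Rightarrow> complex^'d" where
  "plane_vec p q m = (\<chi> a. case m of None \<Rightarrow> (if a = p then 1 else 0)
    | Some k \<Rightarrow> if k = p then (if a = p then 1 else if a = q then 2 else 0)
        else if k = q then (if a = p then 1 else if a = q then -2 else 0)
        else (if a = k then 1 else 0))"

text \<open>Outside the plane the target is not just the basis vector \<open>k\<close>: for
  \<open>k = r\<close> it would coincide with the target of \<open>None\<close>, and combinations of
  the two Kraus operators would again be product operators.\<close>

definition target_vec :: "'d::finite \<Rightarrow> 'd \<Rightarrow> 'd \<Rightarrow> 'd option \<Rightarrow> complex^'d" where
  "target_vec p q r m = (\<chi> i. case m of None \<Rightarrow> (if i = r then 1 else 0)
    | Some k \<Rightarrow> if k = p \<or> k = q then (if i = k then 1 else 0)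
        else (if i = p \<or> i = q \<or> i = k then 1 else 0))"

text \<open>The functionals dual to the matrices \<open>B\<^sup>* B\<close> with \<open>B = \<phi>\<^sub>m x\<^sub>m\<^sup>*\<close>.\<close>

definition dual_coeff :: "'d::finite \<Rightarrow> 'd \<Rightarrow> 'd option \<Rightarrow> ('d \<Rightarrow> 'd \<Rightarrow> complex) \<Rightarrow> complex" where
  "dual_coeff p q m G = (case m of None \<Rightarrow> G p p - G q q / 4
    | Some k \<Rightarrow> if k = p then G q q / 8 + G p q / 4
        else if k = q then G q q / 8 - G p q / 4 else G k k / 3)"

text \<open>The weights that make the map trace preserving, equal to the dual functionals evaluated
  at the identity matrix.\<close>

definition plane_weight :: "'d::finite \<Rightarrow> 'd \<Rightarrow> 'd option \<Rightarrow> real" where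
  "plane_weight p q m = (case m of None \<Rightarrow> 3 / 4 | Some k \<Rightarrow> if k = p \<or> k = q then 1 / 8 else 1 / 3)"

lemma sum_option: "(\<Sum>m\<in>UNIV. g m) = g None + (\<Sum>k\<in>UNIV. g (Some k))"
  for g :: "'d::finite option \<Rightarrow> 'a::comm_monoid_add"
proof -
  have "(\<Sum>m\<in>insert None (range Some). g m) = g None + (\<Sum>m\<in>range Some. g m)"
    by (subst sum.insert) auto
  then show ?thesis
    unfolding UNIV_option_conv by (simp add: sum.reindex)
qed

lemma target_vec_self:
  assumes "p \<noteq> q"
  shows "cinner (target_vec p q r m) (target_vec p q r m)
    = (case m of None \<Rightarrow> 1 | Some k \<Rightarrow> if k = p \<or> k = q then 1 else 3)"
proof -
  have ind: "(\<Sum>i\<in>UNIV. cnj (if P i then 1 else 0) * (if P i then 1 else 0)) = complex_of_nat (card {i. P i})"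
    for P :: "'a \<Rightarrow> bool"
  proof -
    have "(\<Sum>i\<in>UNIV. cnj (if P i then 1 else 0) * (if P i then 1 else 0)) = (\<Sum>i\<in>{i. P i}. (1::complex))"
      by (intro sum.mono_neutral_cong_right) auto
    then show ?thesis by simp
  qed
  show ?thesis
  proof (cases m)
    case None
    then show ?thesis by (simp add: cinner_def target_vec_def ind)
  next
    case (Some k)
    have "{i. i = p \<or> i = q \<or> i = k} = {p, q, k}" by auto
    then show ?thesis
      using assms Some by (auto simp: cinner_def target_vec_def ind)
  qed
qed

lemma dual_coeff_sum: "dual_coeff p q m (\<lambda>a b. \<Sum>s\<in>S. G s a b) = (\<Sum>s\<in>S. dual_coeff p q m (G s))"
  by (cases m) (simp_all add: dual_coeff_def sum_subtractf sum.distrib sum_divide_distrib)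

lemma dual_coeff_scale: "dual_coeff p q m (\<lambda>a b. c * G a b) = c * dual_coeff p q m G"
  by (cases m) (simp_all add: dual_coeff_def algebra_simps)

text \<open>Biorthogonality: a nonnegative combination of the atoms can be recovered from its sum of
  \<open>B\<^sup>* B\<close>, which trace preservation prescribes.\<close>

lemma dual_coeff_kraus:
  assumes "p \<noteq> q"
  shows "dual_coeff p q m (\<lambda>a b. \<Sum>i\<in>UNIV. outer (target_vec p q r m') (plane_vec p q m') i a
      * cnj (outer (target_vec p q r m') (plane_vec p q m') i b)) = (if m = m' then 1 else 0)"
proof -
  have "(\<Sum>i\<in>UNIV. outer \<phi> x i a * cnj (outer \<phi> x i b)) = cinner \<phi> \<phi> * (cnj (x $ a) * x $ b)"
    for \<phi> x :: "complex^'a" and a b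
    by (simp add: outer_def cinner_def sum_distrib_left sum_distrib_right mult_ac)
  then have "dual_coeff p q m (\<lambda>a b. \<Sum>i\<in>UNIV. outer (target_vec p q r m') (plane_vec p q m') i a
      * cnj (outer (target_vec p q r m') (plane_vec p q m') i b))
    = cinner (target_vec p q r m') (target_vec p q r m')
      * dual_coeff p q m (\<lambda>a b. cnj (plane_vec p q m' $ a) * plane_vec p q m' $ b)"
    by (simp only: dual_coeff_scale)
  also have "\<dots> = (if m = m' then 1 else 0)"
  proof (cases m')
    case None
    then show ?thesis
      using assms by (cases m) (simp_all add: target_vec_self[OF assms] dual_coeff_def plane_vec_def)
  next
    case (Some k)
    consider "k = p" | "k = q" "k \<noteq> p" | "k \<noteq> p" "k \<noteq> q" by blast
    then show ?thesis
      using assms Some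
      by cases (cases m; auto simp: target_vec_self[OF assms] dual_coeff_def plane_vec_def)+
  qed
  finally show ?thesis .
qed

lemma dual_coeff_id:
  assumes "p \<noteq> q"
  shows "dual_coeff p q m (\<lambda>a b. if a = b then 1 else 0) = complex_of_real (plane_weight p q m)"
  using assms by (cases m) (auto simp: dual_coeff_def plane_weight_def)

text \<open>The hypotheses are linear relations valid on the span, imposed on a product
  \<open>u i * v a\<close>. If \<open>v k\<close> is nonzero off the plane, \<open>u\<close> is a
  multiple of the target of \<open>Some k\<close>, and, unless \<open>u = 0\<close>, rows
  \<open>p\<close> and \<open>q\<close> make \<open>v\<close> vanish on the plane. Otherwise
  \<open>v\<close> lives on the plane, where rows \<open>p\<close>, \<open>q\<close>,
  \<open>r\<close> prescribe three different directions, so at most one of them is occupied.\<close>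

lemma product_in_span:
  fixes u v :: "'d::finite \<Rightarrow> complex"
  assumes pqr: "p \<noteq> q" "r \<noteq> p" "r \<noteq> q"
    and h1: "u p * v q = 2 * (u p * v p)" and h2: "u q * v q = -2 * (u q * v p)" and h3: "u r * v q = 0"
    and h4: "\<And>i. i \<notin> {p, q, r} \<Longrightarrow> u i * v p = 0" "\<And>i. i \<notin> {p, q, r} \<Longrightarrow> u i * v q = 0"
    and h5: "\<And>k. k \<notin> {p, q} \<Longrightarrow> u p * v k = u k * v k" "\<And>k. k \<notin> {p, q} \<Longrightarrow> u q * v k = u k * v k"
      "\<And>k i. k \<notin> {p, q} \<Longrightarrow> i \<notin> {p, q, k} \<Longrightarrow> u i * v k = 0"
  shows "\<exists>m \<beta>. \<forall>i a. u i * v a = \<beta> * outer (target_vec p q r m) (plane_vec p q m) i a"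
proof -
  have zero: ?thesis if "\<And>i a. u i * v a = 0"
    by (rule exI[of _ None], rule exI[of _ 0]) (simp add: that)
  have prod: ?thesis
    if "\<And>i. u i = b * target_vec p q r m $ i" "\<And>a. v a = c * cnj (plane_vec p q m $ a)" for b c m
    by (rule exI[of _ m], rule exI[of _ "b * c"]) (simp add: that outer_def)
  show ?thesis
  proof (cases "\<exists>k. k \<notin> {p, q} \<and> v k \<noteq> 0")
    case True
    then obtain k where k: "k \<notin> {p, q}" "v k \<noteq> 0" by blast
    have u: "u p = u k" "u q = u k" "\<And>i. i \<notin> {p, q, k} \<Longrightarrow> u i = 0"
      using h5[OF k(1)] k(2) by auto
    show ?thesis
    proof (cases "u k = 0")
      case True
      then have "u i = 0" for i using u by (cases "i \<in> {p, q, k}") auto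
      then show ?thesis by (intro zero) simp
    next
      case False
      have "v q = 2 * v p" using h1 u False by simp
      moreover have "u k * v q = u k * (-2 * v p)" using h2 u by simp
      then have "v q = -2 * v p" by (rule mult_left_cancel[OF False, THEN iffD1])
      ultimately have v: "v p = 0" "v q = 0" by simp_all
      have v': "v k' = 0" if "k' \<notin> {p, q, k}" for k'
        using h5(1)[of k'] u(3)[OF that] that u(1) False by auto
      show ?thesis
      proof (rule prod[of "u k" "Some k" "v k"])
        show "u i = u k * target_vec p q r (Some k) $ i" for i
          using u k by (auto simp: target_vec_def)
        show "v a = v k * cnj (plane_vec p q (Some k) $ a)" for a
          using v v'[of a] k by (cases "a \<in> {p, q, k}") (auto simp: plane_vec_def)
      qed
    qed
  next
    case False
    then have v0: "\<And>k. k \<notin> {p, q} \<Longrightarrow> v k = 0" by blast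
    show ?thesis
    proof (cases "v p = 0 \<and> v q = 0")
      case True
      then have "v a = 0" for a using v0 by (cases "a \<in> {p, q}") auto
      then show ?thesis by (intro zero) simp
    next
      case vpq: False
      then have u0: "\<And>i. i \<notin> {p, q, r} \<Longrightarrow> u i = 0"
        using h4 by auto
      show ?thesis
      proof (cases "u p = 0")
        case up: False
        have vq: "v q = 2 * v p" using h1 up by simp
        then have vp: "v p \<noteq> 0" using vpq by auto
        have "u q = 0" using h2 vq vp by auto
        moreover have "u r = 0" using h3 vq vp by auto
        ultimately have ui: "u i = 0" if "i \<noteq> p" for i using that u0[of i] by auto
        show ?thesis
        proof (rule prod[of "u p" "Some p" "v p"])
          show "u i = u p * target_vec p q r (Some p) $ i" for i
            using ui by (auto simp: target_vec_def)
          show "v a = v p * cnj (plane_vec p q (Some p) $ a)" for a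
            using v0[of a] vq pqr by (auto simp: plane_vec_def)
        qed
      next
        case up: True
        show ?thesis
        proof (cases "u q = 0")
          case uq: False
          have "u q * v q = u q * (-2 * v p)" using h2 by simp
          then have vq: "v q = -2 * v p" by (rule mult_left_cancel[OF uq, THEN iffD1])
          then have vp: "v p \<noteq> 0" using vpq by auto
          have "u r = 0" using h3 vq vp by auto
          then have ui: "u i = 0" if "i \<noteq> q" for i using that u0[of i] up by auto
          show ?thesis
          proof (rule prod[of "u q" "Some q" "v p"])
            show "u i = u q * target_vec p q r (Some q) $ i" for i
              using ui by (auto simp: target_vec_def)
            show "v a = v p * cnj (plane_vec p q (Some q) $ a)" for a
              using v0[of a] vq pqr by (auto simp: plane_vec_def)
          qed
        next
          case uq: True
          have ui: "u i = 0" if "i \<noteq> r" for i using that u0[of i] up uq by auto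
          show ?thesis
          proof (cases "u r = 0")
            case True
            then have "u i = 0" for i using ui by (cases "i = r") auto
            then show ?thesis by (intro zero) simp
          next
            case False
            then have vq: "v q = 0" using h3 by simp
            show ?thesis
            proof (rule prod[of "u r" None "v p"])
              show "u i = u r * target_vec p q r None $ i" for i
                using ui by (auto simp: target_vec_def)
              show "v a = v p * cnj (plane_vec p q None $ a)" for a
                using v0[of a] vq by (auto simp: plane_vec_def)
            qed
          qed
        qed
      qed
    qed
  qed
qed

text \<open>\<open>kraus_range\<close> for a proportionality between two matrix entries;
  \<open>z = 0\<close> expresses that an entry vanishes.\<close>

lemma kraus_range_two:
  fixes A :: "'m \<Rightarrow> 'd::finite \<Rightarrow> 'd \<Rightarrow> complex" and B :: "'s \<Rightarrow> 'd \<Rightarrow> 'd \<Rightarrow> complex"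
  assumes "\<And>\<rho>. (\<Sum>m\<in>M. kraus (A m) \<rho>) = c *\<^sub>R (\<Sum>s\<in>S. kraus (B s) \<rho>) + g \<rho>"
    and "c > 0" "finite S" "complex_linear g" "completely_positive g" "s \<in> S"
    and zero: "\<And>m. m \<in> M \<Longrightarrow> A m i a = z * A m j b"
  shows "B s i a = z * B s j b"
proof -
  let ?z = "\<lambda>i' a'. (if i' = i \<and> a' = a then 1 else 0) - (if i' = j \<and> a' = b then z else 0)"
  have eval: "(\<Sum>i'\<in>UNIV. \<Sum>a'\<in>UNIV. ?z i' a' * C i' a') = C i a - z * C j b" for C :: "'d \<Rightarrow> 'd \<Rightarrow> complex"
  proof -
    have "(\<Sum>i'\<in>UNIV. \<Sum>a'\<in>UNIV. ?z i' a' * C i' a')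
      = (\<Sum>i'\<in>UNIV. \<Sum>a'\<in>UNIV. (if i' = i \<and> a' = a then C i' a' else 0) - (if i' = j \<and> a' = b then z * C i' a' else 0))"
      by (intro sum.cong refl) (auto simp: left_diff_distrib)
    also have "\<dots> = C i a - z * C j b"
      by (simp only: sum_subtractf sum_delta2)
    finally show ?thesis .
  qed
  have "(\<Sum>i'\<in>UNIV. \<Sum>a'\<in>UNIV. ?z i' a' * B s i' a') = 0"
    by (rule kraus_range[OF assms(1-5) _ assms(6)]) (simp only: eval, simp add: zero)
  then show ?thesis by (simp only: eval right_minus_eq)
qed

definition plane_map :: "'d::finite \<Rightarrow> 'd \<Rightarrow> 'd \<Rightarrow> 'd cmat \<Rightarrow> 'd cmat" where
  "plane_map p q r \<rho> = (\<Sum>m\<in>UNIV. plane_weight p q m *\<^sub>R atom (plane_vec p q m) (target_vec p q r m) \<rho>)"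

lemma plane_weight_pos: "plane_weight p q m > 0"
  by (auto simp: plane_weight_def split: option.split)

lemma plane_map_eb: "eb (plane_map p q r)"
proof -
  have "eb (\<lambda>\<rho>. \<Sum>m\<in>UNIV. plane_weight p q m *\<^sub>R atom (plane_vec p q m) (target_vec p q r m) \<rho>)"
    by (intro eb_sum eb_scaleR eb_atom less_imp_le plane_weight_pos)
  then show ?thesis by (simp add: plane_map_def[abs_def])
qed

lemma plane_map_mat_unit:
  "plane_map p q r (mat_unit a b) $ i $ j = (\<Sum>m\<in>UNIV. complex_of_real (plane_weight p q m) *
    (outer (target_vec p q r m) (plane_vec p q m) i a * cnj (outer (target_vec p q r m) (plane_vec p q m) j b)))"
  by (simp add: plane_map_def scaleR_cmat outer_def mult_ac)

lemma plane_map_trace_preserving: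
  assumes "p \<noteq> q" "r \<noteq> p" "r \<noteq> q"
  shows "trace_preserving (plane_map p q r)"
  unfolding trace_preserving_units[OF eb_imp_complex_linear[OF plane_map_eb]]
proof (intro allI)
  fix a b :: 'a
  let ?g = "\<lambda>m. complex_of_real (plane_weight p q m) * cinner (target_vec p q r m) (target_vec p q r m)
    * (cnj (plane_vec p q m $ a) * plane_vec p q m $ b)"
  have "(\<Sum>i\<in>UNIV. plane_map p q r (mat_unit a b) $ i $ i) = (\<Sum>m\<in>UNIV. ?g m)"
    unfolding plane_map_mat_unit
    by (subst sum.swap) (simp add: outer_def cinner_def sum_distrib_left sum_distrib_right mult_ac)
  also have "\<dots> = ?g None + (?g (Some p) + ?g (Some q) + (\<Sum>k\<in>UNIV - {p, q}. ?g (Some k)))"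
    unfolding sum_option
    using assms by (simp add: sum.remove[of UNIV p] sum.remove[of "UNIV - {p}" q] Diff_insert2[symmetric] add.assoc)
  also have "(\<Sum>k\<in>UNIV - {p, q}. ?g (Some k)) = (\<Sum>k\<in>UNIV - {p, q}. if k = a then (if a = b then 1 else 0) else 0)"
    using assms by (intro sum.cong refl) (auto simp: target_vec_self plane_weight_def plane_vec_def)
  also have "\<dots> = (if a \<notin> {p, q} \<and> a = b then 1 else 0)"
    by auto
  also have "?g None + (?g (Some p) + ?g (Some q) + (if a \<notin> {p, q} \<and> a = b then 1 else 0)) = (if a = b then 1 else 0)"
    using assms by (auto simp: target_vec_self plane_weight_def plane_vec_def)
  finally show "(\<Sum>i\<in>UNIV. plane_map p q r (mat_unit a b) $ i $ i) = (if a = b then 1 else 0)" .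
qed

text \<open>Each rank-one Kraus operator of \<open>f\<close> lies in the span and is thus a multiple
  of a single given one. Hence \<open>f\<close> is a reweighting of the same atoms, and trace
  preservation fixes the weights through \<open>dual_coeff\<close>.\<close>

lemma plane_map_unique:
  fixes f g :: "'d::finite cmat \<Rightarrow> 'd cmat"
  assumes pqr: "p \<noteq> q" "r \<noteq> p" "r \<noteq> q"
    and f: "is_EBT f" and g: "is_CPT g" and t: "0 < t" "t < 1"
    and dec: "\<And>\<rho>. plane_map p q r \<rho> = t *\<^sub>R f \<rho> + (1 - t) *\<^sub>R g \<rho>"
  shows "f = plane_map p q r"
proof -
  define A where "A = (\<lambda>m. outer (target_vec p q r m) (plane_vec p q m))"
  obtain n :: nat and y \<psi> where fy: "f = (\<lambda>\<rho>. \<Sum>s<n. atom (y s) (\<psi> s) \<rho>)"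
    using f by (auto simp: EBT_iff eb_def)
  define B where "B = (\<lambda>s. outer (\<psi> s) (y s))"
  have fB: "f = (\<lambda>\<rho>. \<Sum>s<n. kraus (B s) \<rho>)"
    by (simp add: fy B_def kraus_outer)
  let ?A' = "\<lambda>m. outer (target_vec p q r m) (complex_of_real (sqrt (plane_weight p q m)) *s plane_vec p q m)"
  have A': "?A' m i a = complex_of_real (sqrt (plane_weight p q m)) * A m i a" for m i a
    by (simp add: A_def outer_def)
  have "kraus (?A' m) \<rho> = plane_weight p q m *\<^sub>R atom (plane_vec p q m) (target_vec p q r m) \<rho>" for m \<rho>
    using less_imp_le[OF plane_weight_pos[of p q m]] by (simp add: kraus_outer atom_scale_left)
  then have dec': "(\<Sum>m\<in>UNIV. kraus (?A' m) \<rho>) = t *\<^sub>R (\<Sum>s<n. kraus (B s) \<rho>) + (1 - t) *\<^sub>R g \<rho>" for \<rho>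
    using dec[of \<rho>] by (simp add: plane_map_def fB)
  have range: "B s i a = z * B s j b" if "s < n" "\<And>m. A m i a = z * A m j b" for s i a z j b
  proof (rule kraus_range_two[OF dec'])
    show "complex_linear (\<lambda>\<rho>. (1 - t) *\<^sub>R g \<rho>)" "completely_positive (\<lambda>\<rho>. (1 - t) *\<^sub>R g \<rho>)"
      using g t by (auto simp: is_CPT_def intro: complex_linear_scaleR_fun completely_positive_scaleR)
    show "?A' m i a = z * ?A' m j b" for m
      unfolding A' that(2)[of m] by simp
  qed (use t that in auto)
  have range0: "B s i a = 0" if "s < n" "\<And>m. A m i a = 0" for s i a
    using range[of s i a 0 i a] that by simp
  have single: "\<exists>m \<beta>. \<forall>i a. B s i a = \<beta> * A m i a" if s: "s < n" for s
  proof -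
    let ?u = "\<lambda>i. \<psi> s $ i" and ?v = "\<lambda>a. cnj (y s $ a)"
    have B: "?u i * ?v a = B s i a" for i a by (simp add: B_def outer_def)
    have "\<exists>m \<beta>. \<forall>i a. ?u i * ?v a = \<beta> * outer (target_vec p q r m) (plane_vec p q m) i a"
    proof (rule product_in_span[OF pqr], unfold B)
      show "B s p q = 2 * B s p p"
        by (rule range[OF s]) (use pqr in \<open>auto simp: A_def outer_def target_vec_def plane_vec_def split: option.split\<close>)
      show "B s q q = - 2 * B s q p"
        by (rule range[OF s]) (use pqr in \<open>auto simp: A_def outer_def target_vec_def plane_vec_def split: option.split\<close>)
      show "B s r q = 0"
        by (rule range0[OF s]) (use pqr in \<open>auto simp: A_def outer_def target_vec_def plane_vec_def split: option.split\<close>)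
    next
      fix i assume i: "i \<notin> {p, q, r}"
      show "B s i p = 0" "B s i q = 0"
        by (rule range0[OF s]; use pqr i in \<open>auto simp: A_def outer_def target_vec_def plane_vec_def split: option.split\<close>)+
    next
      fix k assume k: "k \<notin> {p, q}"
      have "B s p k = 1 * B s k k" "B s q k = 1 * B s k k"
        by (rule range[OF s]; use pqr k in \<open>auto simp: A_def outer_def target_vec_def plane_vec_def split: option.split\<close>)+
      then show "B s p k = B s k k" "B s q k = B s k k" by simp_all
    next
      fix k i assume k: "k \<notin> {p, q}" "i \<notin> {p, q, k}"
      show "B s i k = 0"
        by (rule range0[OF s]) (use pqr k in \<open>auto simp: A_def outer_def target_vec_def plane_vec_def split: option.split\<close>)
    qed
    then show ?thesis by (simp add: B A_def)
  qed
  \<comment> \<open>Writing the weights as values of linear functionals lets the sum over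
    \<open>s\<close> be taken inside, where it becomes the identity matrix.\<close>
  have key: "B s i a * cnj (B s j b)
      = (\<Sum>m\<in>UNIV. dual_coeff p q m (\<lambda>a b. \<Sum>i\<in>UNIV. B s i a * cnj (B s i b)) * (A m i a * cnj (A m j b)))"
    if s: "s < n" for s i a j b
  proof -
    obtain m0 \<beta> where m0: "\<And>i a. B s i a = \<beta> * A m0 i a"
      using single[OF s] by blast
    have "dual_coeff p q m (\<lambda>a b. \<Sum>i\<in>UNIV. B s i a * cnj (B s i b)) = (\<beta> * cnj \<beta>) * (if m = m0 then 1 else 0)" for m
    proof -
      have "(\<lambda>a b. \<Sum>i\<in>UNIV. B s i a * cnj (B s i b)) = (\<lambda>a b. (\<beta> * cnj \<beta>) * (\<Sum>i\<in>UNIV. A m0 i a * cnj (A m0 i b)))"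
        by (simp add: m0 sum_distrib_left mult_ac)
      then show ?thesis
        using dual_coeff_kraus[OF pqr(1), of m r m0] by (simp only: dual_coeff_scale A_def)
    qed
    then show ?thesis
      by (simp add: m0 if_distrib[of "\<lambda>y. y * _"] if_distrib[of "\<lambda>y. _ * y"] cong: if_cong)
  qed
  have gram: "(\<lambda>a b. \<Sum>s<n. \<Sum>i\<in>UNIV. B s i a * cnj (B s i b)) = (\<lambda>a b. if a = b then 1 else 0)"
    using f unfolding EBT_iff fB trace_preserving_kraus by blast
  show ?thesis
  proof (rule complex_linear_eqI)
    show "complex_linear f" "complex_linear (plane_map p q r)"
      using f by (auto simp: is_EBT_def is_CPT_def eb_imp_complex_linear plane_map_eb)
    fix a b i j
    have "f (mat_unit a b) $ i $ j = (\<Sum>s<n. B s i a * cnj (B s j b))"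
      by (simp add: fB)
    also have "\<dots> = (\<Sum>s<n. \<Sum>m\<in>UNIV. dual_coeff p q m (\<lambda>a b. \<Sum>i\<in>UNIV. B s i a * cnj (B s i b)) * (A m i a * cnj (A m j b)))"
      using key by (intro sum.cong) auto
    also have "\<dots> = (\<Sum>m\<in>UNIV. dual_coeff p q m (\<lambda>a b. \<Sum>s<n. \<Sum>i\<in>UNIV. B s i a * cnj (B s i b)) * (A m i a * cnj (A m j b)))"
      by (subst sum.swap) (simp add: dual_coeff_sum sum_distrib_right)
    also have "\<dots> = plane_map p q r (mat_unit a b) $ i $ j"
      unfolding gram dual_coeff_id[OF pqr(1)] plane_map_mat_unit A_def ..
    finally show "f (mat_unit a b) $ i $ j = plane_map p q r (mat_unit a b) $ i $ j" .
  qed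
qed

text \<open>For a classical-quantum map the operators \<open>F\<^sub>i = (\<Phi> (E\<^sub>a\<^sub>b)\<^sub>i\<^sub>i)\<^sub>a\<^sub>b\<close> are diagonal in a common
  orthonormal basis, so they commute.\<close>

lemma CQ_map_commute:
  assumes "CQ_map \<Phi>"
  shows "(\<Sum>b\<in>UNIV. \<Phi> (mat_unit a b) $ i $ i * \<Phi> (mat_unit b c) $ j $ j)
    = (\<Sum>b\<in>UNIV. \<Phi> (mat_unit a b) $ j $ j * \<Phi> (mat_unit b c) $ i $ i)"
proof -
  obtain e R where CQ: "CQ_form e R \<Phi>" using assms by (auto simp: CQ_map_def)
  have orth: "cinner (e j) (e k) = (if j = k then 1 else 0)" for j k
    using CQ by (simp add: CQ_form_def orthonormal_basis_def)
  have unit: "cinner x (mat_unit a b *v x) = cnj (x $ a) * x $ b" for x :: "complex^'a" and a b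
  proof -
    have "cinner x (mat_unit a b *v x)
      = (\<Sum>a'\<in>UNIV. \<Sum>b'\<in>UNIV. if a' = a \<and> b' = b then cnj (x $ a') * x $ b' else 0)"
      unfolding cinner_matrix by (intro sum.cong refl) (auto simp: mat_unit_def)
    then show ?thesis by (simp add: sum_delta2)
  qed
  have F: "\<Phi> (mat_unit a b) $ i $ i = (\<Sum>k\<in>UNIV. cnj (e k $ a) * e k $ b * R k $ i $ i)" for a b i
    using CQ by (simp add: CQ_form_def unit)
  have prod: "(\<Sum>b\<in>UNIV. \<Phi> (mat_unit a b) $ i $ i * \<Phi> (mat_unit b c) $ j $ j)
      = (\<Sum>k\<in>UNIV. cnj (e k $ a) * e k $ c * (R k $ i $ i * R k $ j $ j))" for i j
  proof -
    have "(\<Sum>b\<in>UNIV. \<Phi> (mat_unit a b) $ i $ i * \<Phi> (mat_unit b c) $ j $ j)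
      = (\<Sum>b\<in>UNIV. \<Sum>k\<in>UNIV. \<Sum>l\<in>UNIV. cnj (e k $ a) * e l $ c * (R k $ i $ i * R l $ j $ j) * (cnj (e l $ b) * e k $ b))"
      by (simp add: F sum_product mult_ac)
    also have "\<dots> = (\<Sum>k\<in>UNIV. \<Sum>l\<in>UNIV. cnj (e k $ a) * e l $ c * (R k $ i $ i * R l $ j $ j) * cinner (e l) (e k))"
      by (subst sum.swap, rule sum.cong[OF refl], subst sum.swap) (simp add: cinner_def sum_distrib_left)
    also have "\<dots> = (\<Sum>k\<in>UNIV. \<Sum>l\<in>UNIV. if l = k then cnj (e k $ a) * e l $ c * (R k $ i $ i * R l $ j $ j) else 0)"
      unfolding orth by (intro sum.cong refl) auto
    finally show ?thesis by simp
  qed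
  show ?thesis unfolding prod by (simp add: mult.commute)
qed

text \<open>On the plane the operators belonging to \<open>i = p\<close> and \<open>i = q\<close>
  are multiples of the projectors onto \<open>(1, 2)\<close> and \<open>(1, -2)\<close>. These
  vectors are neither parallel nor orthogonal, so the operators do not commute.\<close>

lemma plane_map_not_CQ:
  assumes pqr: "p \<noteq> q" "r \<noteq> p" "r \<noteq> q"
  shows "\<not> CQ_map (plane_map p q r)"
proof
  assume CQ: "CQ_map (plane_map p q r)"
  have F: "plane_map p q r (mat_unit a b) $ i $ i
      = (if a = p \<and> b = p then 1 / 8 else if a = q \<and> b = q then 1 / 2
         else if {a, b} = {p, q} then (if i = p then 1 / 4 else - 1 / 4) else 0)"
    if i: "i = p \<or> i = q" and ab: "a = p \<or> a = q \<or> b = p \<or> b = q" for a b i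
  proof -
    let ?g = "\<lambda>m. complex_of_real (plane_weight p q m) *
      (outer (target_vec p q r m) (plane_vec p q m) i a * cnj (outer (target_vec p q r m) (plane_vec p q m) i b))"
    have "plane_map p q r (mat_unit a b) $ i $ i = ?g None + (\<Sum>k\<in>UNIV. ?g (Some k))"
      unfolding plane_map_mat_unit sum_option ..
    also have "?g None = 0"
      using i pqr by (auto simp: outer_def target_vec_def)
    \<comment> \<open>An atom with \<open>k\<close> off the plane contributes only to the entry
      \<open>(k, k)\<close>, which \<open>ab\<close> excludes; of the two plane atoms only the one
      with target \<open>i\<close> reaches row \<open>i\<close>.\<close>
    also have "(\<Sum>k\<in>UNIV. ?g (Some k)) = (\<Sum>k\<in>UNIV. if k = i then ?g (Some i) else 0)"
      using i ab pqr by (intro sum.cong refl) (auto simp: outer_def target_vec_def plane_vec_def)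
    also have "\<dots> = ?g (Some i)" by simp
    also have "\<dots> = (if a = p \<and> b = p then 1 / 8 else if a = q \<and> b = q then 1 / 2
        else if {a, b} = {p, q} then (if i = p then 1 / 4 else - 1 / 4) else 0)"
      using i ab pqr
      by (auto simp: outer_def target_vec_def plane_vec_def plane_weight_def doubleton_eq_iff)
    finally show ?thesis by simp
  qed
  have expand: "(\<Sum>b\<in>UNIV. h b) = h p + h q" if "\<And>b. b \<notin> {p, q} \<Longrightarrow> h b = 0" for h :: "'a \<Rightarrow> complex"
  proof -
    have "(\<Sum>b\<in>UNIV. h b) = (\<Sum>b\<in>{p, q}. h b)"
      using that by (intro sum.mono_neutral_right) auto
    then show ?thesis using pqr(1) by simp
  qed
  have "(\<Sum>b\<in>UNIV. plane_map p q r (mat_unit p b) $ p $ p * plane_map p q r (mat_unit b q) $ q $ q) = 3 / 32"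
    by (subst expand) (use pqr in \<open>auto simp: F doubleton_eq_iff\<close>)
  moreover have "(\<Sum>b\<in>UNIV. plane_map p q r (mat_unit p b) $ q $ q * plane_map p q r (mat_unit b q) $ p $ p) = - 3 / 32"
    by (subst expand) (use pqr in \<open>auto simp: F doubleton_eq_iff\<close>)
  ultimately show False
    using CQ_map_commute[OF CQ, of p p q q] by simp
qed

lemma extreme_EBT_not_CQ:
  assumes "CARD('d::finite) \<ge> 3"
  shows "\<exists>\<Phi> :: 'd superop. \<Phi> extreme_point_of EBT_maps \<and> \<not> CQ_map (blinfun_apply \<Phi>)"
proof -
  obtain T :: "'d set" where "card T = 3"
    using obtain_subset_with_card_n[OF assms] by blast
  then obtain p q r :: 'd where pqr: "p \<noteq> q" "r \<noteq> p" "r \<noteq> q"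
    by (auto simp: card_3_iff)
  define \<Phi> :: "'d superop" where "\<Phi> = Blinfun (plane_map p q r)"
  have \<Phi>: "blinfun_apply \<Phi> = plane_map p q r"
    unfolding \<Phi>_def
    by (intro bounded_linear_Blinfun_apply complex_linear_imp_bounded_linear eb_imp_complex_linear plane_map_eb)
  have "\<Phi> extreme_point_of EBT_maps"
    unfolding EBT_maps_def
  proof (rule extreme_superopI, unfold \<Phi>)
    show "is_EBT (plane_map p q r)"
      by (intro eb_imp_EBT plane_map_eb plane_map_trace_preserving pqr)
    show "f = plane_map p q r" if "is_EBT f" "is_EBT g" "0 < u" "u < 1"
      "\<And>\<rho>. plane_map p q r \<rho> = u *\<^sub>R f \<rho> + (1 - u) *\<^sub>R g \<rho>" for f g u
      using plane_map_unique[OF pqr that(1) _ that(3-5)] that(2) by (simp add: is_EBT_def)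
  qed
  then show ?thesis
    using plane_map_not_CQ[OF pqr] \<Phi> by metis
qed


subsection \<open>The extreme point theorem\<close>

theorem theorem5:
  assumes "CARD('d::finite) \<ge> 2"
  shows
    "(\<forall>\<Phi> :: 'd superop. extreme_CQ_map (blinfun_apply \<Phi>) \<longrightarrow> \<Phi> extreme_point_of EBT_maps) \<and>
     (\<forall>\<Phi> :: 'd superop. extreme_CQ_map (blinfun_apply \<Phi>) \<longrightarrow>
        (\<forall>e \<psi>. pure_CQ_form e \<psi> (blinfun_apply \<Phi>) \<longrightarrow>
           (\<Phi> extreme_point_of CPT_maps \<longleftrightarrow> (\<forall>j k. cinner (\<psi> j) (\<psi> k) \<noteq> 0)))) \<and>
     (\<forall>\<Phi> :: 'd superop. \<Phi> \<in> EBT_maps \<and> \<Phi> extreme_point_of CPT_maps \<longrightarrow>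
        extreme_CQ_map (blinfun_apply \<Phi>)) \<and>
     (CARD('d) = 2 \<longrightarrow>
        {\<Phi> :: 'd superop. \<Phi> extreme_point_of EBT_maps} =
        {\<Phi>. extreme_CQ_map (blinfun_apply \<Phi>)}) \<and>
     (CARD('d) \<ge> 3 \<longrightarrow>
        (\<exists>\<Phi> :: 'd superop. \<Phi> extreme_point_of EBT_maps \<and> \<not> CQ_map (blinfun_apply \<Phi>)))"
proof (intro conjI allI impI)
  fix \<Phi> :: "'d superop"
  assume "extreme_CQ_map (blinfun_apply \<Phi>)"
  then show "\<Phi> extreme_point_of EBT_maps"
    using extreme_CQ_extreme_EBT by (auto simp: extreme_CQ_map_def)
next
  fix \<Phi> :: "'d superop" and e \<psi>
  assume "pure_CQ_form e \<psi> (blinfun_apply \<Phi>)"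
  then show "\<Phi> extreme_point_of CPT_maps \<longleftrightarrow> (\<forall>j k. cinner (\<psi> j) (\<psi> k) \<noteq> 0)"
    using extreme_CPT_CQ_imp_nonorthogonal extreme_CQ_extreme_CPT by blast
next
  fix \<Phi> :: "'d superop"
  assume "\<Phi> \<in> EBT_maps \<and> \<Phi> extreme_point_of CPT_maps"
  then show "extreme_CQ_map (blinfun_apply \<Phi>)"
    using extreme_CPT_EBT_imp_CQ by blast
next
  assume "CARD('d) = 2"
  then show "{\<Phi> :: 'd superop. \<Phi> extreme_point_of EBT_maps} = {\<Phi>. extreme_CQ_map (blinfun_apply \<Phi>)}"
    using extreme_EBT_qubit_imp_CQ extreme_CQ_extreme_EBT by (auto simp: extreme_CQ_map_def)
next
  assume "CARD('d) \<ge> 3"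
  then show "\<exists>\<Phi> :: 'd superop. \<Phi> extreme_point_of EBT_maps \<and> \<not> CQ_map (blinfun_apply \<Phi>)"
    by (rule extreme_EBT_not_CQ)
qed

end
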